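(* Let $n,p\in\mathbb N$ and let $L:\mathbb R[x]_{\le 2n}\to \mathbb S_p(\mathbb R)$ be a linear operator which admits a representing measure. Fix $t\in\mathbb R$ and $m\in\mathbb N\cup\{0\}$. Let $T_i:=L((x-t)^i)$ for $i\in\{0,\dots,2n\}$ and define the block matrices $$\mathcal M_1:=(T_{i+j-2})_{i,j=1}^{n+1},\qquad \mathcal M_2:=(T_{i+j-2})_{\substack{i=1,\dots,n,\\ j=1,\dots,n+2}}.$$ Denote by $\mathbf y_j$ the $j$-th (scalar) column of $\mathcal M_1$ and by $\mathbf u_j$ the $j$-th (scalar) column of $\mathcal M_2$. Let $$A:=\Big\{i\in\{1,\dots,p\}:\ \exists k\in\{1,\dots,n\}\text{ such that }\mathbf y_{kp+i}=\sum_{\ell=p+1}^{kp+i-1}\gamma_\ell\mathbf y_\ell\text{ for some }\gamma_\ell\in\mathbb R\text{ and }\mathbf y_{(k-1)p+i}\ne\sum_{\ell=1}^{(k-1)p+i-1}\delta_\ell\mathbf y_\ell\text{ for all }\delta_\ell\in\mathbb R\Big\},$$ $$B:=\Big\{i\in\{1,\dots,p\}:\ \mathbf u_{(n+1)p+i}=\sum_{\ell=p+1}^{(n+1)p+i-1}\gamma_\ell\mathbf u_\ell\text{ for some }\gamma_\ell\in\mathbb R\text{ and }\mathbf y_{np+i}\ne\sum_{\ell=1}^{np+i-1}\delta_\ell\mathbf y_\ell\text{ for all }\delta_\ell\in\mathbb R\Big\}.$$ Then the following statements are equivalent: (1) There exists a minimal representing measure $\mu$ for $L$ such that $\operatorname{mult}_\mu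 t=m$. (2) $\operatorname{card}A\le m\le\operatorname{card}(A\cup B)$. Moreover, write $B=\{i_1,\dots,i_{\operatorname{card}B}\}$ and $\{1,\dots,p\}\setminus B=\{j_1,\dots,j_{p-\operatorname{card}B}\}$. There is exactly one minimal representing measure $\mu$ for $L$ with $\operatorname{mult}_\mu t=m$ if and only if all of the following hold: (a) $B=\big\{i\in\{1,\dots,p\}:\ \mathbf y_{np+i}\ne\sum_{\ell=1}^{np+i-1}\delta_\ell\mathbf y_\ell\text{ for all }\delta_\ell\in\mathbb R\big\}$; (b) $m=\operatorname{card}(A\cup B)$; (c) $\ker\,(T_{i+j-2})_{\substack{i=1,\dots,n,\\ j=2,\dots,n+1}}\subseteq\ker\begin{pmatrix}\mathbf u_{(n+1)p+i_1}&\mathbf u_{(n+1)p+i_2}&\cdots&\mathbf u_{(n+1)p+i_{\operatorname{card}B}}\end{pmatrix}^T$; (d) $\ker\,(T_{i+j-2})_{\substack{i=1,\dots,n,\\ j=2,\dots,n+1}}\subseteq\ker\begin{pmatrix}\mathbf u_{(n+1)p+j_1}&\mathbf u_{(n+1)p+j_2}&\cdots&\mathbf u_{(n+1)p+j_{p-\operatorname{card}B}}\end{pmatrix}^T$.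
   Context: $\mathbb N=\{1,2,\dots\}$. $\mathbb R[x]_{\le k}$ is the space of real univariate polynomials of degree at most $k$; $\mathbb S_p(\mathbb R)$ is the space of real symmetric $p\times p$ matrices. A positive $\mathbb S_p(\mathbb R)$-valued measure is a map $\mu=(\mu_{ij})_{i,j=1}^p:\mathrm{Bor}(\mathbb R)\to\mathbb S_p(\mathbb R)$ such that every $\mu_{ij}$ is a real (signed) measure and $\mu(\Delta)$ is positive semidefinite for each Borel set $\Delta$. A polynomial $f$ is $\mu$-integrable if $f\in L^1(\tau)$ with $\tau=\sum_i\mu_{ii}$, and then $\int f\,d\mu:=(\int f\,d\mu_{ij})_{i,j=1}^p$. It is a representing measure for $L$ if $L(f)=\int_{\mathbb R}f\,d\mu$ for all $f\in\mathbb R[x]_{\le 2n}$. Let $M(n):=(L(x^{i+j-2}))_{i,j=1}^{n+1}$, a real symmetric $(n+1)p\times(n+1)p$ block matrix (the moment matrix of $L$). A representing measure for $L$ is minimal if it has the form $\mu=\sum_{j=1}^{\ell}\delta_{x_j}A_j$ with $\ell\in\mathbb N$, pairwise distinct $x_j\in\mathbb R$, nonzero positive semidefinite $A_j\in\mathbb S_p(\mathbb R)$, and $\sum_{j=1}^\ell\operatorname{rank}A_j=\operatorname{rank}M(n)$ (this is the smallest possible total rank of the masses among finitely atomic representing measures of $L$). Here $\delta_{x}$ is the Dirac measure at $x$. The multiplicity of $t$ in $\mu$ is $\operatorname{mult}_\mu t:=\operatorname{rank}\mu(\{t\})$ (which is $0$ if $t$ is not an atom). Empty sums equal $0$; a matrix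 with no columns has a transpose whose kernel is the whole space.
   Formalization: A minimal representing measure may have ℓ = 0 atoms (the zero measure); with ℓ ≥ 1 the equivalence fails for L = 0, m = 0, where (2) holds but no nonzero masses have total rank 0. For L ≠ 0 nothing changes. *)

theory Defs
  imports
    "HOL-Analysis.Bochner_Integration"
    "HOL-Computational_Algebra.Polynomial"
    "Jordan_Normal_Form.DL_Rank"
    "Jordan_Normal_Form.Matrix_Kernel"
begin

section \<open>Real symmetric matrices\<close>

definition sym_mats :: "nat \<Rightarrow> real mat set" where
  "sym_mats p = {A \<in> carrier_mat p p. transpose_mat A = A}"

definition psd :: "nat \<Rightarrow> real mat \<Rightarrow> bool" where
  "psd p A \<longleftrightarrow> A \<in> sym_mats p \<and> (\<forall>v \<in> carrier_vec p. 0 \<le> scalar_prod v (A *\<^sub>v v))"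

definition mat_rank :: "real mat \<Rightarrow> nat" where
  "mat_rank A = vec_space.rank (dim_row A) A"

text \<open>The \<open>r \<times> c\<close> block matrix with \<open>p \<times> p\<close> blocks \<open>F i j\<close>. Block indices, like matrix
  indices, start at 0.\<close>

definition block_mat :: "nat \<Rightarrow> nat \<Rightarrow> nat \<Rightarrow> (nat \<Rightarrow> nat \<Rightarrow> real mat) \<Rightarrow> real mat" where
  "block_mat p r c F =
     mat (r * p) (c * p) (\<lambda>(a, b). F (a div p) (b div p) $$ (a mod p, b mod p))"

definition is_lincomb :: "nat \<Rightarrow> (nat \<Rightarrow> real vec) \<Rightarrow> nat set \<Rightarrow> real vec \<Rightarrow> bool" where
  "is_lincomb d w I v \<longleftrightarrow> (\<exists>\<gamma>. v = finsum_vec TYPE(real) d (\<lambda>l. \<gamma> l \<cdot>\<^sub>v w l) I)"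


section \<open>Signed and matrix-valued measures on the real line\<close>

definition signed_borel_measure :: "(real set \<Rightarrow> real) \<Rightarrow> bool" where
  "signed_borel_measure \<nu> \<longleftrightarrow> \<nu> {} = 0 \<and>
     (\<forall>E :: nat \<Rightarrow> real set. range E \<subseteq> sets borel \<longrightarrow> disjoint_family E \<longrightarrow>
        (\<lambda>i. \<nu> (E i)) sums \<nu> (\<Union>i. E i))"

text \<open>The positive variation of the Jordan decomposition. Negative values of \<open>\<nu>\<close> are truncated
  to 0 by \<^const>\<open>ennreal\<close>, which does not change the supremum because \<open>E = {}\<close> is allowed.
  The negative variation of \<open>\<nu>\<close> is the positive variation of \<open>- \<nu>\<close>.\<close>

definition pos_variation :: "(real set \<Rightarrow> real) \<Rightarrow> real measure" where
  "pos_variation \<nu> =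
     measure_of UNIV (sets borel) (\<lambda>D. SUP E \<in> {E \<in> sets borel. E \<subseteq> D}. ennreal (\<nu> E))"

definition signed_integral :: "(real set \<Rightarrow> real) \<Rightarrow> (real \<Rightarrow> real) \<Rightarrow> real" where
  "signed_integral \<nu> f =
     integral\<^sup>L (pos_variation \<nu>) f - integral\<^sup>L (pos_variation (\<lambda>E. - \<nu> E)) f"

text \<open>Maps on the Borel sets are extensional functions (\<^const>\<open>undefined\<close> off the Borel sets), so
  that equality of HOL functions is equality of measures.\<close>

definition psd_measure :: "nat \<Rightarrow> (real set \<Rightarrow> real mat) \<Rightarrow> bool" where
  "psd_measure p \<mu> \<longleftrightarrow>
     \<mu> \<in> sets borel \<rightarrow>\<^sub>E sym_mats p \<and>
     (\<forall>i < p. \<forall>j < p. signed_borel_measure (\<lambda>D. \<mu> D $$ (i, j))) \<and>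
     (\<forall>D \<in> sets borel. psd p (\<mu> D))"

definition trace_measure :: "nat \<Rightarrow> (real set \<Rightarrow> real mat) \<Rightarrow> real measure" where
  "trace_measure p \<mu> = measure_of UNIV (sets borel) (\<lambda>D. ennreal (\<Sum>i < p. \<mu> D $$ (i, i)))"

definition mat_integral :: "nat \<Rightarrow> (real set \<Rightarrow> real mat) \<Rightarrow> (real \<Rightarrow> real) \<Rightarrow> real mat" where
  "mat_integral p \<mu> f = mat p p (\<lambda>(i, j). signed_integral (\<lambda>D. \<mu> D $$ (i, j)) f)"

definition mult_at :: "(real set \<Rightarrow> real mat) \<Rightarrow> real \<Rightarrow> nat" where
  "mult_at \<mu> t = mat_rank (\<mu> {t})"

definition atomic_measure ::
    "nat \<Rightarrow> nat \<Rightarrow> (nat \<Rightarrow> real) \<Rightarrow> (nat \<Rightarrow> real mat) \<Rightarrow> real set \<Rightarrow> real mat" where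
  "atomic_measure p l x A = (\<lambda>D \<in> sets borel.
     mat p p (\<lambda>(a, b). \<Sum>j = 1..l. indicator D (x j) * A j $$ (a, b)))"


section \<open>Truncated matricial moment functionals\<close>

text \<open>An operator on the polynomials of degree at most \<open>d\<close> is a total function on all
  polynomials whose values in higher degree are irrelevant.\<close>

definition linear_operator :: "nat \<Rightarrow> nat \<Rightarrow> (real poly \<Rightarrow> real mat) \<Rightarrow> bool" where
  "linear_operator p d L \<longleftrightarrow>
     (\<forall>f. degree f \<le> d \<longrightarrow> L f \<in> sym_mats p) \<and>
     (\<forall>f g. degree f \<le> d \<longrightarrow> degree g \<le> d \<longrightarrow> L (f + g) = L f + L g) \<and>
     (\<forall>c f. degree f \<le> d \<longrightarrow> L (Polynomial.smult c f) = c \<cdot>\<^sub>m L f)"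

definition representing_measure ::
    "nat \<Rightarrow> nat \<Rightarrow> (real poly \<Rightarrow> real mat) \<Rightarrow> (real set \<Rightarrow> real mat) \<Rightarrow> bool" where
  "representing_measure p d L \<mu> \<longleftrightarrow> psd_measure p \<mu> \<and>
     (\<forall>f. degree f \<le> d \<longrightarrow>
        integrable (trace_measure p \<mu>) (poly f) \<and> L f = mat_integral p \<mu> (poly f))"

definition moment_matrix :: "nat \<Rightarrow> nat \<Rightarrow> (real poly \<Rightarrow> real mat) \<Rightarrow> real mat" where
  "moment_matrix p n L = block_mat p (n + 1) (n + 1) (\<lambda>i j. L (monom 1 (i + j)))"

text \<open>The number \<open>l\<close> of atoms may be 0. This happens only for \<open>L = 0\<close>, whose only
  representing measure is the zero measure (an empty sum); for \<open>L \<noteq> 0\<close> the rank condition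
  forces \<open>l \<ge> 1\<close>.\<close>

definition minimal_measure ::
    "nat \<Rightarrow> nat \<Rightarrow> (real poly \<Rightarrow> real mat) \<Rightarrow> (real set \<Rightarrow> real mat) \<Rightarrow> bool" where
  "minimal_measure p n L \<mu> \<longleftrightarrow> representing_measure p (2 * n) L \<mu> \<and>
     (\<exists>l x A. inj_on x {1..l} \<and>
        (\<forall>j \<in> {1..l}. psd p (A j) \<and> A j \<noteq> 0\<^sub>m p p) \<and>
        \<mu> = atomic_measure p l x A \<and>
        (\<Sum>j = 1..l. mat_rank (A j)) = mat_rank (moment_matrix p n L))"

end

theory Submission
  imports Defs "HOL-Analysis.Linear_Algebra" "HOL-Analysis.Radon_Nikodym"
    "HOL-Computational_Algebra.Fundamental_Theorem_Algebra"
begin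

text \<open>
  Since \<open>L\<close> has a representing measure, the moment matrix in powers of \<open>x - t\<close> is the Gram matrix of
  vectors \<open>v l\<close> spanning a space \<open>K\<close>, and \<open>v l \<mapsto> v (l + p)\<close> extends to a linear map \<open>X\<close> on the
  span \<open>V\<close> of the first \<open>n * p\<close> of them. By the spectral theorem, the minimal representing measures
  correspond bijectively to the self-adjoint operators \<open>S\<close> on \<open>K\<close> that extend \<open>X\<close>; the atoms are the
  eigenvalues shifted by \<open>t\<close>, and the multiplicity of \<open>t\<close> is the dimension of the kernel of \<open>S\<close>.

  Let \<open>G\<close> be the orthogonal complement of \<open>X V\<close> in \<open>K\<close>. The kernel of \<open>S\<close> lies in \<open>G\<close> and meets
  \<open>V\<close> in \<open>ker X\<close>, so its dimension lies between \<open>dim (ker X)\<close> and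
  \<open>dim (ker X) + dim (V + G) - dim V\<close>. Prescribing the quadratic form of \<open>S\<close> on a basis
  adapted to \<open>V \<subseteq> V + G \<subseteq> K\<close> attains all these values, and \<open>S\<close> is unique exactly if
  \<open>V + G = K\<close> and the kernel is as large as possible. Counting pivot columns shows that
  \<open>card A = dim (ker X)\<close> and \<open>card B = dim (V + G) - dim V\<close>; conditions (c) and (d) together say that
  \<open>X V\<close> contains no nonzero vector orthogonal to \<open>V\<close>, that is \<open>V + G = K\<close>.
\<close>

section \<open>Finite-dimensional subspaces\<close>

text \<open>What \<open>L\<close> leaves free is the moment of order \<open>2n + 1\<close>. An
  extension \<open>S\<close> is known on \<open>v l\<close> for \<open>l < n * p\<close>, so its
  form can vary only on the last block, \<open>v (n * p)\<close> to
  \<open>v (n * p + p - 1)\<close>, and \<open>B\<close> selects indices of that block. The rows of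
  the second matrix pair with \<open>v p\<close>, \<open>v (p + 1)\<close>, ..., a spanning family
  of \<open>X V\<close>, so its columns show a vector only modulo \<open>G\<close>; this turns the
  condition that defines \<open>B\<close> into a statement about \<open>V + G\<close>. Minimality
  enters through dimensions: the total rank of the masses is the dimension of the L^2 space of the
  measure. If it equals \<open>dim K\<close>, then the isometric copy of \<open>K\<close> fills that
  space, and multiplication by \<open>x - t\<close> becomes an operator on \<open>K\<close>. The
  moment matrix may be singular. Hence the \<open>v l\<close> may be dependent or repeated, and
  every map prescribed on such a family has to respect all relations in it. The given representing
  measure is used for two facts: positivity of the form, and the inheritance of relations under the
  shift, which makes \<open>X\<close> well defined.\<close>

text \<open>The dimension theory of \<open>euclidean_space\<close> is not applicable: the vectors below live in an
  infinite-dimensional type.\<close>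

definition findim :: "'a::real_vector set \<Rightarrow> bool" where
  "findim U \<longleftrightarrow> (\<exists>B. finite B \<and> span B = U)"

lemma findim_span: "finite B \<Longrightarrow> findim (span B)"
  by (auto simp: findim_def)

lemma findim_subspace: "findim U \<Longrightarrow> real_vector.subspace U"
  by (auto simp: findim_def real_vector.subspace_span)

lemma findim_basis:
  assumes "findim U"
  obtains B where "finite B" "independent B" "span B = U" "card B = dim U"
proof -
  from assms obtain F where F: "finite F" "span F = U" by (auto simp: findim_def)
  obtain B where B: "B \<subseteq> F" "independent B" "F \<subseteq> span B" "card B = dim F"
    by (rule real_vector.basis_exists)
  have "span B = U"
    using B(1,3) F(2) by (metis real_vector.span_eq real_vector.span_superset subset_trans)
  with B F show ?thesis
    by (intro that[of B]) (auto intro: finite_subset simp: real_vector.dim_span)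
qed

lemma findim_subset:
  assumes "real_vector.subspace U" "U \<subseteq> K" "findim K"
  shows "findim U"
proof -
  obtain F where F: "finite F" "span F = K" using assms(3) by (auto simp: findim_def)
  obtain B where B: "B \<subseteq> U" "independent B" "U \<subseteq> span B"
    by (rule real_vector.maximal_independent_subset)
  have "finite B"
    using real_vector.independent_span_bound[OF F(1) B(2)] B(1) assms(2) F(2) by auto
  moreover have "span B = U"
    using B assms(1) by (metis real_vector.span_minimal subset_antisym)
  ultimately show ?thesis by (auto simp: findim_def)
qed

lemma span_findim: "findim U \<Longrightarrow> span U = U"
  by (metis findim_subspace real_vector.span_eq_iff)

lemma findim_basis_extend:
  assumes K: "findim K" and S: "independent S" "S \<subseteq> U" "U \<subseteq> K"
  obtains B where "finite B" "S \<subseteq> B" "B \<subseteq> U" "independent B" "span B = span U"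
    "card B = dim U"
proof -
  obtain B where B: "S \<subseteq> B" "B \<subseteq> U" "independent B" "U \<subseteq> span B"
    by (rule real_vector.maximal_independent_subset_extend[OF S(2,1)])
  obtain F where F: "finite F" "span F = K" using assms(1) by (auto simp: findim_def)
  have "finite B"
    using real_vector.independent_span_bound[OF F(1) B(3)] B(2) assms(4) F(2) by auto
  moreover have sp: "span B = span U"
    using B by (metis real_vector.span_eq real_vector.span_superset subset_trans)
  moreover have "card B = dim U" using real_vector.dim_eq_card[OF sp B(3)] by simp
  ultimately show ?thesis using B that by blast
qed

lemma dim_mono_findim:
  assumes "U \<subseteq> K" "findim K"
  shows "dim U \<le> dim K"
proof -
  obtain B where B: "finite B" "span B = K" "card B = dim K"
    using findim_basis[OF assms(2)] by metis
  show ?thesis using real_vector.dim_le_card[of U B] B assms(1) by auto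
qed

lemma findim_eqI:
  assumes "real_vector.subspace U" "U \<subseteq> K" "findim K" "dim K \<le> dim U"
  shows "U = K"
proof -
  have fU: "findim U" by (rule findim_subset[OF assms(1-3)])
  obtain B where B: "finite B" "independent B" "span B = U" "card B = dim U"
    using findim_basis[OF fU] .
  have "B \<subseteq> K" using B(3) assms(2) real_vector.span_superset by blast
  then obtain C where C: "finite C" "B \<subseteq> C" "C \<subseteq> K" "independent C" "span C = span K" "card C = dim K"
    using findim_basis_extend[OF assms(3) B(2) _ subset_refl] by metis
  have "B = C" using C B assms(4) by (simp add: card_seteq)
  then show ?thesis using B(3) C(5) span_findim[OF assms(3)] by simp
qed

lemma subspace_kernel_on:
  assumes "linear f" "real_vector.subspace V"
  shows "real_vector.subspace {x \<in> V. f x = 0}"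
  using assms by (auto simp: real_vector.subspace_def linear_0 linear_add linear_scale)

lemma independent_span_disjoint:
  assumes C: "independent C" "finite C" and B: "B \<subseteq> C"
  shows "span (C - B) \<inter> span B \<subseteq> {0}"
proof
  fix w assume w: "w \<in> span (C - B) \<inter> span B"
  have fB: "finite B" "finite (C - B)" using C(2) B finite_subset by auto
  obtain f where f: "w = (\<Sum>c\<in>C - B. f c *\<^sub>R c)"
    using w real_vector.span_finite[OF fB(2)] by auto
  obtain g where g: "w = (\<Sum>c\<in>B. g c *\<^sub>R c)"
    using w real_vector.span_finite[OF fB(1)] by auto
  define h where "h = (\<lambda>c. if c \<in> B then - g c else f c)"
  have "(\<Sum>c\<in>C. h c *\<^sub>R c) = (\<Sum>c\<in>C - B. h c *\<^sub>R c) + (\<Sum>c\<in>B. h c *\<^sub>R c)"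
    using sum.subset_diff[OF B C(2)] by auto
  also have "(\<Sum>c\<in>C - B. h c *\<^sub>R c) = w" unfolding f by (rule sum.cong) (auto simp: h_def)
  also have "(\<Sum>c\<in>B. h c *\<^sub>R c) = - w"
    unfolding g sum_negf[symmetric] by (rule sum.cong) (auto simp: h_def)
  finally have "(\<Sum>c\<in>C. h c *\<^sub>R c) = 0" by simp
  then have "\<forall>c\<in>C. h c = 0"
    using C(1) real_vector.dependent_finite[OF C(2)] by blast
  then have "w = (\<Sum>c\<in>C - B. 0)" unfolding f by (intro sum.cong) (auto simp: h_def split: if_splits)
  then show "w \<in> {0}" by simp
qed

lemma rank_nullity:
  fixes f :: "'a::real_vector \<Rightarrow> 'b::real_vector"
  assumes f: "linear f" and V: "findim V"
  shows "dim V = dim {x \<in> V. f x = 0} + dim (f ` V)"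
proof -
  let ?N = "{x \<in> V. f x = 0}"
  have sN: "real_vector.subspace ?N"
    by (rule subspace_kernel_on[OF f findim_subspace[OF V]])
  have fN: "findim ?N" by (rule findim_subset[OF sN _ V]) auto
  obtain B where B: "finite B" "independent B" "span B = ?N" "card B = dim ?N"
    using findim_basis[OF fN] .
  have BV: "B \<subseteq> V" using B(3) real_vector.span_superset by fastforce
  obtain C where C: "finite C" "B \<subseteq> C" "C \<subseteq> V" "independent C" "span C = span V" "card C = dim V"
    using findim_basis_extend[OF V B(2) BV subset_refl] by metis
  have spC: "span C = V" using C(5) span_findim[OF V] by simp
  have inj: "inj_on f (span (C - B))"
  proof (rule inj_onI)
    fix x y assume xy: "x \<in> span (C - B)" "y \<in> span (C - B)" "f x = f y"
    have d: "x - y \<in> span (C - B)" using xy by (simp add: real_vector.span_diff)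
    have "x - y \<in> V" using d spC real_vector.span_mono[of "C - B" C] by auto
    then have "x - y \<in> span B" using xy(3) f B(3) by (simp add: linear_diff)
    moreover have "span (C - B) \<inter> span B \<subseteq> {0}"
      by (rule independent_span_disjoint[OF C(4,1,2)])
    ultimately have "x - y = 0" using d by blast
    then show "x = y" by simp
  qed
  have im: "f ` V = span (f ` (C - B))"
  proof -
    have "f ` V = span (f ` C)" using spC f by (metis linear_span_image)
    also have "\<dots> = span (f ` (C - B))"
    proof (rule subset_antisym; rule real_vector.span_minimal)
      show "f ` C \<subseteq> span (f ` (C - B))"
      proof
        fix z assume "z \<in> f ` C"
        then obtain c where c: "c \<in> C" "z = f c" by auto
        show "z \<in> span (f ` (C - B))"
        proof (cases "c \<in> B")
          case True
          then have "f c = 0" using B(3) real_vector.span_base[of c B] by auto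
          then show ?thesis using c by (simp add: real_vector.span_zero)
        next
          case False
          then show ?thesis using c by (auto intro: real_vector.span_base)
        qed
      qed
      show "f ` (C - B) \<subseteq> span (f ` C)"
        using real_vector.span_superset by fastforce
    qed (auto simp: real_vector.subspace_span)
    finally show ?thesis .
  qed
  have ind: "independent (f ` (C - B))"
    using linear_independent_injective_image[OF f _ inj]
      real_vector.independent_mono[OF C(4)] by blast
  have "dim (f ` V) = card (f ` (C - B))"
    using ind im real_vector.dim_span_eq_card_independent by metis
  also have "\<dots> = card (C - B)"
    by (meson card_image inj inj_on_subset real_vector.span_superset)
  also have "\<dots> = card C - card B" using B(1) C(2) by (simp add: card_Diff_subset)
  finally show ?thesis using B(4) C(6) card_mono[OF C(1,2)] by simp
qed

text \<open>Each counted index raises the dimension of the span by exactly one, and every other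
  index leaves it unchanged. This is how conditions of the kind "not a combination of the preceding
  columns" become dimensions.\<close>

lemma card_pivots:
  fixes v :: "nat \<Rightarrow> 'a::real_vector"
  assumes U: "real_vector.subspace U" and K: "findim K" and ab: "a \<le> b"
    and sub: "U \<subseteq> K" "v ` {a..<b} \<subseteq> K"
  shows "card {l \<in> {a..<b}. v l \<notin> span (U \<union> v ` {a..<l})} + dim U = dim (span (U \<union> v ` {a..<b}))"
  using ab sub(2)
proof (induction b rule: dec_induct)
  case base
  then show ?case by (simp add: real_vector.dim_span)
next
  case (step b)
  let ?S = "U \<union> v ` {a..<b}"
  let ?P = "\<lambda>b. {l \<in> {a..<b}. v l \<notin> span (U \<union> v ` {a..<l})}"
  have IH: "card (?P b) + dim U = dim (span ?S)"
    using step.IH step.prems step.hyps by (auto simp: atLeastLessThanSuc)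
  have SK: "?S \<subseteq> K" "v b \<in> K" using step.prems step.hyps sub(1) by auto
  have eq: "U \<union> v ` {a..<Suc b} = insert (v b) ?S"
    using step.hyps by (auto simp: atLeastLessThanSuc)
  show ?case
  proof (cases "v b \<in> span ?S")
    case True
    then have "?P (Suc b) = ?P b" using step.hyps by (auto simp: less_Suc_eq)
    moreover have "span (insert (v b) ?S) = span ?S"
      using True by (rule real_vector.span_redundant)
    ultimately show ?thesis using IH eq by simp
  next
    case False
    then have "?P (Suc b) = insert b (?P b)" using step.hyps by (auto simp: less_Suc_eq)
    then have c: "card (?P (Suc b)) = Suc (card (?P b))" by simp
    obtain B where B: "finite B" "B \<subseteq> ?S" "independent B" "span B = span ?S" "card B = dim ?S"
      using findim_basis_extend[OF K real_vector.independent_empty _ SK(1)] by (metis empty_subsetI)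
    have nb: "v b \<notin> span B" using False B by simp
    have "independent (insert (v b) B)"
      using nb B(3) real_vector.independent_insertI by blast
    moreover have "span (insert (v b) B) = span (insert (v b) ?S)"
      using B(4) by (auto simp: real_vector.span_insert)
    ultimately have "dim (span (insert (v b) ?S)) = card (insert (v b) B)"
      by (metis real_vector.dim_span_eq_card_independent)
    also have "\<dots> = Suc (card B)" using B(1) nb real_vector.span_base[of "v b" B] by (auto simp: card_insert_if)
    finally show ?thesis using c IH eq B(5) by (simp add: real_vector.dim_span)
  qed
qed

text \<open>Coefficients are attached to indices and not to vectors, because \<open>v\<close> need
  not be injective: a family of columns may contain repetitions. The proof picks one index per
  vector and pads with zeros.\<close>

lemma span_image_explicit:
  fixes v :: "'b \<Rightarrow> 'a::real_vector"
  assumes "finite J"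
  shows "x \<in> span (v ` J) \<longleftrightarrow> (\<exists>\<gamma>. x = (\<Sum>j\<in>J. \<gamma> j *\<^sub>R v j))"
proof
  assume "\<exists>\<gamma>. x = (\<Sum>j\<in>J. \<gamma> j *\<^sub>R v j)"
  then obtain \<gamma> where x: "x = (\<Sum>j\<in>J. \<gamma> j *\<^sub>R v j)" by blast
  show "x \<in> span (v ` J)" unfolding x
    by (rule real_vector.span_sum, rule real_vector.span_scale, rule real_vector.span_base) simp
next
  obtain I where I: "I \<subseteq> J" "inj_on v I" "v ` I = v ` J"
    by (metis subset_image_inj subset_refl)
  assume "x \<in> span (v ` J)"
  then obtain g where "x = (\<Sum>b\<in>v ` I. g b *\<^sub>R b)"
    using real_vector.span_finite[of "v ` I"] assms I(3) by auto
  also have "\<dots> = (\<Sum>j\<in>I. g (v j) *\<^sub>R v j)" using I(2) by (simp add: sum.reindex)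
  also have "\<dots> = (\<Sum>j\<in>J. (if j \<in> I then g (v j) else 0) *\<^sub>R v j)"
    using I(1) assms by (intro sum.mono_neutral_cong_left) auto
  finally show "\<exists>\<gamma>. x = (\<Sum>j\<in>J. \<gamma> j *\<^sub>R v j)"
    by (intro exI[of _ "\<lambda>j. if j \<in> I then g (v j) else 0"])
qed

section \<open>Self-adjoint operators and Gram matrices\<close>

lemma inner_span_0:
  fixes x :: "'a::real_inner"
  assumes "\<And>b. b \<in> B \<Longrightarrow> inner x b = 0" "w \<in> span B"
  shows "inner x w = 0"
  using orthogonal_to_span[of w B x] assms by (simp add: real_inner_class.orthogonal_def)

lemma inner_0_span:
  fixes x :: "'a::real_inner"
  assumes "\<And>b. b \<in> B \<Longrightarrow> inner b x = 0" "w \<in> span B"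
  shows "inner w x = 0"
  using inner_span_0[of B x w] assms by (simp add: inner_commute)

lemma orth_decomp:
  fixes U :: "'a::real_inner set"
  assumes "findim U"
  obtains u where "u \<in> U" "\<And>w. w \<in> U \<Longrightarrow> inner (x - u) w = 0"
proof -
  obtain B where "finite B" "span B = U" using assms by (auto simp: findim_def)
  then obtain C where C: "finite C" "span C = U" "pairwise real_inner_class.orthogonal C"
    using basis_orthogonal[of B] by auto
  define u where "u = (\<Sum>c\<in>C. (inner x c / inner c c) *\<^sub>R c)"
  have "u \<in> U" unfolding u_def C(2)[symmetric]
    by (rule real_vector.span_sum, rule real_vector.span_scale, rule real_vector.span_base)
  moreover have "inner (x - u) w = 0" if "w \<in> U" for w
  proof (rule inner_span_0[of C])
    fix b assume b: "b \<in> C"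
    have "inner u b = (\<Sum>c\<in>C. if c = b then inner x b else 0)"
      unfolding u_def inner_sum_left
      using C(3) b by (intro sum.cong) (auto simp: pairwise_def real_inner_class.orthogonal_def)
    then show "inner (x - u) b = 0" using C(1) b by (simp add: inner_diff_left)
  qed (use that C(2) in auto)
  ultimately show ?thesis using that by blast
qed

text \<open>The difference between \<open>w\<close> and its projection \<open>u\<close> to
  \<open>U\<close> lies in \<open>K\<close> and is orthogonal to \<open>U\<close>, so the hypothesis
  makes it orthogonal to \<open>w\<close>, hence to itself. Membership in a subspace is thus tested
  against its complement in \<open>K\<close>.\<close>

lemma double_complement:
  fixes K :: "'a::real_inner set"
  assumes U: "findim U" "U \<subseteq> K" and K: "real_vector.subspace K" and w: "w \<in> K"
    and perp: "\<And>k. k \<in> K \<Longrightarrow> (\<And>u. u \<in> U \<Longrightarrow> inner k u = 0) \<Longrightarrow> inner w k = 0"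
  shows "w \<in> U"
proof -
  obtain u where u: "u \<in> U" "\<And>z. z \<in> U \<Longrightarrow> inner (w - u) z = 0"
    using orth_decomp[OF U(1), of w] by metis
  have "inner w (w - u) = 0"
    using u U(2) w K by (intro perp real_vector.subspace_diff) auto
  then have "inner (w - u) (w - u) = 0"
    using u by (simp add: inner_diff_left inner_diff_right inner_commute)
  then show ?thesis using u(1) by simp
qed

text \<open>The vector dual to \<open>b\<close> is the component of \<open>b\<close> orthogonal to
  the span of the other basis vectors, rescaled so that its inner product with \<open>b\<close> is
  1.\<close>

lemma dual_basis:
  fixes B :: "'a::real_inner set"
  assumes "finite B" "independent B"
  obtains d where "\<And>b. b \<in> B \<Longrightarrow> d b \<in> span B"
    "\<And>b b'. b \<in> B \<Longrightarrow> b' \<in> B \<Longrightarrow> inner (d b) b' = (if b = b' then 1 else 0)"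
proof -
  have "\<exists>e \<in> span B. \<forall>b' \<in> B. inner e b' = (if b = b' then 1 else 0)" if b: "b \<in> B" for b
  proof -
    have f: "findim (span (B - {b}))" using assms(1) by (intro findim_span) auto
    obtain u where u: "u \<in> span (B - {b})" "\<And>z. z \<in> span (B - {b}) \<Longrightarrow> inner (b - u) z = 0"
      using orth_decomp[OF f, of b] by metis
    have "b \<notin> span (B - {b})" using assms(2) b by (auto simp: real_vector.dependent_def)
    then have ne: "inner (b - u) (b - u) \<noteq> 0" using u(1) by auto
    have eb: "inner (b - u) b = inner (b - u) (b - u)"
      using u by (simp add: inner_diff_right)
    have "u \<in> span B" using u(1) real_vector.span_mono[of "B - {b}" B] by auto
    then have "(1 / inner (b - u) (b - u)) *\<^sub>R (b - u) \<in> span B"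
      using b by (simp add: real_vector.span_scale real_vector.span_diff real_vector.span_base)
    moreover have "inner ((1 / inner (b - u) (b - u)) *\<^sub>R (b - u)) b' = (if b = b' then 1 else 0)"
      if "b' \<in> B" for b'
    proof (cases "b = b'")
      case True
      then show ?thesis using eb ne by simp
    next
      case False
      then have "inner (b - u) b' = 0"
        using that by (intro u(2) real_vector.span_base) auto
      then show ?thesis using False by simp
    qed
    ultimately show ?thesis by blast
  qed
  then show ?thesis using that by metis
qed

lemma selfadjoint_span:
  fixes S :: "'a::real_inner \<Rightarrow> 'a"
  assumes S: "linear S" and B: "\<And>b b'. b \<in> B \<Longrightarrow> b' \<in> B \<Longrightarrow> inner (S b) b' = inner b (S b')"
    and xy: "x \<in> span B" "y \<in> span B"
  shows "inner (S x) y = inner x (S y)"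
proof -
  have 1: "inner (S b) y = inner b (S y)" if "b \<in> B" for b
    using xy(2)
  proof (rule real_vector.span_induct)
    show "real_vector.subspace {y. inner (S b) y = inner b (S y)}"
      using S by (auto simp: real_vector.subspace_def linear_0 linear_add linear_scale inner_add_right)
  qed (use B that in auto)
  show ?thesis using xy(1)
  proof (rule real_vector.span_induct)
    show "real_vector.subspace {x. inner (S x) y = inner x (S y)}"
      using S by (auto simp: real_vector.subspace_def linear_0 linear_add linear_scale inner_add_left)
  qed (use 1 in auto)
qed

text \<open>Prescribed matrix entries are realised by the dual basis: \<open>S b\<close> is the
  combination of dual vectors with coefficients \<open>\<beta> b c\<close>. For symmetric
  \<open>\<beta>\<close>, self-adjointness then comes from \<open>selfadjoint_span\<close>.\<close>

lemma operator_of_form: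
  fixes B :: "'a::real_inner set"
  assumes B: "finite B" "independent B"
  obtains S where "linear S" "S ` span B \<subseteq> span B"
    "\<And>b b'. b \<in> B \<Longrightarrow> b' \<in> B \<Longrightarrow> inner (S b) b' = \<beta> b b'"
proof -
  obtain d where d: "\<And>b. b \<in> B \<Longrightarrow> d b \<in> span B"
    "\<And>b b'. b \<in> B \<Longrightarrow> b' \<in> B \<Longrightarrow> inner (d b) b' = (if b = b' then 1 else 0)"
    using dual_basis[OF B] by metis
  define h where "h = (\<lambda>b. \<Sum>c\<in>B. \<beta> b c *\<^sub>R d c)"
  have hB: "h b \<in> span B" for b
    unfolding h_def using d(1) by (intro real_vector.span_sum real_vector.span_scale)
  obtain S where S: "linear S" "\<And>b. b \<in> B \<Longrightarrow> S b = h b"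
    using linear_independent_extend[OF B(2), of h] by auto
  show ?thesis
  proof (rule that[OF S(1)])
    have "S ` span B = span (S ` B)" using S(1) by (simp add: linear_span_image)
    also have "\<dots> \<subseteq> span B"
      using S(2) hB by (intro real_vector.span_minimal) (auto simp: real_vector.subspace_span)
    finally show "S ` span B \<subseteq> span B" .
    fix b b' assume bb: "b \<in> B" "b' \<in> B"
    have "inner (S b) b' = (\<Sum>c\<in>B. if c = b' then \<beta> b b' else 0)"
      unfolding S(2)[OF bb(1)] h_def inner_sum_left using d(2) bb by (intro sum.cong) auto
    then show "inner (S b) b' = \<beta> b b'" using B(1) bb by simp
  qed
qed

section \<open>Families with prescribed relations or a prescribed Gram matrix\<close>

lemma gram_sum_eq:
  fixes v :: "'i \<Rightarrow> 'a::real_inner" and w :: "'i \<Rightarrow> 'b::real_inner"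
  assumes "\<And>i j. i \<in> I \<Longrightarrow> j \<in> I \<Longrightarrow> inner (v i) (v j) = inner (w i) (w j)"
  shows "inner (\<Sum>i\<in>I. c i *\<^sub>R v i) (\<Sum>i\<in>I. e i *\<^sub>R v i) = inner (\<Sum>i\<in>I. c i *\<^sub>R w i) (\<Sum>i\<in>I. e i *\<^sub>R w i)"
  unfolding inner_sum_left inner_sum_right using assms by (intro sum.cong) auto

text \<open>The \<open>v i\<close> may be dependent, so \<open>U\<close> is first defined on a
  maximal independent subfamily. Every relation among the \<open>v i\<close> is inherited by the
  \<open>w i\<close>, and this forces the right values on the remaining indices.\<close>

lemma linear_extension_family:
  fixes v :: "'i \<Rightarrow> 'a::real_vector" and w :: "'i \<Rightarrow> 'b::real_vector"
  assumes I: "finite I"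
    and null: "\<And>c. (\<Sum>i\<in>I. c i *\<^sub>R v i) = 0 \<Longrightarrow> (\<Sum>i\<in>I. c i *\<^sub>R w i) = 0"
  obtains U where "linear U" "\<And>i. i \<in> I \<Longrightarrow> U (v i) = w i"
proof -
  obtain B where B: "B \<subseteq> v ` I" "independent B" "v ` I \<subseteq> span B"
    by (rule real_vector.maximal_independent_subset)
  obtain J where J: "J \<subseteq> I" "inj_on v J" "B = v ` J" using B(1) by (metis subset_image_inj)
  have fJ: "finite J" using I J finite_subset by auto
  obtain U where U: "linear U" "\<And>b. b \<in> B \<Longrightarrow> U b = w (inv_into J v b)"
    using linear_independent_extend[OF B(2), of "\<lambda>b. w (inv_into J v b)"] by auto
  have UJ: "U (v j) = w j" if "j \<in> J" for j using U(2) J that by auto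
  have Ui: "U (v i) = w i" if i: "i \<in> I" for i
  proof -
    obtain g where g: "v i = (\<Sum>j\<in>J. g j *\<^sub>R v j)"
      using B(3) i span_image_explicit[OF fJ, of "v i" v] J(3) by auto
    \<comment> \<open>The relation that expresses \<open>v i\<close> through the subfamily
      \<open>J\<close>, written as one coefficient family over \<open>I\<close>; the two terms are
      kept separate so that \<open>i\<close> may itself belong to \<open>J\<close>.\<close>
    define c where "c = (\<lambda>j. (if j = i then 1 else 0) - (if j \<in> J then g j else 0))"
    have ex: "(\<Sum>j\<in>I. c j *\<^sub>R f j) = f i - (\<Sum>j\<in>J. g j *\<^sub>R f j)" for f :: "'i \<Rightarrow> 'c::real_vector"
    proof -
      have "(\<Sum>j\<in>I. c j *\<^sub>R f j) = (\<Sum>j\<in>I. (if j = i then f i else 0)) - (\<Sum>j\<in>I. if j \<in> J then g j *\<^sub>R f j else 0)"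
        unfolding c_def sum_subtractf[symmetric] by (intro sum.cong) (auto simp: algebra_simps)
      also have "(\<Sum>j\<in>I. (if j = i then f i else 0)) = f i" using I i by simp
      also have "(\<Sum>j\<in>I. if j \<in> J then g j *\<^sub>R f j else 0) = (\<Sum>j\<in>J. g j *\<^sub>R f j)"
        using J(1) I by (intro sum.mono_neutral_cong_right) auto
      finally show ?thesis .
    qed
    have "(\<Sum>j\<in>I. c j *\<^sub>R w j) = 0" using null[of c] ex[of v] g by simp
    then have "w i = (\<Sum>j\<in>J. g j *\<^sub>R w j)" using ex[of w] by simp
    also have "\<dots> = U (v i)" using UJ U(1) g by (simp add: linear_sum linear_scale)
    finally show ?thesis by simp
  qed
  then show ?thesis using U(1) by (intro that[of U])
qed

text \<open>Inner products of combinations depend only on the Gram matrix. In particular a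
  combination of norm 0 goes to one of norm 0, so sending \<open>v i\<close> to \<open>w i\<close>
  is well defined.\<close>

lemma gram_isometry:
  fixes v :: "'i \<Rightarrow> 'a::real_inner" and w :: "'i \<Rightarrow> 'b::real_inner"
  assumes I: "finite I"
    and gram: "\<And>i j. i \<in> I \<Longrightarrow> j \<in> I \<Longrightarrow> inner (v i) (v j) = inner (w i) (w j)"
  shows "\<exists>U. linear U \<and> (\<forall>i\<in>I. U (v i) = w i) \<and>
    (\<forall>x\<in>span (v ` I). \<forall>y\<in>span (v ` I). inner (U x) (U y) = inner x y)"
proof -
  have "(\<Sum>i\<in>I. c i *\<^sub>R w i) = 0" if "(\<Sum>i\<in>I. c i *\<^sub>R v i) = 0" for c
    using gram_sum_eq[of I v w c c] gram that by simp
  then obtain U where U: "linear U" "\<And>i. i \<in> I \<Longrightarrow> U (v i) = w i"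
    using linear_extension_family[OF I, of v w] by metis
  show ?thesis
  proof (intro exI[of _ U] conjI ballI U)
    fix x y assume "x \<in> span (v ` I)" "y \<in> span (v ` I)"
    then obtain c e where ce: "x = (\<Sum>i\<in>I. c i *\<^sub>R v i)" "y = (\<Sum>i\<in>I. e i *\<^sub>R v i)"
      using span_image_explicit[OF I] by metis
    have "U (\<Sum>i\<in>I. f i *\<^sub>R v i) = (\<Sum>i\<in>I. f i *\<^sub>R w i)" for f
      using U by (simp add: linear_sum linear_scale)
    then show "inner (U x) (U y) = inner x y"
      using gram_sum_eq[of I v w c e] gram ce by simp
  qed
qed

text \<open>The number of Gram vectors depends on the numbers \<open>n\<close> and \<open>p\<close>, so they need one inner product
  space that contains orthonormal families of every finite size.\<close>

typedef fseq = "{f :: nat \<Rightarrow> real. finite {i. f i \<noteq> 0}}" morphisms fseq_nth Abs_fseq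
  by (rule exI[of _ "\<lambda>_. 0"]) simp

setup_lifting type_definition_fseq

lemma finite_fseq_supp: "finite {i. fseq_nth f i \<noteq> 0}"
  using fseq_nth[of f] by simp

lemma fseq_eqI: "(\<And>i. fseq_nth f i = fseq_nth g i) \<Longrightarrow> f = g"
  by (metis fseq_nth_inject ext)

instantiation fseq :: real_inner
begin

lift_definition zero_fseq :: fseq is "\<lambda>_. 0" by simp
lift_definition plus_fseq :: "fseq \<Rightarrow> fseq \<Rightarrow> fseq" is "\<lambda>f g i. f i + g i"
  subgoal for f g by (rule finite_subset[of _ "{i. f i \<noteq> 0} \<union> {i. g i \<noteq> 0}"]) auto
  done
lift_definition minus_fseq :: "fseq \<Rightarrow> fseq \<Rightarrow> fseq" is "\<lambda>f g i. f i - g i"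
  subgoal for f g by (rule finite_subset[of _ "{i. f i \<noteq> 0} \<union> {i. g i \<noteq> 0}"]) auto
  done
lift_definition uminus_fseq :: "fseq \<Rightarrow> fseq" is "\<lambda>f i. - f i" by simp
lift_definition scaleR_fseq :: "real \<Rightarrow> fseq \<Rightarrow> fseq" is "\<lambda>c f i. c * f i"
  subgoal for c f by (rule finite_subset[of _ "{i. f i \<noteq> 0}"]) auto
  done

definition "inner f g = (\<Sum>i | fseq_nth f i \<noteq> 0. fseq_nth f i * fseq_nth g i)"
definition "norm (f :: fseq) = sqrt (inner f f)"
definition "sgn (f :: fseq) = scaleR (inverse (norm f)) f"
definition "dist (f :: fseq) g = norm (f - g)"
definition "uniformity = (INF e\<in>{0<..}. principal {(f :: fseq, g). dist f g < e})"
definition "open (U :: fseq set) \<longleftrightarrow> (\<forall>x\<in>U. \<forall>\<^sub>F (x', y) in uniformity. x' = x \<longrightarrow> y \<in> U)"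

lemma inner_fseq_superset:
  assumes "finite I" "{i. fseq_nth f i \<noteq> 0} \<subseteq> I"
  shows "inner f g = (\<Sum>i\<in>I. fseq_nth f i * fseq_nth g i)"
  unfolding inner_fseq_def using assms by (intro sum.mono_neutral_left) auto

instance
proof
  fix f g h :: fseq and r s :: real
  let ?I = "{i. fseq_nth f i \<noteq> 0} \<union> {i. fseq_nth g i \<noteq> 0}"
  have I: "finite ?I" using finite_fseq_supp by auto
  show "f + g + h = f + (g + h)" "f + g = g + f" "0 + f = f" "- f + f = 0" "f - g = f + - g"
    "r *\<^sub>R (f + g) = r *\<^sub>R f + r *\<^sub>R g" "(r + s) *\<^sub>R f = r *\<^sub>R f + s *\<^sub>R f"
    "r *\<^sub>R s *\<^sub>R f = (r * s) *\<^sub>R f" "1 *\<^sub>R f = f"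
    by (transfer; auto simp: algebra_simps)+
  show "dist f g = norm (f - g)" by (simp add: dist_fseq_def)
  show "sgn f = scaleR (inverse (norm f)) f" by (simp add: sgn_fseq_def)
  show "uniformity = (INF e\<in>{0<..}. principal {(f :: fseq, g). dist f g < e})"
    by (simp add: uniformity_fseq_def)
  show "open U \<longleftrightarrow> (\<forall>x\<in>U. \<forall>\<^sub>F (x', y) in uniformity. x' = x \<longrightarrow> y \<in> U)" for U :: "fseq set"
    by (simp add: open_fseq_def)
  show "norm f = sqrt (inner f f)" by (simp add: norm_fseq_def)
  show "inner f g = inner g f"
    using inner_fseq_superset[OF I, of f g] inner_fseq_superset[OF I, of g f] by (simp add: mult.commute)
  show "inner (f + g) h = inner f h + inner g h"
  proof -
    have "inner (f + g) h = (\<Sum>i\<in>?I. fseq_nth (f + g) i * fseq_nth h i)"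
      by (rule inner_fseq_superset[OF I]) (auto simp: plus_fseq.rep_eq)
    also have "\<dots> = inner f h + inner g h"
      using inner_fseq_superset[OF I, of f h] inner_fseq_superset[OF I, of g h]
      by (simp add: plus_fseq.rep_eq distrib_right sum.distrib)
    finally show ?thesis .
  qed
  show "inner (r *\<^sub>R f) g = r * inner f g"
    using inner_fseq_superset[OF I, of "r *\<^sub>R f" g] inner_fseq_superset[OF I, of f g]
    by (auto simp: scaleR_fseq.rep_eq sum_distrib_left mult.assoc)
  show "0 \<le> inner f f" unfolding inner_fseq_def by (intro sum_nonneg) auto
  show "(inner f f = 0) = (f = 0)"
  proof
    assume "inner f f = 0"
    then have "fseq_nth f i = 0" for i
      unfolding inner_fseq_def
      by (subst (asm) sum_nonneg_eq_0_iff) (auto simp: finite_fseq_supp)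
    then show "f = 0" by (intro fseq_eqI) (simp add: zero_fseq.rep_eq)
  next
    assume "f = 0"
    then show "inner f f = 0" by (simp add: inner_fseq_def zero_fseq.rep_eq)
  qed
qed

end

text \<open>A coordinate outside all supports gives the fresh direction that each induction step of
  \<open>psd_gram_vectors\<close> consumes.\<close>

lemma fseq_unit_orth:
  fixes F :: "fseq set"
  assumes "finite F"
  obtains e where "inner e e = 1" "\<And>x. x \<in> F \<Longrightarrow> inner e x = 0"
proof -
  have "finite (\<Union>x\<in>F. {i. fseq_nth x i \<noteq> 0})" using assms finite_fseq_supp by auto
  then obtain k where k: "k \<notin> (\<Union>x\<in>F. {i. fseq_nth x i \<noteq> 0})"
    using ex_new_if_finite[OF infinite_UNIV_nat] by blast
  define e where "e = Abs_fseq (\<lambda>i. if i = k then 1 else 0)"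
  have e: "fseq_nth e i = (if i = k then 1 else 0)" for i
    unfolding e_def by (subst Abs_fseq_inverse) auto
  show ?thesis
  proof (rule that[of e])
    show "inner e e = 1" using inner_fseq_superset[of "{k}" e e] by (auto simp: e)
    fix x assume "x \<in> F"
    then have "fseq_nth x k = 0" using k by auto
    then show "inner e x = 0" using inner_fseq_superset[of "{k}" e x] by (auto simp: e)
  qed
qed

text \<open>The hypothesis says that the values \<open>m i\<close> are consistent with a linear
  functional on the span of the \<open>v i\<close>; \<open>w\<close> is the Riesz representative of
  that functional.\<close>

lemma riesz_span:
  fixes v :: "nat \<Rightarrow> 'a::real_inner" and m :: "nat \<Rightarrow> real"
  assumes null: "\<And>c. (\<Sum>i<N. c i *\<^sub>R v i) = 0 \<Longrightarrow> (\<Sum>i<N. c i * m i) = 0"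
  obtains w where "w \<in> span (v ` {..<N})" "\<And>i. i < N \<Longrightarrow> inner w (v i) = m i"
proof -
  obtain \<phi> :: "'a \<Rightarrow> real" where \<phi>: "linear \<phi>" "\<And>i. i \<in> {..<N} \<Longrightarrow> \<phi> (v i) = m i"
    by (rule linear_extension_family[of "{..<N}" v m]) (use null in auto)
  obtain B where B: "finite B" "independent B" "span B = span (v ` {..<N})"
    by (rule findim_basis[OF findim_span[of "v ` {..<N}"]]) auto
  obtain d where d: "\<And>b. b \<in> B \<Longrightarrow> d b \<in> span B"
    "\<And>b b'. b \<in> B \<Longrightarrow> b' \<in> B \<Longrightarrow> inner (d b) b' = (if b = b' then 1 else 0)"
    using dual_basis[OF B(1,2)] by metis
  define w where "w = (\<Sum>b\<in>B. \<phi> b *\<^sub>R d b)"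
  have 1: "w \<in> span (v ` {..<N})" unfolding w_def B(3)[symmetric] using d(1)
    by (intro real_vector.span_sum real_vector.span_scale) auto
  have 2: "inner w b = \<phi> b" if b: "b \<in> B" for b
  proof -
    have "inner w b = (\<Sum>c\<in>B. if c = b then \<phi> b else 0)"
      unfolding w_def inner_sum_left using d(2) b by (intro sum.cong) auto
    then show ?thesis using B(1) b by simp
  qed
  have lin: "linear (inner w)"
    by (intro linearI) (auto simp: inner_add_right)
  have "inner w (v i) = m i" if i: "i < N" for i
  proof -
    have "v i \<in> span B" using i B(3) by (auto intro: real_vector.span_base)
    then have "inner w (v i) = \<phi> (v i)"
      by (rule real_vector.linear_eq_on[OF lin \<phi>(1)]) (rule 2)
    then show ?thesis using \<phi>(2) i by simp
  qed
  with 1 show ?thesis by (rule that)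
qed

text \<open>A Cholesky factorisation that tolerates singular matrices. The new vector has a part
  \<open>w\<close> in the span of the old ones that reproduces the last column, and a part along a
  fresh unit vector whose squared length is the Schur complement.\<close>

lemma psd_gram_vectors:
  fixes M :: "nat \<Rightarrow> nat \<Rightarrow> real"
  assumes "\<And>i j. i < N \<Longrightarrow> j < N \<Longrightarrow> M i j = M j i"
    and "\<And>c. 0 \<le> (\<Sum>i<N. \<Sum>j<N. c i * c j * M i j)"
  shows "\<exists>v :: nat \<Rightarrow> fseq. \<forall>i<N. \<forall>j<N. inner (v i) (v j) = M i j"
  using assms
proof (induction N)
  case 0
  then show ?case by simp
next
  case (Suc N)
  let ?D = "M N N"
  have quad: "0 \<le> (\<Sum>i<N. \<Sum>j<N. c i * c j * M i j) + 2 * t * (\<Sum>i<N. c i * M i N) + t\<^sup>2 * ?D"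
    for c t
  proof -
    define c' where "c' = c(N := t)"
    have "0 \<le> (\<Sum>i<Suc N. \<Sum>j<Suc N. c' i * c' j * M i j)" by (rule Suc.prems(2))
    also have "\<dots> = (\<Sum>i<N. (\<Sum>j<N. c' i * c' j * M i j) + c' i * c' N * M i N) +
       (\<Sum>j<N. c' N * c' j * M N j) + c' N * c' N * ?D" by simp
    also have "(\<Sum>j<N. c' N * c' j * M N j) = (\<Sum>j<N. t * (c j * M j N))"
      using Suc.prems(1) by (intro sum.cong) (auto simp: c'_def)
    also have "\<dots> = t * (\<Sum>j<N. c j * M j N)" by (simp add: sum_distrib_left)
    also have "(\<Sum>i<N. (\<Sum>j<N. c' i * c' j * M i j) + c' i * c' N * M i N)
      = (\<Sum>i<N. \<Sum>j<N. c i * c j * M i j) + (\<Sum>i<N. t * (c i * M i N))"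
      by (simp add: sum.distrib c'_def mult.commute mult.left_commute)
    also have "(\<Sum>i<N. t * (c i * M i N)) = t * (\<Sum>j<N. c j * M j N)" by (simp add: sum_distrib_left)
    finally show ?thesis by (simp add: c'_def power2_eq_square algebra_simps)
  qed
  have "0 \<le> (\<Sum>i<N. \<Sum>j<N. c i * c j * M i j)" for c using quad[of c 0] by simp
  then obtain v :: "nat \<Rightarrow> fseq" where v: "\<And>i j. i < N \<Longrightarrow> j < N \<Longrightarrow> inner (v i) (v j) = M i j"
    using Suc.IH Suc.prems(1) by (metis less_SucI)
  have nrm: "(\<Sum>i<N. \<Sum>j<N. c i * c j * M i j) = inner (\<Sum>i<N. c i *\<^sub>R v i) (\<Sum>i<N. c i *\<^sub>R v i)" for c
    unfolding inner_sum_left unfolding inner_sum_right using v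
    by (intro sum.cong) (auto simp: mult.assoc)
  have D0: "0 \<le> ?D" using quad[of "\<lambda>_. 0" 1] by simp
  have null: "(\<Sum>i<N. c i * M i N) = 0" if "(\<Sum>i<N. c i *\<^sub>R v i) = 0" for c
  proof -
    let ?X = "\<Sum>i<N. c i * M i N"
    \<comment> \<open>A nonnegative quadratic polynomial without constant term has no linear term.
      The denominator \<open>?D + 1\<close> instead of \<open>?D\<close> keeps the choice meaningful
      for \<open>?D = 0\<close>.\<close>
    define t where "t = - ?X / (?D + 1)"
    have tX: "?X = - t * (?D + 1)" using D0 by (simp add: t_def)
    have "0 \<le> 2 * t * ?X + t\<^sup>2 * ?D" using quad[of c t] nrm[of c] that by simp
    also have "\<dots> = - t\<^sup>2 * (?D + 2)" unfolding tX by (simp add: power2_eq_square algebra_simps)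
    finally have "t\<^sup>2 * (?D + 2) \<le> 0" by simp
    then have "t = 0" using D0 by (auto simp: mult_le_0_iff)
    then show ?thesis using tX by simp
  qed
  obtain w where w: "w \<in> span (v ` {..<N})" "\<And>i. i < N \<Longrightarrow> inner w (v i) = M i N"
    by (rule riesz_span[where v = v and N = N and m = "\<lambda>i. M i N"]) (use null in auto)
  obtain g where g: "w = (\<Sum>i<N. g i *\<^sub>R v i)"
    using w(1) span_image_explicit[of "{..<N}" w v] by auto
  have gw: "(\<Sum>i<N. g i * M i N) = inner w w"
  proof -
    have "inner w w = (\<Sum>i<N. g i * inner w (v i))"
      by (subst (2) g) (simp add: inner_sum_right)
    then show ?thesis using w(2) by simp
  qed
  \<comment> \<open>At the coefficients of \<open>w\<close> with last entry -1 the form equals the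
    Schur complement \<open>?D - inner w w\<close>.\<close>
  have le: "inner w w \<le> ?D" using quad[of g "-1"] nrm[of g] gw g by simp
  obtain e where e: "inner e e = 1" "\<And>x. x \<in> insert w (v ` {..<N}) \<Longrightarrow> inner e x = 0"
    using fseq_unit_orth[of "insert w (v ` {..<N})"] by auto
  define u where "u = w + sqrt (?D - inner w w) *\<^sub>R e"
  have eo: "inner e (v i) = 0" if "i < N" for i using e(2)[of "v i"] that by simp
  have ew: "inner e w = 0" "inner w e = 0" using e(2)[of w] by (auto simp: inner_commute[of w e])
  have uu: "inner u u = ?D" using le e(1) ew
    by (simp add: u_def inner_add_left inner_add_right flip: power2_eq_square)
  have uv: "inner u (v i) = M i N" if "i < N" for i
    using that w(2) eo by (simp add: u_def inner_add_left)
  show ?case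
  proof (rule exI[of _ "v(N := u)"], intro allI impI)
    fix i j assume "i < Suc N" "j < Suc N"
    then show "inner ((v(N := u)) i) ((v(N := u)) j) = M i j"
      using v uu uv Suc.prems(1)[of i j] by (auto simp: less_Suc_eq inner_commute)
  qed
qed

section \<open>Diagonalisation of self-adjoint operators\<close>

text \<open>This is f(S) v, computed by the Horner scheme.\<close>

definition polyop :: "('a::real_vector \<Rightarrow> 'a) \<Rightarrow> real poly \<Rightarrow> 'a \<Rightarrow> 'a" where
  "polyop S f v = fold_coeffs (\<lambda>a w. a *\<^sub>R v + S w) f 0"

lemma polyop_0 [simp]: "polyop S 0 v = 0"
  by (simp add: polyop_def)

lemma polyop_pCons:
  assumes "linear S"
  shows "polyop S (pCons a f) v = a *\<^sub>R v + S (polyop S f v)"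
  using assms by (cases "a = 0 \<and> f = 0") (auto simp: polyop_def linear_0)

lemma polyop_add:
  assumes "linear S"
  shows "polyop S (f + g) v = polyop S f v + polyop S g v"
proof (induction f arbitrary: g)
  case 0
  then show ?case by simp
next
  case (pCons a f)
  obtain b h where g: "g = pCons b h" by (cases g)
  show ?case unfolding g
    by (simp add: polyop_pCons[OF assms] pCons.IH linear_add[OF assms] scaleR_left.add)
qed

lemma polyop_smult:
  assumes "linear S"
  shows "polyop S (Polynomial.smult c f) v = c *\<^sub>R polyop S f v"
  by (induction f) (auto simp: polyop_pCons[OF assms] linear_scale[OF assms] scaleR_right_distrib)

lemma polyop_monom:
  assumes "linear S"
  shows "polyop S (monom c n) v = c *\<^sub>R (S ^^ n) v"
  by (induction n) (auto simp: polyop_pCons[OF assms] monom_0 monom_Suc linear_scale[OF assms] linear_0[OF assms])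

text \<open>The shape into which \<open>simp\<close> brings the product of \<open>g\<close> with an
  explicit factor; a linear factor takes one application, a quadratic factor two.\<close>

lemma polyop_step:
  assumes "linear S"
  shows "polyop S (Polynomial.smult c f + pCons 0 g) v = c *\<^sub>R polyop S f v + S (polyop S g v)"
  by (simp add: polyop_add[OF assms] polyop_smult[OF assms] polyop_pCons[OF assms])

lemma polyop_sum:
  assumes "linear S"
  shows "polyop S (sum f I) v = (\<Sum>i\<in>I. polyop S (f i) v)"
  by (induction I rule: infinite_finite_induct) (auto simp: polyop_add[OF assms])

lemma polyop_in:
  assumes "linear S" "real_vector.subspace K" "S ` K \<subseteq> K" "v \<in> K"
  shows "polyop S f v \<in> K"
  by (induction f) (use assms in \<open>auto simp: polyop_pCons real_vector.subspace_0
    intro!: real_vector.subspace_add real_vector.subspace_scale\<close>)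

lemma funpow_in: "S ` K \<subseteq> K \<Longrightarrow> x \<in> K \<Longrightarrow> (S ^^ i) x \<in> K"
  by (induction i) auto

text \<open>Among \<open>dim K + 1\<close> iterates of \<open>x\<close> one is a combination of its
  predecessors, by \<open>card_pivots\<close> over the zero subspace. This relation, with leading
  coefficient 1, is the polynomial.\<close>

lemma annihilating_poly:
  assumes S: "linear S" "S ` K \<subseteq> K" and K: "findim K" and x: "x \<in> K"
  obtains f where "f \<noteq> 0" "polyop S f x = 0"
proof -
  let ?v = "\<lambda>i. (S ^^ i) x"
  let ?n = "Suc (dim K)"
  have sub: "?v ` {0..<?n} \<subseteq> K" using funpow_in[OF S(2) x] by auto
  have s0: "real_vector.subspace {0::'a}" "{0} \<subseteq> K"
    using real_vector.subspace_single_0 real_vector.subspace_0[OF findim_subspace[OF K]] by simp_all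
  have "dim (span ({0} \<union> ?v ` {0..<?n})) \<le> dim K"
    using sub s0(2) real_vector.span_minimal[OF _ findim_subspace[OF K]]
    by (intro dim_mono_findim[OF _ K]) auto
  then have "card {l \<in> {0..<?n}. ?v l \<notin> span ({0} \<union> ?v ` {0..<l})} \<le> dim K"
    using card_pivots[OF s0(1) K _ s0(2) sub] by simp
  then have "{l \<in> {0..<?n}. ?v l \<notin> span ({0} \<union> ?v ` {0..<l})} \<noteq> {0..<?n}"
    by (metis card_atLeastLessThan diff_zero not_less_eq_eq order_refl)
  then obtain l where l: "?v l \<in> span (insert 0 (?v ` {0..<l}))" by auto
  then have "?v l \<in> span (?v ` {0..<l})" by (simp add: real_vector.span_insert_0)
  then obtain g where g: "?v l = (\<Sum>i\<in>{0..<l}. g i *\<^sub>R ?v i)"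
    using span_image_explicit[of "{0..<l}" "?v l" ?v] by auto
  define f where "f = monom 1 l + Polynomial.smult (-1) (\<Sum>i\<in>{0..<l}. monom (g i) i)"
  have "polyop S f x = 0"
    unfolding f_def polyop_add[OF S(1)] polyop_smult[OF S(1)] polyop_sum[OF S(1)] polyop_monom[OF S(1)]
    using g by simp
  moreover have "coeff f l = 1" unfolding f_def by (simp add: coeff_sum)
  then have "f \<noteq> 0" by auto
  ultimately show ?thesis using that by blast
qed

section \<open>Real polynomials and their complex roots\<close>

lemma map_of_real_pCons:
  "map_poly complex_of_real (pCons a f) = pCons (complex_of_real a) (map_poly complex_of_real f)"
  by (simp add: map_poly_pCons)

lemma poly_map_of_real_of_real:
  "poly (map_poly complex_of_real f) (complex_of_real x) = complex_of_real (poly f x)"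
  by (induction f) (auto simp: map_of_real_pCons)

lemma poly_map_of_real_add:
  "poly (map_poly complex_of_real (f + g)) z = poly (map_poly complex_of_real f) z + poly (map_poly complex_of_real g) z"
proof (induction f arbitrary: g)
  case (pCons a f)
  obtain b h where g: "g = pCons b h" by (cases g)
  show ?case unfolding g by (simp add: map_of_real_pCons pCons.IH algebra_simps)
qed simp

lemma poly_map_of_real_smult:
  "poly (map_poly complex_of_real (Polynomial.smult c f)) z = complex_of_real c * poly (map_poly complex_of_real f) z"
  by (induction f) (auto simp: map_of_real_pCons algebra_simps)

lemma poly_map_of_real_mult:
  "poly (map_poly complex_of_real (f * g)) z = poly (map_poly complex_of_real f) z * poly (map_poly complex_of_real g) z"
  by (induction f)
    (auto simp: map_of_real_pCons poly_map_of_real_add poly_map_of_real_smult algebra_simps)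

text \<open>For a non-real root \<open>z\<close> the remainder modulo the quadratic with roots
  \<open>z\<close> and its conjugate has degree at most 1 and vanishes at \<open>z\<close>. A real
  polynomial of degree at most 1 with a non-real root is 0.\<close>

lemma real_poly_factor:
  fixes f :: "real poly"
  assumes "degree f > 0"
  obtains a where "[:- a, 1:] dvd f" | b a where "b \<noteq> 0" "[:a\<^sup>2 + b\<^sup>2, - 2 * a, 1:] dvd f"
proof -
  let ?F = "map_poly complex_of_real f"
  have "degree ?F = degree f" by (intro degree_map_poly) auto
  then have "\<not> constant (poly ?F)" using assms by (simp add: constant_degree)
  then obtain z where z: "poly ?F z = 0" using fundamental_theorem_of_algebra by blast
  show ?thesis
  proof (cases "Im z = 0")
    case True
    then have "z = complex_of_real (Re z)" by (simp add: complex_eq_iff)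
    then have "poly ?F (complex_of_real (Re z)) = 0" using z by simp
    then have "poly f (Re z) = 0" by (simp add: poly_map_of_real_of_real)
    then show ?thesis using that(1) by (simp add: poly_eq_0_iff_dvd)
  next
    case False
    let ?q = "[:(Re z)\<^sup>2 + (Im z)\<^sup>2, - 2 * Re z, 1:]"
    define r where "r = f mod ?q"
    have dr: "degree r < 2" using degree_mod_less'[of ?q f] by (cases "r = 0") (auto simp: r_def)
    then obtain c d where r: "r = [:c, d:]"
    proof -
      obtain c r' where c: "r = pCons c r'" by (cases r)
      then have "degree r' = 0" using dr by (cases "r' = 0") auto
      then obtain d where "r' = [:d:]" by (elim degree_eq_zeroE)
      then show ?thesis using that c by auto
    qed
    have "f = ?q * (f div ?q) + r" unfolding r_def by (rule mult_div_mod_eq[symmetric])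
    then have F: "poly ?F z = poly (map_poly complex_of_real ?q) z * poly (map_poly complex_of_real (f div ?q)) z
        + poly (map_poly complex_of_real r) z"
      by (metis poly_map_of_real_add poly_map_of_real_mult)
    have q0: "poly (map_poly complex_of_real ?q) z = 0"
      by (simp add: map_of_real_pCons complex_eq_iff power2_eq_square algebra_simps)
    have "poly (map_poly complex_of_real r) z = 0" using z F q0 by simp
    then have cd: "complex_of_real c + z * complex_of_real d = 0" unfolding r by (simp add: map_of_real_pCons)
    then have "d = 0" using False by (auto simp: complex_eq_iff)
    then have "r = 0" using cd r by simp
    then have "?q dvd f" unfolding r_def by (simp add: dvd_eq_mod_eq_0)
    then show ?thesis using that(2) False by blast
  qed
qed

text \<open>A nonzero polynomial that annihilates a vector has linear and definite quadratic factors.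
  The quadratic factors \<open>(S - a)^2 + b^2\<close> are injective, so some linear factor has a kernel.\<close>

lemma eigenvector_exists:
  fixes S :: "'a::real_inner \<Rightarrow> 'a"
  assumes S: "linear S" "S ` K \<subseteq> K" "\<And>x y. x \<in> K \<Longrightarrow> y \<in> K \<Longrightarrow> inner (S x) y = inner x (S y)"
    and K: "findim K" and x: "x \<in> K" "x \<noteq> 0"
  obtains w r where "w \<in> K" "w \<noteq> 0" "S w = r *\<^sub>R w"
proof -
  note sK = findim_subspace[OF K]
  define P where "P = (\<lambda>f. f \<noteq> 0 \<and> polyop S f x = 0)"
  obtain f0 where "P f0" using annihilating_poly[OF S(1,2) K x(1)] unfolding P_def by metis
  \<comment> \<open>Minimal degree guarantees that after splitting off a factor the cofactor
    \<open>g\<close> does not annihilate \<open>x\<close>, so the remaining factor acts on the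
    nonzero vector \<open>polyop S g x\<close>.\<close>
  define f where "f = arg_min degree P"
  have f: "P f" "\<And>g. P g \<Longrightarrow> degree f \<le> degree g"
    using arg_min_nat_lemma[of P f0 degree] \<open>P f0\<close> unfolding f_def by auto
  have "degree f > 0"
  proof (rule ccontr)
    assume "\<not> degree f > 0"
    then obtain c where "f = [:c:]" by (auto elim: degree_eq_zeroE)
    then show False using f(1) x(2) by (auto simp: P_def polyop_pCons[OF S(1)] linear_0[OF S(1)])
  qed
  then show ?thesis
  proof (cases rule: real_poly_factor)
    case (1 a)
    then obtain g where g: "f = [:- a, 1:] * g" by (auto simp: dvd_def)
    have "g \<noteq> 0" using f(1) g by (auto simp: P_def)
    then have "degree g < degree f" unfolding g by (subst degree_mult_eq) auto
    then have nz: "polyop S g x \<noteq> 0" using f(2)[of g] \<open>g \<noteq> 0\<close> by (auto simp: P_def)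
    have fe: "f = Polynomial.smult (-a) g + pCons 0 g" unfolding g by simp
    have "polyop S f x = (- a) *\<^sub>R polyop S g x + S (polyop S g x)"
      by (subst fe) (rule polyop_step[OF S(1)])
    then have "S (polyop S g x) = a *\<^sub>R polyop S g x" using f(1) by (auto simp: P_def)
    then show ?thesis using that nz polyop_in[OF S(1) sK S(2) x(1)] by blast
  next
    case (2 b a)
    from 2(2) obtain g where g: "f = [:a\<^sup>2 + b\<^sup>2, - 2 * a, 1:] * g" unfolding dvd_def by blast
    have "g \<noteq> 0" using f(1) g by (auto simp: P_def)
    then have "degree g < degree f" unfolding g by (subst degree_mult_eq) auto
    then have nz: "polyop S g x \<noteq> 0" using f(2)[of g] \<open>g \<noteq> 0\<close> by (auto simp: P_def)
    let ?w = "polyop S g x"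
    have w: "?w \<in> K" by (rule polyop_in[OF S(1) sK S(2) x(1)])
    have fe: "f = Polynomial.smult (a\<^sup>2 + b\<^sup>2) g + pCons 0 (Polynomial.smult (-2*a) g + pCons 0 g)"
      unfolding g by simp
    have "polyop S f x = (a\<^sup>2 + b\<^sup>2) *\<^sub>R ?w + S ((-2*a) *\<^sub>R ?w + S ?w)"
      by (subst fe) (simp only: polyop_step[OF S(1)])
    also have "\<dots> = (a\<^sup>2 + b\<^sup>2) *\<^sub>R ?w + (-2*a) *\<^sub>R S ?w + S (S ?w)"
      by (simp only: linear_add[OF S(1)] linear_scale[OF S(1)] add.assoc)
    finally have eq: "(a\<^sup>2 + b\<^sup>2) *\<^sub>R ?w + (-2*a) *\<^sub>R S ?w + S (S ?w) = 0" using f(1) by (simp add: P_def)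
    \<comment> \<open>Self-adjointness completes the square: the quadratic factor has a strictly
      positive form at a nonzero vector and cannot annihilate it.\<close>
    have "inner ((a\<^sup>2 + b\<^sup>2) *\<^sub>R ?w + (-2*a) *\<^sub>R S ?w + S (S ?w)) ?w
        = b\<^sup>2 * inner ?w ?w + inner (S ?w - a *\<^sub>R ?w) (S ?w - a *\<^sub>R ?w)"
    proof -
      have "inner (S (S ?w)) ?w = inner (S ?w) (S ?w)" using S(2) w by (intro S(3)) auto
      then show ?thesis
        by (simp add: inner_add_left inner_diff_left inner_diff_right inner_commute power2_eq_square algebra_simps)
    qed
    then have "b\<^sup>2 * inner ?w ?w + inner (S ?w - a *\<^sub>R ?w) (S ?w - a *\<^sub>R ?w) = 0" using eq by simp
    moreover have "0 \<le> inner (S ?w - a *\<^sub>R ?w) (S ?w - a *\<^sub>R ?w)" by simp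
    moreover have "b\<^sup>2 * inner ?w ?w > 0" using 2(1) nz by simp
    ultimately show ?thesis by linarith
  qed
qed

text \<open>Induction on the dimension: the complement of an eigenvector in \<open>K\<close> is
  invariant because \<open>S\<close> is self-adjoint. Eigenvalues are a function on the basis, so
  that eigenspaces are spanned by the fibres of \<open>ev\<close>.\<close>

lemma spectral_decomposition:
  fixes S :: "'a::real_inner \<Rightarrow> 'a"
  assumes S: "linear S" "S ` K \<subseteq> K" "\<And>x y. x \<in> K \<Longrightarrow> y \<in> K \<Longrightarrow> inner (S x) y = inner x (S y)"
    and K: "findim K"
  shows "\<exists>E ev. finite E \<and> span E = K \<and> card E = dim K \<and> (\<forall>e\<in>E. S e = ev e *\<^sub>R e) \<and>
    (\<forall>e\<in>E. \<forall>e'\<in>E. inner e e' = (if e = e' then 1 else 0))"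
  using assms(2-4)
proof (induction "dim K" arbitrary: K rule: less_induct)
  case less
  note sK = findim_subspace[OF less.prems(3)]
  show ?case
  proof (cases "K = {0}")
    case True
    then show ?thesis
      using real_vector.dim_span_eq_card_independent[OF real_vector.independent_empty]
      by (intro exI[of _ "{}"]) auto
  next
    case False
    then obtain x where "x \<in> K" "x \<noteq> 0" using sK real_vector.subspace_0 by blast
    then obtain w \<mu> where w: "w \<in> K" "w \<noteq> 0" "S w = \<mu> *\<^sub>R w"
      using eigenvector_exists[OF S(1) less.prems(1,2,3)] by metis
    define e where "e = (1 / norm w) *\<^sub>R w"
    have e: "e \<in> K" "inner e e = 1" "S e = \<mu> *\<^sub>R e"
      using w sK by (auto simp: e_def real_vector.subspace_scale linear_scale[OF S(1)] dot_square_norm power2_eq_square)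
    define K' where "K' = {k \<in> K. inner e k = 0}"
    have sK': "real_vector.subspace K'"
      using sK by (auto simp: K'_def real_vector.subspace_def inner_add_right)
    have fK': "findim K'" by (rule findim_subset[OF sK' _ less.prems(3)]) (auto simp: K'_def)
    have lt: "dim K' < dim K"
    proof (rule ccontr)
      assume "\<not> dim K' < dim K"
      then have "K' = K" by (intro findim_eqI[OF sK' _ less.prems(3)]) (auto simp: K'_def)
      then have "e \<in> K'" using e(1) by simp
      then show False using e(2) by (simp add: K'_def)
    qed
    have SK': "S ` K' \<subseteq> K'"
    proof
      fix y assume "y \<in> S ` K'"
      then obtain k where k: "k \<in> K" "inner e k = 0" "y = S k" by (auto simp: K'_def)
      have "inner e (S k) = inner (S e) k" using less.prems(2) e(1) k(1) by simp
      also have "\<dots> = 0" using e(3) k(2) by simp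
      finally show "y \<in> K'" using k less.prems(1) by (auto simp: K'_def)
    qed
    have "\<exists>E ev. finite E \<and> span E = K' \<and> card E = dim K' \<and> (\<forall>e\<in>E. S e = ev e *\<^sub>R e) \<and>
      (\<forall>e\<in>E. \<forall>e'\<in>E. inner e e' = (if e = e' then 1 else 0))"
      by (rule less.hyps[OF lt SK' _ fK']) (use less.prems(2) in \<open>auto simp: K'_def\<close>)
    then obtain E ev where E': "finite E \<and> span E = K' \<and> card E = dim K' \<and> (\<forall>e\<in>E. S e = ev e *\<^sub>R e) \<and>
      (\<forall>e\<in>E. \<forall>e'\<in>E. inner e e' = (if e = e' then 1 else 0))" by blast
    then have E: "finite E" "span E = K'" "card E = dim K'" "\<And>d. d \<in> E \<Longrightarrow> S d = ev d *\<^sub>R d"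
      "\<And>d d'. d \<in> E \<Longrightarrow> d' \<in> E \<Longrightarrow> inner d d' = (if d = d' then 1 else 0)" by blast+
    have EK': "E \<subseteq> K'" using E(2) real_vector.span_superset by blast
    have eE: "inner e d = 0" "inner d e = 0" if "d \<in> E" for d
      using EK' that by (auto simp: K'_def inner_commute)
    have neE: "e \<notin> E" using eE(1)[of e] e(2) by auto
    have sp: "span (insert e E) = K"
    proof
      show "span (insert e E) \<subseteq> K" using EK' e(1) sK by (intro real_vector.span_minimal) (auto simp: K'_def)
      show "K \<subseteq> span (insert e E)"
      proof
        fix k assume k: "k \<in> K"
        have "k - inner e k *\<^sub>R e \<in> K'"
          using k e sK by (auto simp: K'_def inner_diff_right intro!: real_vector.subspace_diff real_vector.subspace_scale)
        then have "k - inner e k *\<^sub>R e \<in> span E" using E(2) by simp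
        then show "k \<in> span (insert e E)" by (auto simp: real_vector.span_insert)
      qed
    qed
    have gramE: "inner d d' = (if d = d' then 1 else 0)" if "d \<in> insert e E" "d' \<in> insert e E" for d d'
      using that E(5) eE e(2) neE by auto
    have "independent (insert e E)"
    proof (rule pairwise_orthogonal_independent)
      show "pairwise real_inner_class.orthogonal (insert e E)"
        using gramE by (auto simp: pairwise_def real_inner_class.orthogonal_def)
      show "0 \<notin> insert e E" using gramE[of 0 0] by auto
    qed
    then have "card (insert e E) = dim K" using sp real_vector.dim_span_eq_card_independent by metis
    then show ?thesis
      using E(1) sp gramE neE E(4) e(3)
      by (intro exI[of _ "insert e E"] exI[of _ "ev(e := \<mu>)"]) auto
  qed
qed

section \<open>Self-adjoint extensions of a partial shift\<close>

text \<open>Rank and nullity of one linear map whose kernel within \<open>K\<close> is exactly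
  \<open>V\<close>, taken on \<open>V + U\<close> and on \<open>U\<close>: the images coincide, and
  the kernels are \<open>V\<close> and \<open>U \<inter> V\<close>.\<close>

lemma dim_span_Un:
  fixes U V :: "'a::real_vector set"
  assumes K: "findim K" and U: "real_vector.subspace U" "U \<subseteq> K" and V: "real_vector.subspace V" "V \<subseteq> K"
  shows "dim (span (V \<union> U)) + dim (U \<inter> V) = dim U + dim V"
proof -
  have fV: "findim V" and fU: "findim U" using findim_subset K U V by auto
  obtain B where B: "finite B" "independent B" "span B = V" "card B = dim V"
    using findim_basis[OF fV] .
  have BK: "B \<subseteq> K" using B(3) V(2) real_vector.span_superset by blast
  obtain C where C: "finite C" "B \<subseteq> C" "C \<subseteq> K" "independent C" "span C = span K"
    using findim_basis_extend[OF K B(2) BK subset_refl] by metis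
  obtain f :: "'a \<Rightarrow> 'a" where f: "linear f" "\<And>c. c \<in> C \<Longrightarrow> f c = (if c \<in> B then 0 else c)"
    using linear_independent_extend[OF C(4), of "\<lambda>c. if c \<in> B then 0 else c"] by auto
  have fB: "\<And>b. b \<in> B \<Longrightarrow> f b = 0" using f(2) C(2) by auto
  have f0: "f x = 0" if "x \<in> V" for x
    by (rule linear_eq_0_on_span[where b = B, OF f(1)]) (use that fB B(3) in auto)
  have fid: "f x = x" if "x \<in> span (C - B)" for x
    by (rule real_vector.linear_eq_on[OF f(1) real_vector.linear_id[unfolded id_def] that]) (use f(2) in auto)
  have ker: "f x = 0 \<longleftrightarrow> x \<in> V" if "x \<in> K" for x
  proof
    assume fx: "f x = 0"
    have "x \<in> span (B \<union> (C - B))"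
      using that C(2,5) real_vector.span_superset[of K] by (auto simp: Un_absorb1)
    then obtain y z where yz: "x = y + z" "y \<in> span B" "z \<in> span (C - B)"
      unfolding real_vector.span_Un by blast
    then have "z = 0" using fx f0[of y] fid[of z] B(3) by (simp add: linear_add[OF f(1)])
    then show "x \<in> V" using yz B(3) by simp
  qed (rule f0)
  have H: "span (V \<union> U) \<subseteq> K" using U V findim_subspace[OF K] by (simp add: real_vector.span_minimal)
  have fH: "findim (span (V \<union> U))" by (rule findim_subset[OF real_vector.subspace_span H K])
  have "f ` span (V \<union> U) = f ` U"
  proof
    show "f ` span (V \<union> U) \<subseteq> f ` U"
    proof
      fix y assume "y \<in> f ` span (V \<union> U)"
      then obtain a b where ab: "y = f (a + b)" "a \<in> span V" "b \<in> span U"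
        by (auto simp: real_vector.span_Un)
      have "a \<in> V" "b \<in> U" using ab U(1) V(1) by (metis real_vector.span_eq_iff)+
      then show "y \<in> f ` U" using ab(1) f0[of a] by (simp add: linear_add[OF f(1)])
    qed
  qed (use real_vector.span_superset[of "V \<union> U"] in auto)
  moreover have "{x \<in> span (V \<union> U). f x = 0} = V"
    using ker H real_vector.span_superset[of "V \<union> U"] by blast
  moreover have "{x \<in> U. f x = 0} = U \<inter> V" using ker U by blast
  ultimately show ?thesis using rank_nullity[OF f(1) fH] rank_nullity[OF f(1) fU] by simp
qed

lemma eq_0_if_orth_span:
  fixes x :: "'a::real_inner"
  assumes "x \<in> span B" "\<And>b. b \<in> B \<Longrightarrow> inner x b = 0"
  shows "x = 0"
  using inner_span_0[of B x x] assms by simp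

text \<open>The vectors may be dependent. \<open>X\<close> is a total function, but only its values
  on the span of the first \<open>q\<close> vectors are determined. \<open>X_sym\<close> is the
  Hankel property of the Gram matrix.\<close>

locale partial_shift =
  fixes v :: "nat \<Rightarrow> 'a::real_inner" and X :: "'a \<Rightarrow> 'a" and q p :: nat
  assumes X_linear: "linear X"
    and X_shift: "\<And>l. l < q \<Longrightarrow> X (v l) = v (l + p)"
    and X_sym: "\<And>k l. k < q \<Longrightarrow> l < q \<Longrightarrow> inner (v (k + p)) (v l) = inner (v k) (v (l + p))"
begin

definition K where "K = span (v ` {..<q + p})"
definition V where "V = span (v ` {..<q})"
definition R where "R = span (v ` {p..<q + p})"
definition G where \<comment> \<open>the orthogonal complement of \<open>R = X V\<close>\<close>
  "G = {w \<in> K. \<forall>l\<in>{p..<q + p}. inner w (v l) = 0}"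

text \<open>\<open>S\<close> is total on the type, but only its restriction to \<open>K\<close>
  carries meaning: two extensions count as equal when they agree on \<open>K\<close>.\<close>

definition ext :: "('a \<Rightarrow> 'a) \<Rightarrow> bool" where
  "ext S \<longleftrightarrow> linear S \<and> S ` K \<subseteq> K \<and> (\<forall>x\<in>K. \<forall>y\<in>K. inner (S x) y = inner x (S y)) \<and>
     (\<forall>l<q. S (v l) = v (l + p))"

definition nullity :: "('a \<Rightarrow> 'a) \<Rightarrow> nat" where "nullity S = dim {x \<in> K. S x = 0}"

lemma K_findim: "findim K" and V_findim: "findim V" and R_findim: "findim R"
  by (simp_all add: K_def V_def R_def findim_span)

lemma K_sub: "real_vector.subspace K" and V_sub: "real_vector.subspace V" and R_sub: "real_vector.subspace R"
  by (simp_all add: K_def V_def R_def real_vector.subspace_span)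

lemma V_K: "V \<subseteq> K" and R_K: "R \<subseteq> K"
  unfolding V_def K_def R_def by (rule real_vector.span_mono; auto)+

lemma v_K: "l < q + p \<Longrightarrow> v l \<in> K" and v_V: "l < q \<Longrightarrow> v l \<in> V"
  unfolding V_def K_def by (rule real_vector.span_base; auto)+

lemma G_K: "G \<subseteq> K" by (auto simp: G_def)

lemma G_sub: "real_vector.subspace G"
  using K_sub by (auto simp: G_def real_vector.subspace_def inner_add_left)

lemma G_R: "w \<in> G \<Longrightarrow> r \<in> R \<Longrightarrow> inner w r = 0"
  unfolding R_def by (rule inner_span_0) (auto simp: G_def)

lemma X_V: "X ` V = R"
proof -
  have "X ` V = span (X ` v ` {..<q})" unfolding V_def using X_linear by (simp add: linear_span_image)
  also have "X ` v ` {..<q} = (\<lambda>l. v (l + p)) ` {..<q}" using X_shift by force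
  also have "\<dots> = v ` {p..<q + p}"
  proof -
    have "(\<lambda>l. l + p) ` {..<q} = {p..<q + p}" by (simp add: lessThan_atLeast0)
    then show ?thesis by (metis image_image)
  qed
  finally show ?thesis by (simp add: R_def)
qed

lemma X_sym_V:
  assumes "x \<in> V" "y \<in> V"
  shows "inner (X x) y = inner x (X y)"
proof (rule selfadjoint_span[OF X_linear])
  show "x \<in> span (v ` {..<q})" "y \<in> span (v ` {..<q})" using assms by (simp_all add: V_def)
  fix b b' assume "b \<in> v ` {..<q}" "b' \<in> v ` {..<q}"
  then show "inner (X b) b' = inner b (X b')" using X_sym X_shift by auto
qed

lemma ext_V: "ext S \<Longrightarrow> x \<in> V \<Longrightarrow> S x = X x"
  unfolding V_def
  by (rule real_vector.linear_eq_on[of S X]) (auto simp: ext_def X_linear X_shift)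

section \<open>Bounds for the nullity of an extension, and the extremal case\<close>

definition N0 where "N0 = {x \<in> V. X x = 0}"

lemma N0_sub: "real_vector.subspace N0"
  unfolding N0_def by (rule subspace_kernel_on[OF X_linear V_sub])

lemma dim_N0: "dim N0 + dim R = dim V"
  using rank_nullity[OF X_linear V_findim] X_V by (simp add: N0_def)

lemma VG_K: "span (V \<union> G) \<subseteq> K"
  using V_K G_K K_sub by (simp add: real_vector.span_minimal)

lemma R_complement:
  assumes "k \<in> K" "\<And>g. g \<in> G \<Longrightarrow> inner k g = 0"
  shows "k \<in> R"
proof (rule double_complement[OF R_findim R_K K_sub assms(1)])
  fix k' assume "k' \<in> K" "\<And>u. u \<in> R \<Longrightarrow> inner k' u = 0"
  then have "k' \<in> G" by (auto simp: G_def R_def intro: real_vector.span_base)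
  then show "inner k k' = 0" by (rule assms(2))
qed

lemma ext_ker_sub: "ext S \<Longrightarrow> real_vector.subspace {x \<in> K. S x = 0}"
  by (rule subspace_kernel_on[OF _ K_sub]) (simp add: ext_def)

text \<open>The kernel of a self-adjoint operator is orthogonal to its range, and the range contains
  every \<open>v l\<close> with \<open>p \<le> l\<close>, as \<open>S (v (l - p))\<close>.\<close>

lemma ext_ker_G:
  assumes "ext S" "x \<in> K" "S x = 0"
  shows "x \<in> G"
proof -
  have "inner x (v l) = 0" if "l \<in> {p..<q + p}" for l
  proof -
    define k where "k = l - p"
    have k: "k < q" "l = k + p" using that by (auto simp: k_def)
    have "v l = S (v k)" using assms(1) k by (simp add: ext_def)
    moreover have "v k \<in> K" using k by (intro v_K) auto
    moreover have "inner (S x) (v k) = inner x (S (v k))"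
      using assms(1,2) \<open>v k \<in> K\<close> unfolding ext_def by blast
    ultimately show ?thesis using assms(3) by simp
  qed
  then show ?thesis using assms by (simp add: G_def)
qed

text \<open>\<open>S\<close> agrees with \<open>X\<close> on \<open>V\<close>, so its kernel meets
  \<open>V\<close> in \<open>N0\<close>. The nullity therefore exceeds \<open>dim N0\<close> by
  exactly what the kernel adds to \<open>V\<close>.\<close>

lemma ext_nullity:
  assumes "ext S"
  shows "nullity S + dim V = dim N0 + dim (span (V \<union> {x \<in> K. S x = 0}))"
proof -
  have "{x \<in> K. S x = 0} \<inter> V = N0" using ext_V[OF assms] V_K by (auto simp: N0_def)
  then show ?thesis
    using dim_span_Un[OF K_findim ext_ker_sub[OF assms] _ V_sub V_K] by (auto simp: nullity_def)
qed

lemma nullity_le: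
  assumes "ext S"
  shows "nullity S + dim V \<le> dim N0 + dim (span (V \<union> G))"
proof -
  have "V \<union> {x \<in> K. S x = 0} \<subseteq> V \<union> G" using ext_ker_G[OF assms] by auto
  then have "dim (span (V \<union> {x \<in> K. S x = 0})) \<le> dim (span (V \<union> G))"
    by (intro dim_mono_findim findim_subset[OF real_vector.subspace_span VG_K K_findim] real_vector.span_mono)
  then show ?thesis using ext_nullity[OF assms] by simp
qed

lemma nullity_ge:
  assumes "ext S"
  shows "dim N0 \<le> nullity S"
proof -
  have "N0 \<subseteq> {x \<in> K. S x = 0}" using ext_V[OF assms] V_K by (auto simp: N0_def)
  then show ?thesis unfolding nullity_def
    by (rule dim_mono_findim) (rule findim_subset[OF ext_ker_sub[OF assms] _ K_findim], auto)
qed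

text \<open>Maximal nullity together with \<open>V + G = K\<close> gives
  \<open>K = V + ker S = V + ker S'\<close>. The form of \<open>S - S'\<close> is then evaluated on
  mixed decompositions, where it vanishes.\<close>

lemma ext_unique:
  assumes S: "ext S" "ext S'" and VG: "span (V \<union> G) = K"
    and m: "nullity S + dim V = dim N0 + dim (span (V \<union> G))" "nullity S' + dim V = dim N0 + dim (span (V \<union> G))"
    and x: "x \<in> K"
  shows "S x = S' x"
proof -
  have dec: "\<exists>h\<in>V. \<exists>k\<in>K. T k = 0 \<and> w = h + k"
    if T: "ext T" "nullity T + dim V = dim N0 + dim (span (V \<union> G))" and w: "w \<in> K" for T w
  proof -
    let ?k = "{x \<in> K. T x = 0}"
    have sub: "span (V \<union> ?k) \<subseteq> K" using V_K K_sub by (intro real_vector.span_minimal) auto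
    have "span (V \<union> ?k) = K"
      using ext_nullity[OF T(1)] T(2) VG
      by (intro findim_eqI[OF real_vector.subspace_span sub K_findim]) auto
    then have "w \<in> span (V \<union> ?k)" using w by simp
    then show ?thesis
      using V_sub ext_ker_sub[OF T(1)] by (auto simp: real_vector.span_Un real_vector.span_eq_iff[THEN iffD2])
  qed
  have lin: "linear S" "linear S'" using S by (auto simp: ext_def)
  have sym: "inner (S x) y = inner x (S y)" "inner (S' x) y = inner x (S' y)" if "x \<in> K" "y \<in> K" for x y
    using S that by (auto simp: ext_def)
  \<comment> \<open>The left argument is split along the kernel of \<open>S\<close> and the right
    one along the kernel of \<open>S'\<close>. Since both operators equal \<open>X\<close> on
    \<open>V\<close>, only \<open>S' k\<close> remains; moving \<open>S'\<close> across, it is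
    orthogonal to \<open>h'\<close> because \<open>S' h' = S h'\<close> and \<open>S k = 0\<close>,
    and to \<open>k'\<close> because \<open>S' k' = 0\<close>.\<close>
  have D0: "inner (S w - S' w) w' = 0" if w: "w \<in> K" "w' \<in> K" for w w'
  proof -
    obtain h k where hk: "h \<in> V" "k \<in> K" "S k = 0" "w = h + k" using dec[OF S(1) m(1) w(1)] by auto
    obtain h' k' where hk': "h' \<in> V" "k' \<in> K" "S' k' = 0" "w' = h' + k'" using dec[OF S(2) m(2) w(2)] by auto
    have "S w - S' w = - S' k"
      using hk ext_V[OF S(1)] ext_V[OF S(2)] by (simp add: linear_add[OF lin(1)] linear_add[OF lin(2)])
    moreover have "inner (S' k) h' = 0"
      using sym(2)[OF hk(2), of h'] sym(1)[OF hk(2), of h'] ext_V[OF S(1) hk'(1)] ext_V[OF S(2) hk'(1)] hk'(1) hk(3) V_K by auto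
    moreover have "inner (S' k) k' = 0" using sym(2)[OF hk(2) hk'(2)] hk'(3) by simp
    ultimately show ?thesis using hk'(4) by (simp add: inner_add_right)
  qed
  have "S x - S' x \<in> K" using S x K_sub by (auto simp: ext_def intro!: real_vector.subspace_diff)
  then have "inner (S x - S' x) (S x - S' x) = 0" using D0[OF x] by blast
  then show ?thesis by simp
qed

text \<open>The complement of \<open>G\<close> in \<open>K\<close> is \<open>R = X V\<close>, so the
  complement of \<open>V + G\<close> consists of the vectors \<open>X h\<close> that are orthogonal
  to \<open>V\<close>.\<close>

lemma VG_full_iff:
  "span (V \<union> G) = K \<longleftrightarrow> (\<forall>h\<in>V. (\<forall>y\<in>V. inner (X h) y = 0) \<longrightarrow> X h = 0)"
proof safe
  fix h assume VG: "span (V \<union> G) = K" and h: "h \<in> V" "\<forall>y\<in>V. inner (X h) y = 0"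
  have "X h \<in> R" using X_V h by auto
  then show "X h = 0"
    using h R_K VG G_R by (intro eq_0_if_orth_span[of "X h" "V \<union> G"]) (auto simp: inner_commute)
next
  fix x assume "x \<in> span (V \<union> G)" then show "x \<in> K" using VG_K by auto
next
  fix x assume *: "\<forall>h\<in>V. (\<forall>y\<in>V. inner (X h) y = 0) \<longrightarrow> X h = 0" and x: "x \<in> K"
  show "x \<in> span (V \<union> G)"
  proof (rule double_complement[OF findim_subset[OF real_vector.subspace_span VG_K K_findim] VG_K K_sub x])
    fix k assume k: "k \<in> K" "\<And>u. u \<in> span (V \<union> G) \<Longrightarrow> inner k u = 0"
    have "k \<in> R" using k real_vector.span_base[of _ "V \<union> G"] by (intro R_complement) auto
    then obtain h where h: "h \<in> V" "k = X h" using X_V by auto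
    then show "inner x k = 0" using * k(2) real_vector.span_base[of _ "V \<union> G"] by auto
  qed
qed

text \<open>In the lemma below, \<open>BG\<close> completes a basis of \<open>V\<close> to a basis of \<open>V + G\<close>, and \<open>BZ\<close> completes
  the latter to a basis of \<open>K\<close>. The quadratic form of an extension is free on both: zeros on
  \<open>Z\<close> produce the kernel, and varying \<open>c\<close> and \<open>e\<close> shows non-uniqueness.\<close>

definition complements :: "'a set \<Rightarrow> 'a set \<Rightarrow> bool" where
  "complements BG BZ \<longleftrightarrow> finite BG \<and> card BG + dim V = dim (span (V \<union> G)) \<and> finite BZ \<and>
    BG \<subseteq> K \<and> BZ \<subseteq> K \<and> (BZ = {} \<longleftrightarrow> span (V \<union> G) = K) \<and>
    (\<forall>Z \<subseteq> BG. \<forall>c e :: real. c \<noteq> 0 \<longrightarrow> (\<exists>S. ext S \<and> nullity S = dim N0 + card Z \<and>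
       (\<forall>g\<in>BG - Z. inner (S g) g = c) \<and> (\<forall>z\<in>BZ. inner (S z) z = e)))"

lemma complements_exist: "\<exists>BG BZ. complements BG BZ"
proof -
  obtain BV where BV: "finite BV" "independent BV" "span BV = V" "card BV = dim V"
    using findim_basis[OF V_findim] .
  have BVV: "BV \<subseteq> V" using BV(3) real_vector.span_superset by blast
  have BGK: "BV \<union> G \<subseteq> K" using BVV V_K G_K by auto
  obtain C where C: "finite C" "BV \<subseteq> C" "C \<subseteq> BV \<union> G" "independent C" "span C = span (BV \<union> G)"
      "card C = dim (BV \<union> G)"
    using findim_basis_extend[OF K_findim BV(2) Un_upper1 BGK] .
  have spC: "span C = span (V \<union> G)" unfolding C(5) real_vector.span_Un using BV(3) by (metis real_vector.span_span)
  define BG where "BG = C - BV"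
  have BG: "BG \<subseteq> G" "finite BG" using C(1,3) by (auto simp: BG_def)
  have CK: "C \<subseteq> K" using C(3) BVV V_K G_K by auto
  obtain B where B: "finite B" "C \<subseteq> B" "B \<subseteq> K" "independent B" "span B = span K" "card B = dim K"
    using findim_basis_extend[OF K_findim C(4) CK subset_refl] .
  have spB: "span B = K" using B(5) span_findim[OF K_findim] by simp
  define BZ where "BZ = B - C"
  have cG: "card BG + dim V = dim (span (V \<union> G))"
  proof -
    have "dim (span (V \<union> G)) = card C" using real_vector.dim_span_eq_card_independent[OF C(4)] spC by simp
    moreover have "card C = card BG + card BV" unfolding BG_def
      using C(1,2) BV(1) by (simp add: card_Diff_subset card_mono)
    ultimately show ?thesis using BV(4) by simp
  qed
  have BZe: "BZ = {} \<longleftrightarrow> span (V \<union> G) = K"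
  proof
    assume "BZ = {}" then have "B = C" using B(2) by (auto simp: BZ_def)
    then show "span (V \<union> G) = K" using spB spC by simp
  next
    assume "span (V \<union> G) = K"
    then have "card C = dim K" using real_vector.dim_span_eq_card_independent[OF C(4)] spC by simp
    then have "C = B" using B(6) by (intro card_subset_eq[OF B(1,2)]) simp
    then show "BZ = {}" by (simp add: BZ_def)
  qed
  have Beq: "B = BV \<union> BG \<union> BZ" "BV \<inter> BG = {}" "BV \<inter> BZ = {}" "BG \<inter> BZ = {}"
    using B(2) C(2) by (auto simp: BG_def BZ_def)
  have main: "\<exists>S. ext S \<and> nullity S = dim N0 + card Z \<and>
       (\<forall>g\<in>BG - Z. inner (S g) g = c) \<and> (\<forall>z\<in>BZ. inner (S z) z = e)"
    if Z: "Z \<subseteq> BG" and c: "c \<noteq> 0" for Z c e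
  proof -
    \<comment> \<open>Rows and columns of \<open>BV\<close> are forced by \<open>X\<close> and
      compatible by \<open>X_sym_V\<close>. On the other basis vectors the form is diagonal: 0 on
      \<open>Z\<close>, \<open>c\<close> on the rest of \<open>BG\<close>, \<open>e\<close> on
      \<open>BZ\<close>. For a vector of \<open>BG\<close> the entries against \<open>BV\<close>
      vanish too, because \<open>G\<close> is orthogonal to \<open>X V\<close>.\<close>
    define \<beta> where "\<beta> = (\<lambda>b b'. if b \<in> BV then inner (X b) b' else if b' \<in> BV then inner b (X b')
       else if b = b' then (if b \<in> Z then 0 else if b \<in> BG then c else e) else 0)"
    have \<beta>_sym: "\<beta> b b' = \<beta> b' b" for b b'
      using X_sym_V[of b b'] BVV by (auto simp: \<beta>_def inner_commute)
    obtain S where S: "linear S" "S ` span B \<subseteq> span B"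
      "\<And>b b'. b \<in> B \<Longrightarrow> b' \<in> B \<Longrightarrow> inner (S b) b' = \<beta> b b'"
      using operator_of_form[OF B(1,4)] by metis
    have SK: "S ` K \<subseteq> K" using S(2) spB by simp
    have selfadj: "inner (S x) y = inner x (S y)" if "x \<in> K" "y \<in> K" for x y
      using selfadjoint_span[OF S(1), of B x y] that spB S(3) \<beta>_sym by (metis inner_commute)
    have SX: "S b = X b" if b: "b \<in> BV" for b
    proof -
      have "S b - X b = 0"
      proof (rule eq_0_if_orth_span[of _ B])
        have "X b \<in> K" using b BVV X_V R_K by blast
        moreover have "S b \<in> K" using b BVV V_K SK by blast
        ultimately show "S b - X b \<in> span B" using spB K_sub by (simp add: real_vector.subspace_diff)
        show "inner (S b - X b) b' = 0" if "b' \<in> B" for b'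
          using S(3)[OF _ that, of b] b Beq(1) by (simp add: inner_diff_left \<beta>_def)
      qed
      then show ?thesis by simp
    qed
    have SXV: "S h = X h" if "h \<in> V" for h
      using that BV(3) SX by (intro real_vector.linear_eq_on[OF S(1) X_linear, of h BV]) auto
    have ext: "ext S" unfolding ext_def using S(1) SK selfadj SXV v_V X_shift by auto
    have BGB: "BG \<subseteq> B" "BZ \<subseteq> B" "BV \<subseteq> B" using Beq by auto
    have Sgv: "inner (S g) b = \<beta> g b" if "g \<in> BG" "b \<in> B" for g b using S(3) that BGB by auto
    have GX: "inner g (X h) = 0" if "g \<in> G" "h \<in> V" for g h using G_R[of g "X h"] X_V that by auto
    have Z0: "S g = 0" if g: "g \<in> Z" for g
    proof (rule eq_0_if_orth_span[of _ B])
      show "S g \<in> span B" using g Z BGB S(2) real_vector.span_base[of g B] by blast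
      fix b assume b: "b \<in> B"
      have "g \<in> BG" "g \<in> G" "g \<notin> BV" using g Z BG Beq by auto
      then show "inner (S g) b = 0" using Sgv[OF _ b] g GX[of g b] BVV by (auto simp: \<beta>_def)
    qed
    have fZ: "finite Z" using Z BG finite_subset by auto
    have spBG: "span BG \<subseteq> G" by (rule real_vector.span_minimal[OF BG(1) G_sub])
    have ker: "{x \<in> K. S x = 0} = span (N0 \<union> span Z)"
    proof
      show "span (N0 \<union> span Z) \<subseteq> {x \<in> K. S x = 0}"
      proof (rule real_vector.span_minimal[OF _ ext_ker_sub[OF ext]])
        have "span Z \<subseteq> {x \<in> K. S x = 0}"
          using Z0 Z BG G_K by (intro real_vector.span_minimal[OF _ ext_ker_sub[OF ext]]) auto
        then show "N0 \<union> span Z \<subseteq> {x \<in> K. S x = 0}" using SXV V_K by (auto simp: N0_def)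
      qed
      show "{x \<in> K. S x = 0} \<subseteq> span (N0 \<union> span Z)"
      proof
        fix w assume "w \<in> {x \<in> K. S x = 0}"
        then have w: "w \<in> K" "S w = 0" by auto
        have "w \<in> span ((BV \<union> BG) \<union> BZ)" using w spB Beq by simp
        then obtain h g z where hgz: "w = h + g + z" "h \<in> V" "g \<in> span BG" "z \<in> span BZ"
          using BV(3) unfolding real_vector.span_Un by auto
        have gG: "g \<in> G" using hgz(3) spBG by auto
        have zK: "z \<in> K" using hgz(4) BGB(2) real_vector.span_mono spB by blast
        \<comment> \<open>The \<open>BZ\<close> part of a kernel vector vanishes: a vector
          orthogonal to \<open>V + G\<close> has the form \<open>X h'\<close>, and pairing it with
          \<open>w\<close> gives \<open>inner (S w) h' = 0\<close>. So \<open>z\<close> lies in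
          \<open>V + G\<close>, and independence of the basis leaves only 0.\<close>
        have "z \<in> span (V \<union> G)"
        proof (rule double_complement[OF findim_subset[OF real_vector.subspace_span VG_K K_findim] VG_K K_sub zK])
          fix k assume k: "k \<in> K" "\<And>u. u \<in> span (V \<union> G) \<Longrightarrow> inner k u = 0"
          have "k \<in> R" using k real_vector.span_base[of _ "V \<union> G"] by (intro R_complement) auto
          then obtain h' where h': "h' \<in> V" "k = X h'" using X_V by auto
          have kV: "inner h k = 0" using k(2)[of h] hgz(2) real_vector.span_base[of _ "V \<union> G"] by (auto simp: inner_commute)
          have "inner w k = inner (S w) h'" using selfadj[OF w(1), of h'] SXV[OF h'(1)] h' V_K by auto
          then have "inner w k = 0" using w by simp
          then show "inner z k = 0" using kV GX[OF gG h'(1)] h'(2) by (simp add: hgz(1) inner_add_left)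
        qed
        then have "z \<in> span (B - C) \<inter> span C" using hgz(4) spC by (simp add: BZ_def)
        then have z0: "z = 0" using independent_span_disjoint[OF B(4,1,2)] by auto
        obtain \<gamma> where g: "g = (\<Sum>b\<in>BG. \<gamma> b *\<^sub>R b)"
          using hgz(3) real_vector.span_finite[OF BG(2)] by auto
        \<comment> \<open>Pairing \<open>S w = 0\<close> with \<open>g'\<close> isolates one
          coefficient: the form is diagonal on \<open>BG\<close>, and \<open>S h = X h\<close> is
          orthogonal to \<open>G\<close>.\<close>
        have \<gamma>0: "\<gamma> g' = 0" if g': "g' \<in> BG - Z" for g'
        proof -
          have "inner (S h) g' = 0" using SXV[OF hgz(2)] GX[of g' h] g' BG hgz(2) by (auto simp: inner_commute)
          moreover have "inner (S w) g' = inner (S h) g' + inner (S g) g'"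
            using z0 hgz(1) by (simp add: linear_add[OF S(1)] inner_add_left)
          ultimately have "inner (S g) g' = 0" using w(2) by simp
          moreover have "inner (S g) g' = (\<Sum>b\<in>BG. if b = g' then \<gamma> g' * c else 0)"
            unfolding g linear_sum[OF S(1)] linear_scale[OF S(1)] inner_sum_left
            using Sgv g' Beq BGB by (intro sum.cong) (auto simp: \<beta>_def)
          ultimately have "\<gamma> g' * c = 0" using BG(2) g' by simp
          then show ?thesis using c by simp
        qed
        have "g = (\<Sum>b\<in>Z. \<gamma> b *\<^sub>R b)" unfolding g using \<gamma>0 Z BG(2) by (intro sum.mono_neutral_right) auto
        then have gZ: "g \<in> span Z" by (auto intro: real_vector.span_sum real_vector.span_scale real_vector.span_base)
        have "S g = 0" using linear_eq_0_on_span[OF S(1) _ gZ] Z0 by auto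
        then have "S h = 0" using w(2) z0 hgz(1) by (simp add: linear_add[OF S(1)])
        then have "h \<in> N0" using SXV hgz(2) by (simp add: N0_def)
        then show "w \<in> span (N0 \<union> span Z)"
          unfolding hgz(1) z0 add_0_right
          using gZ by (intro real_vector.span_add real_vector.span_base[of h] real_vector.span_base[of g]) auto
      qed
    qed
    have indZ: "independent Z" using real_vector.independent_mono[OF C(4)] Z by (auto simp: BG_def)
    have dZ: "dim (span Z) = card Z" by (rule real_vector.dim_span_eq_card_independent[OF indZ])
    have "span Z \<inter> N0 \<subseteq> span (C - BV) \<inter> span BV"
      using Z BV(3) real_vector.span_mono[of Z "C - BV"] by (auto simp: N0_def BG_def)
    then have "span Z \<inter> N0 \<subseteq> {0}" using independent_span_disjoint[OF C(4,1,2)] by auto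
    then have "span Z \<inter> N0 = span {}"
      using real_vector.span_zero[of Z] real_vector.subspace_0[OF N0_sub] by auto
    then have d0: "dim (span Z \<inter> N0) = 0"
      using real_vector.dim_span_eq_card_independent[OF real_vector.independent_empty] by simp
    have "span Z \<subseteq> K" using Z BG G_K K_sub by (intro real_vector.span_minimal) auto
    moreover have "N0 \<subseteq> K" using V_K by (auto simp: N0_def)
    ultimately have "nullity S = dim N0 + card Z"
      unfolding nullity_def ker
      using dim_span_Un[OF K_findim real_vector.subspace_span _ N0_sub, of Z] d0 dZ by simp
    moreover have "inner (S g) g = c" if "g \<in> BG - Z" for g using that Sgv[of g g] Beq BGB by (auto simp: \<beta>_def)
    moreover have "inner (S z) z = e" if "z \<in> BZ" for z
      using that S(3)[of z z] Beq BGB Z by (auto simp: \<beta>_def)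
    ultimately show ?thesis using ext by blast
  qed
  have fBZ: "finite BZ" and BZK: "BZ \<subseteq> K" and BGK: "BG \<subseteq> K" using B BG(1) G_K by (auto simp: BZ_def)
  have main': "\<forall>Z \<subseteq> BG. \<forall>c e :: real. c \<noteq> 0 \<longrightarrow> (\<exists>S. ext S \<and> nullity S = dim N0 + card Z \<and>
       (\<forall>g\<in>BG - Z. inner (S g) g = c) \<and> (\<forall>z\<in>BZ. inner (S z) z = e))"
    by (intro allI impI; rule main; assumption)
  have "complements BG BZ" unfolding complements_def
    by (intro conjI BG(2) cG fBZ BGK BZK BZe main')
  then show ?thesis by blast
qed

lemma ext_exists_iff:
  "(\<exists>S. ext S \<and> nullity S = m) \<longleftrightarrow> dim N0 \<le> m \<and> m + dim V \<le> dim N0 + dim (span (V \<union> G))"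
proof
  assume "\<exists>S. ext S \<and> nullity S = m"
  then show "dim N0 \<le> m \<and> m + dim V \<le> dim N0 + dim (span (V \<union> G))" using nullity_le nullity_ge by blast
next
  assume m: "dim N0 \<le> m \<and> m + dim V \<le> dim N0 + dim (span (V \<union> G))"
  obtain BG BZ where c: "complements BG BZ" using complements_exist by blast
  have BG: "finite BG" "card BG + dim V = dim (span (V \<union> G))"
    "finite BZ" "BG \<subseteq> K" "BZ \<subseteq> K" "BZ = {} \<longleftrightarrow> span (V \<union> G) = K"
    and ex: "\<forall>Z \<subseteq> BG. \<forall>c e :: real. c \<noteq> 0 \<longrightarrow> (\<exists>S. ext S \<and> nullity S = dim N0 + card Z \<and>
       (\<forall>g\<in>BG - Z. inner (S g) g = c) \<and> (\<forall>z\<in>BZ. inner (S z) z = e))"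
    using c unfolding complements_def by - (elim conjE, assumption)+
  have "m - dim N0 \<le> card BG" using m BG(2) by auto
  then obtain Z where Z: "Z \<subseteq> BG" "card Z = m - dim N0" using obtain_subset_with_card_n by metis
  then show "\<exists>S. ext S \<and> nullity S = m" using ex[rule_format, OF Z(1), of 1 1] m by auto
qed

text \<open>If \<open>BG - Z\<close> or \<open>BZ\<close> is nonempty, a diagonal entry of the form
  is free, and the choices 1 and 2 give two extensions of the same nullity that differ on
  \<open>K\<close>. The converse is \<open>ext_unique\<close>.\<close>

lemma ext_unique_iff:
  assumes m: "dim N0 \<le> m" "m + dim V \<le> dim N0 + dim (span (V \<union> G))"
  shows "(\<forall>S S'. ext S \<and> nullity S = m \<and> ext S' \<and> nullity S' = m \<longrightarrow> (\<forall>x\<in>K. S x = S' x)) \<longleftrightarrow>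
    span (V \<union> G) = K \<and> m + dim V = dim N0 + dim (span (V \<union> G))"
    (is "?U \<longleftrightarrow> ?C")
proof
  assume C: ?C
  show ?U
  proof (intro allI impI ballI)
    fix S S' x assume "ext S \<and> nullity S = m \<and> ext S' \<and> nullity S' = m" "x \<in> K"
    then show "S x = S' x" using C by (intro ext_unique[of S S']) (simp_all del: real_vector.dim_span)
  qed
next
  assume U: ?U
  obtain BG BZ where c: "complements BG BZ" using complements_exist by blast
  have BG: "finite BG" "card BG + dim V = dim (span (V \<union> G))"
    "finite BZ" "BG \<subseteq> K" "BZ \<subseteq> K" "BZ = {} \<longleftrightarrow> span (V \<union> G) = K"
    and ex: "\<forall>Z \<subseteq> BG. \<forall>c e :: real. c \<noteq> 0 \<longrightarrow> (\<exists>S. ext S \<and> nullity S = dim N0 + card Z \<and>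
       (\<forall>g\<in>BG - Z. inner (S g) g = c) \<and> (\<forall>z\<in>BZ. inner (S z) z = e))"
    using c unfolding complements_def by - (elim conjE, assumption)+
  have "m - dim N0 \<le> card BG" using m BG(2) by auto
  then obtain Z where Z: "Z \<subseteq> BG" "card Z = m - dim N0" using obtain_subset_with_card_n by metis
  obtain S where S: "ext S" "nullity S = m" "\<forall>g\<in>BG - Z. inner (S g) g = 1" "\<forall>z\<in>BZ. inner (S z) z = 1"
    using ex[rule_format, OF Z(1), of 1 1] Z(2) m by auto
  obtain S' where S': "ext S'" "nullity S' = m" "\<forall>g\<in>BG - Z. inner (S' g) g = 2" "\<forall>z\<in>BZ. inner (S' z) z = 2"
    using ex[rule_format, OF Z(1), of 2 2] Z(2) m by auto
  have eq: "S x = S' x" if "x \<in> K" for x using U[rule_format, of S S' x] S(1,2) S'(1,2) that by simp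
  have "BG - Z = {}"
  proof (rule ccontr)
    assume "BG - Z \<noteq> {}"
    then obtain g where "g \<in> BG - Z" by blast
    then have "inner (S g) g = 1" "inner (S' g) g = 2" "S g = S' g" using S(3) S'(3) eq BG(4) by auto
    then show False by simp
  qed
  then have "Z = BG" using Z by auto
  moreover have "BZ = {}"
  proof (rule ccontr)
    assume "BZ \<noteq> {}"
    then obtain g where "g \<in> BZ" by blast
    then have "inner (S g) g = 1" "inner (S' g) g = 2" "S g = S' g" using S(4) S'(4) eq BG(5) by auto
    then show False by simp
  qed
  ultimately show ?C using Z(2) m BG by auto
qed

end

section \<open>Linear combinations of columns and rank\<close>

lemma is_lincomb_iff:
  assumes "finite I" "\<And>l. l \<in> I \<Longrightarrow> w l \<in> carrier_vec d" "v \<in> carrier_vec d"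
  shows "is_lincomb d w I v \<longleftrightarrow> (\<exists>\<gamma>. \<forall>r<d. v $ r = (\<Sum>l\<in>I. \<gamma> l * w l $ r))"
proof -
  have c: "finsum_vec TYPE(real) d (\<lambda>l. \<gamma> l \<cdot>\<^sub>v w l) I \<in> carrier_vec d" for \<gamma>
    using assms(2) by (intro finsum_vec_closed) auto
  have dw: "l \<in> I \<Longrightarrow> dim_vec (w l) = d" for l using assms(2)[of l] by auto
  have i: "finsum_vec TYPE(real) d (\<lambda>l. \<gamma> l \<cdot>\<^sub>v w l) I $ r = (\<Sum>l\<in>I. \<gamma> l * w l $ r)" if "r < d" for \<gamma> r
  proof -
    have "finsum_vec TYPE(real) d (\<lambda>l. \<gamma> l \<cdot>\<^sub>v w l) I $ r = (\<Sum>l\<in>I. (\<gamma> l \<cdot>\<^sub>v w l) $ r)"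
      using assms(2) by (intro index_finsum_vec[OF assms(1) that]) auto
    also have "\<dots> = (\<Sum>l\<in>I. \<gamma> l * w l $ r)"
      using dw that by (intro sum.cong) auto
    finally show ?thesis .
  qed
  have "v = finsum_vec TYPE(real) d (\<lambda>l. \<gamma> l \<cdot>\<^sub>v w l) I \<longleftrightarrow> (\<forall>r<d. v $ r = (\<Sum>l\<in>I. \<gamma> l * w l $ r))" for \<gamma>
    using c[of \<gamma>] i[of _ \<gamma>] assms(3) by (auto simp: vec_eq_iff carrier_vecD)
  then show ?thesis by (simp add: is_lincomb_def)
qed

lemma orth_generators_0:
  fixes w :: "nat \<Rightarrow> 'a::real_inner"
  assumes "u \<in> span (w ` I)" "\<And>i. i \<in> I \<Longrightarrow> inner (w i) u = 0"
  shows "u = 0"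
  by (rule eq_0_if_orth_span[OF assms(1)]) (use assms(2) in \<open>auto simp: inner_commute[of u]\<close>)

text \<open>A combination of columns of a Gram matrix consists of the inner products of the same
  combination of vectors with a spanning family. So columns and vectors satisfy the same relations,
  and matrix rank becomes a dimension of a span.\<close>

lemma mat_rank_gram:
  fixes w :: "nat \<Rightarrow> 'a::real_inner"
  assumes A: "A \<in> carrier_mat N N" "\<And>i j. i < N \<Longrightarrow> j < N \<Longrightarrow> A $$ (i, j) = inner (w i) (w j)"
  shows "mat_rank A = dim (span (w ` {..<N}))"
proof -
  obtain B where B: "B \<subseteq> w ` {..<N}" "independent B" "w ` {..<N} \<subseteq> span B" "card B = dim (w ` {..<N})"
    by (rule real_vector.basis_exists)
  obtain J where J: "J \<subseteq> {..<N}" "inj_on w J" "B = w ` J" using B(1) by (metis subset_image_inj)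
  have fJ: "finite J" using J finite_subset by auto
  interpret vec_space "TYPE(real)" N .
  have colA: "col A j \<in> carrier_vec N" for j using A(1) by auto
  have colAi: "col A j $ i = inner (w i) (w j)" if "i < N" "j < N" for i j
    using A that by (auto simp: col_def)
  have setcols: "set (cols A) = col A ` {..<N}" using A(1) by (auto simp: cols_def)
  have zero: "(\<Sum>j\<in>I. c j *\<^sub>R w j) = 0"
    if "I \<subseteq> {..<N}" "\<And>i. i < N \<Longrightarrow> (\<Sum>j\<in>I. c j * col A j $ i) = 0" for I c
  proof (rule orth_generators_0[of _ w "{..<N}"])
    show "(\<Sum>j\<in>I. c j *\<^sub>R w j) \<in> real_vector.span (w ` {..<N})"
      using that(1) by (intro real_vector.span_sum real_vector.span_scale real_vector.span_base) auto
    show "inner (w i) (\<Sum>j\<in>I. c j *\<^sub>R w j) = 0" if i: "i \<in> {..<N}" for i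
    proof -
      have "(\<Sum>j\<in>I. c j * col A j $ i) = (\<Sum>j\<in>I. c j * inner (w i) (w j))"
        using i \<open>I \<subseteq> {..<N}\<close> colAi by (intro sum.cong) auto
      then show ?thesis using that(1) i \<open>\<And>i. i < N \<Longrightarrow> (\<Sum>j\<in>I. c j * col A j $ i) = 0\<close>[of i]
        by (simp add: inner_sum_right)
    qed
  qed
  \<comment> \<open>The rank is computed from a set of columns, so different chosen vectors must
    have different columns.\<close>
  have inj: "inj_on (col A) J"
  proof (rule inj_onI)
    fix j k assume jk: "j \<in> J" "k \<in> J" "col A j = col A k"
    have "w j - w k = 0"
    proof (rule orth_generators_0[of _ w "{..<N}"])
      show "w j - w k \<in> real_vector.span (w ` {..<N})"
        using jk J by (intro real_vector.span_diff real_vector.span_base) auto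
      fix i assume "i \<in> {..<N}"
      then show "inner (w i) (w j - w k) = 0" using jk J(1) colAi[of i j] colAi[of i k] by (simp add: inner_diff_right subset_eq)
    qed
    then show "j = k" using jk J(2) by (simp add: inj_on_eq_iff)
  qed
  have ind: "independent (w ` J)" using B J by simp
  have indJ: "c j = 0" if "I \<subseteq> J" "(\<Sum>j\<in>I. c j *\<^sub>R w j) = 0" "j \<in> I" for c I j
  proof -
    have injI: "inj_on w I" using J(2) that(1) inj_on_subset by blast
    have "(\<Sum>b\<in>w ` I. c (inv_into I w b) *\<^sub>R b) = (\<Sum>j\<in>I. c j *\<^sub>R w j)"
      using injI by (simp add: sum.reindex)
    moreover have "finite (w ` I)" using that(1) fJ finite_subset by blast
    moreover have "w ` I \<subseteq> w ` J" using that(1) by auto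
    ultimately have "c (inv_into I w (w j)) = 0"
      using that
      by (intro real_vector.independent_explicit_module[THEN iffD1, rule_format, OF ind,
            of "w ` I" "\<lambda>b. c (inv_into I w b)" "w j"]) auto
    then show ?thesis using injI that(3) by simp
  qed
  have li: "lin_indpt (col A ` J)"
  proof
    assume "lin_dep (col A ` J)"
    then obtain F a u where F: "finite F" "F \<subseteq> col A ` J" "lincomb a F = 0\<^sub>v N" "u \<in> F" "a u \<noteq> 0"
      unfolding lin_dep_def by (auto simp: module_vec_simps)
    then obtain I where I: "I \<subseteq> J" "F = col A ` I" by (meson subset_imageE)
    have injI: "inj_on (col A) I" using inj I(1) inj_on_subset by blast
    have Fc: "F \<subseteq> carrier_vec N" using F(2) colA by auto
    have "(\<Sum>j\<in>I. a (col A j) *\<^sub>R w j) = 0"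
    proof (rule zero)
      show "I \<subseteq> {..<N}" using I J by auto
      fix i assume i: "i < N"
      have "(\<Sum>x\<in>F. a x * x $ i) = lincomb a F $ i" using lincomb_index[OF i Fc] by simp
      also have "\<dots> = 0" using F(3) i by simp
      finally show "(\<Sum>j\<in>I. a (col A j) * col A j $ i) = 0" using injI by (simp add: I(2) sum.reindex)
    qed
    moreover obtain j where "j \<in> I" "u = col A j" using F(4) I(2) by auto
    ultimately show False using indJ[OF I(1), of "\<lambda>j. a (col A j)" j] F(5) by simp
  qed
  have maxi: "maximal (col A ` J) (\<lambda>T. T \<subseteq> set (cols A) \<and> lin_indpt T)"
    unfolding maximal_def
  proof (intro conjI allI impI)
    show "col A ` J \<subseteq> set (cols A)" using J setcols by auto
    show "lin_indpt (col A ` J)" by (rule li)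
    fix T assume T: "col A ` J \<subseteq> T \<and> T \<subseteq> set (cols A) \<and> lin_indpt T"
    show "T = col A ` J"
    proof (rule ccontr)
      assume "T \<noteq> col A ` J"
      then obtain u where u: "u \<in> T" "u \<notin> col A ` J" using T by auto
      then obtain k where k: "k < N" "u = col A k" using T setcols by auto
      obtain g where g: "w k = (\<Sum>j\<in>J. g j *\<^sub>R w j)"
        using B(3) k span_image_explicit[OF fJ, of "w k" w] J(3) by auto
      \<comment> \<open>The expansion of \<open>w k\<close> in the chosen vectors, read as a
        relation among columns in which the additional column \<open>u\<close> has coefficient
        -1.\<close>
      define a where "a = (\<lambda>x. if x = u then - 1 else g (inv_into J (col A) x))"
      let ?F = "insert u (col A ` J)"
      have Fc: "?F \<subseteq> carrier_vec N" using k colA by auto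
      have fF: "finite ?F" using fJ by auto
      have "lincomb a ?F = 0\<^sub>v N"
      proof (rule eq_vecI)
        show "dim_vec (lincomb a ?F) = dim_vec (0\<^sub>v N)" using lincomb_dim[OF fF Fc] by simp
        fix i assume "i < dim_vec (0\<^sub>v N)"
        then have i: "i < N" by simp
        have "lincomb a ?F $ i = (\<Sum>x\<in>?F. a x * x $ i)" by (rule lincomb_index[OF i Fc])
        also have "\<dots> = a u * u $ i + (\<Sum>x\<in>col A ` J. a x * x $ i)" using u fJ by simp
        also have "(\<Sum>x\<in>col A ` J. a x * x $ i) = (\<Sum>j\<in>J. a (col A j) * col A j $ i)"
          using inj by (simp add: sum.reindex)
        also have "\<dots> = (\<Sum>j\<in>J. g j * inner (w i) (w j))"
          using u inj i J colAi by (intro sum.cong) (auto simp: a_def)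
        also have "\<dots> = inner (w i) (w k)" unfolding g by (simp add: inner_sum_right)
        finally show "lincomb a ?F $ i = 0\<^sub>v N $ i" using i k colAi by (simp add: a_def)
      qed
      then have "lin_dep T"
        using u T by (intro lin_dep_crit[where A = ?F and a = a and v = u, OF fF]) (auto simp: a_def module_vec_simps)
      then show False using T by simp
    qed
  qed
  have "mat_rank A = rank A" using A(1) by (simp add: mat_rank_def)
  also have "\<dots> = card (col A ` J)" by (rule rank_card_indpt[OF A(1) maxi])
  also have "\<dots> = card B" using inj J by (simp add: card_image)
  finally show ?thesis using B(4) by (simp add: real_vector.dim_span)
qed

section \<open>Densities of signed and matrix-valued measures\<close>

lemma measure_of_eq_measure:
  assumes "sets M = sets borel" "\<And>D. D \<in> sets borel \<Longrightarrow> F D = emeasure M D"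
  shows "measure_of UNIV (sets borel) F = (M :: real measure)"
proof -
  have sp: "space M = UNIV" using sets_eq_imp_space_eq[OF assms(1)] by simp
  have "measure_of UNIV (sets borel) F = measure_of UNIV (sets borel) (emeasure M)"
    by (rule measure_of_eq) (use assms(2) sets.sigma_sets_eq[of "borel :: real measure"] in auto)
  also have "\<dots> = measure_of (space M) (sets M) (emeasure M)" using assms(1) sp by simp
  also have "\<dots> = M" by (rule measure_of_of_measure)
  finally show ?thesis .
qed

text \<open>The supremum is attained at the part of \<open>D\<close> where \<open>h\<close> is
  nonnegative, the positive set of a Hahn decomposition.\<close>

lemma pos_variation_density:
  assumes sets: "sets \<tau> = sets (borel :: real measure)" and h: "integrable \<tau> h"
    and \<nu>: "\<And>D. D \<in> sets borel \<Longrightarrow> \<nu> D = integral\<^sup>L \<tau> (\<lambda>x. indicator D x * h x)"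
  shows "pos_variation \<nu> = density \<tau> (\<lambda>x. ennreal (max 0 (h x)))"
  unfolding pos_variation_def
proof (rule measure_of_eq_measure)
  have [measurable_cong]: "sets \<tau> = sets borel" by fact
  have [measurable]: "h \<in> borel_measurable \<tau>" using h by auto
  show "sets (density \<tau> (\<lambda>x. ennreal (max 0 (h x)))) = sets borel" using sets by simp
  fix D :: "real set" assume D[measurable]: "D \<in> sets borel"
  have int: "integrable \<tau> (\<lambda>x. indicator E x * g x)" if "E \<in> sets borel" "integrable \<tau> g"
    for E and g :: "real \<Rightarrow> real"
    using that sets integrable_mult_indicator[of E \<tau> g] by simp
  have hp: "integrable \<tau> (\<lambda>x. max 0 (h x))" using h by auto
  have val: "emeasure (density \<tau> (\<lambda>x. ennreal (max 0 (h x)))) E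
      = ennreal (integral\<^sup>L \<tau> (\<lambda>x. indicator E x * max 0 (h x)))" if E[measurable]: "E \<in> sets borel" for E
  proof -
    have "emeasure (density \<tau> (\<lambda>x. ennreal (max 0 (h x)))) E
        = (\<integral>\<^sup>+x. ennreal (indicator E x * max 0 (h x)) \<partial>\<tau>)"
      using E sets by (subst emeasure_density) (auto intro!: nn_integral_cong split: split_indicator)
    also have "\<dots> = ennreal (integral\<^sup>L \<tau> (\<lambda>x. indicator E x * max 0 (h x)))"
      using int[OF E hp] by (intro nn_integral_eq_integral) auto
    finally show ?thesis .
  qed
  show "(SUP E\<in>{E \<in> sets borel. E \<subseteq> D}. ennreal (\<nu> E)) = emeasure (density \<tau> (\<lambda>x. ennreal (max 0 (h x)))) D"
  proof (rule antisym)
    show "(SUP E\<in>{E \<in> sets borel. E \<subseteq> D}. ennreal (\<nu> E)) \<le> emeasure (density \<tau> (\<lambda>x. ennreal (max 0 (h x)))) D"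
    proof (rule SUP_least)
      fix E assume "E \<in> {E \<in> sets borel. E \<subseteq> D}"
      then have E: "E \<in> sets borel" "E \<subseteq> D" by auto
      have "\<nu> E \<le> integral\<^sup>L \<tau> (\<lambda>x. indicator D x * max 0 (h x))"
        unfolding \<nu>[OF E(1)] using E
        by (intro integral_mono int h hp D) (auto split: split_indicator)
      then show "ennreal (\<nu> E) \<le> emeasure (density \<tau> (\<lambda>x. ennreal (max 0 (h x)))) D"
        unfolding val[OF D] by (rule ennreal_leI)
    qed
    define E where "E = {x \<in> D. 0 \<le> h x}"
    have "{x \<in> space \<tau>. x \<in> D \<and> 0 \<le> h x} \<in> sets \<tau>" by measurable
    then have E: "E \<in> sets borel" "E \<subseteq> D" using sets sets_eq_imp_space_eq[OF sets] by (auto simp: E_def)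
    have "\<nu> E = integral\<^sup>L \<tau> (\<lambda>x. indicator D x * max 0 (h x))"
      unfolding \<nu>[OF E(1)] by (intro Bochner_Integration.integral_cong) (auto simp: E_def split: split_indicator)
    then show "emeasure (density \<tau> (\<lambda>x. ennreal (max 0 (h x)))) D \<le> (SUP E\<in>{E \<in> sets borel. E \<subseteq> D}. ennreal (\<nu> E))"
      unfolding val[OF D] using E by (intro SUP_upper2[of E]) auto
  qed
qed

text \<open>Every signed integral below is computed through this formula: for the given measure with
  the trace measure as \<open>\<tau>\<close>, for atomic measures with counting measure on the
  atoms.\<close>

lemma signed_integral_density:
  assumes sets: "sets \<tau> = sets (borel :: real measure)" and h: "integrable \<tau> h"
    and \<nu>: "\<And>D. D \<in> sets borel \<Longrightarrow> \<nu> D = integral\<^sup>L \<tau> (\<lambda>x. indicator D x * h x)"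
    and f: "f \<in> borel_measurable borel" "integrable \<tau> (\<lambda>x. f x * h x)"
  shows "signed_integral \<nu> f = integral\<^sup>L \<tau> (\<lambda>x. f x * h x)"
proof -
  have [measurable]: "h \<in> borel_measurable \<tau>" using h by auto
  have [measurable]: "f \<in> borel_measurable \<tau>" using f(1) sets by (simp cong: measurable_cong_sets)
  have pos: "pos_variation \<nu> = density \<tau> (\<lambda>x. ennreal (max 0 (h x)))"
    by (rule pos_variation_density[OF sets h \<nu>])
  have neg: "pos_variation (\<lambda>E. - \<nu> E) = density \<tau> (\<lambda>x. ennreal (max 0 (- h x)))"
    by (rule pos_variation_density[OF sets]) (use h \<nu> in auto)
  have i1: "integrable \<tau> (\<lambda>x. max 0 (h x) * f x)" and i2: "integrable \<tau> (\<lambda>x. max 0 (- h x) * f x)"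
  proof -
    have "\<bar>max 0 (h x) * f x\<bar> \<le> \<bar>f x * h x\<bar>" "\<bar>max 0 (- h x) * f x\<bar> \<le> \<bar>f x * h x\<bar>" for x
      unfolding abs_mult by (subst mult.commute, rule mult_left_mono; simp)+
    then show "integrable \<tau> (\<lambda>x. max 0 (h x) * f x)" "integrable \<tau> (\<lambda>x. max 0 (- h x) * f x)"
      by (auto intro!: Bochner_Integration.integrable_bound[OF f(2)])
  qed
  have "signed_integral \<nu> f = integral\<^sup>L \<tau> (\<lambda>x. max 0 (h x) * f x) - integral\<^sup>L \<tau> (\<lambda>x. max 0 (- h x) * f x)"
    unfolding signed_integral_def neg pos
    by (simp add: integral_density)
  also have "\<dots> = integral\<^sup>L \<tau> (\<lambda>x. max 0 (h x) * f x - max 0 (- h x) * f x)"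
    using i1 i2 by simp
  also have "\<dots> = integral\<^sup>L \<tau> (\<lambda>x. f x * h x)"
    by (intro Bochner_Integration.integral_cong) (auto simp: max_def)
  finally show ?thesis .
qed

text \<open>On the set where \<open>q\<close> is negative the integral of \<open>- q\<close> is both
  nonnegative and nonpositive, so it vanishes and that set is null.\<close>

lemma AE_nonneg_if_set_integrals_nonneg:
  fixes q :: "real \<Rightarrow> real"
  assumes sets: "sets \<tau> = sets borel" and q: "integrable \<tau> q"
    and nn: "\<And>D. D \<in> sets borel \<Longrightarrow> 0 \<le> integral\<^sup>L \<tau> (\<lambda>x. indicator D x * q x)"
  shows "AE x in \<tau>. 0 \<le> q x"
proof -
  have [measurable]: "q \<in> borel_measurable \<tau>" using q by auto
  define D where "D = {x. q x < 0}"
  have "{x \<in> space \<tau>. q x < 0} \<in> sets \<tau>" by measurable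
  then have D: "D \<in> sets borel" using sets sets_eq_imp_space_eq[OF sets] by (auto simp: D_def)
  have int: "integrable \<tau> (\<lambda>x. indicator D x * q x)"
    using D sets integrable_mult_indicator[OF _ q, of D] by simp
  have "integral\<^sup>L \<tau> (\<lambda>x. - (indicator D x * q x)) = 0"
  proof (rule antisym)
    show "integral\<^sup>L \<tau> (\<lambda>x. - (indicator D x * q x)) \<le> 0" using nn[OF D] by simp
    show "0 \<le> integral\<^sup>L \<tau> (\<lambda>x. - (indicator D x * q x))"
      by (intro integral_nonneg_AE) (auto simp: D_def split: split_indicator)
  qed
  then have "AE x in \<tau>. - (indicator D x * q x) = 0"
    using int by (subst (asm) integral_nonneg_eq_0_iff_AE) (auto simp: D_def split: split_indicator)
  then show ?thesis by eventually_elim (auto simp: D_def split: split_indicator_asm)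
qed

lemma nonneg_signed_measure:
  assumes "signed_borel_measure \<nu>" "\<And>D. D \<in> sets borel \<Longrightarrow> 0 \<le> \<nu> D"
  defines "M \<equiv> measure_of UNIV (sets borel) (\<lambda>D. ennreal (\<nu> D))"
  shows "sets M = sets borel" "\<And>D. D \<in> sets borel \<Longrightarrow> emeasure M D = ennreal (\<nu> D)" "finite_measure M"
proof -
  have ss: "sigma_sets UNIV (sets (borel :: real measure)) = sets borel"
    using sets.sigma_sets_eq[of "borel :: real measure"] by simp
  show sets: "sets M = sets borel" unfolding M_def by (simp add: ss)
  have ca: "countably_additive (sets borel) (\<lambda>D. ennreal (\<nu> D))"
  proof (rule countably_additiveI)
    fix E :: "nat \<Rightarrow> real set" assume E: "range E \<subseteq> sets borel" "disjoint_family E" "\<Union> (range E) \<in> sets borel"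
    then have "(\<lambda>i. \<nu> (E i)) sums \<nu> (\<Union>i. E i)" using assms(1) by (auto simp: signed_borel_measure_def)
    then show "(\<Sum>i. ennreal (\<nu> (E i))) = ennreal (\<nu> (\<Union> (range E)))"
      using E assms(2) by (intro suminf_ennreal_eq) auto
  qed
  show em: "emeasure M D = ennreal (\<nu> D)" if "D \<in> sets borel" for D
  proof (rule emeasure_measure_of[OF M_def[THEN meta_eq_to_obj_eq]])
    show "positive (sets M) (\<lambda>D. ennreal (\<nu> D))"
      using assms(1) by (auto simp: positive_def signed_borel_measure_def)
  qed (use that sets ca in auto)
  show "finite_measure M"
  proof
    have "space M = UNIV" using sets_eq_imp_space_eq[OF sets] by simp
    then show "emeasure M (space M) \<noteq> \<infinity>" using em[of UNIV] by simp
  qed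
qed

text \<open>\<open>Radon_Nikodym\<close> concerns positive measures, so it is applied to
  \<open>\<nu> + \<tau>\<close>, which lies between 0 and \<open>2 \<tau>\<close>. Its density has
  values in [0, 2] almost everywhere, and subtracting 1 gives \<open>h\<close>.\<close>

lemma RN_bounded:
  assumes fin: "finite_measure \<tau>" and sets: "sets \<tau> = sets (borel :: real measure)"
    and \<nu>: "signed_borel_measure \<nu>"
    and le: "\<And>D. D \<in> sets borel \<Longrightarrow> \<bar>\<nu> D\<bar> \<le> measure \<tau> D"
  obtains h where "h \<in> borel_measurable borel" "\<And>x. \<bar>h x\<bar> \<le> 1"
    "\<And>D. D \<in> sets borel \<Longrightarrow> \<nu> D = integral\<^sup>L \<tau> (\<lambda>x. indicator D x * h x)"
proof -
  interpret finite_measure \<tau> by (rule fin)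
  have sp: "space \<tau> = UNIV" using sets_eq_imp_space_eq[OF sets] by simp
  have [measurable_cong]: "sets \<tau> = sets borel" by fact
  define \<nu>' where "\<nu>' = (\<lambda>D. \<nu> D + measure \<tau> D)"
  have \<nu>': "signed_borel_measure \<nu>'"
    unfolding signed_borel_measure_def
  proof (intro conjI allI impI)
    show "\<nu>' {} = 0" using \<nu> by (simp add: \<nu>'_def signed_borel_measure_def)
    fix E :: "nat \<Rightarrow> real set" assume E: "range E \<subseteq> sets borel" "disjoint_family E"
    have "(\<lambda>i. measure \<tau> (E i)) sums measure \<tau> (\<Union>i. E i)"
      using E sets by (intro finite_measure_UNION) auto
    then show "(\<lambda>i. \<nu>' (E i)) sums \<nu>' (\<Union>i. E i)"
      unfolding \<nu>'_def using \<nu> E by (intro sums_add) (auto simp: signed_borel_measure_def)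
  qed
  have nn: "0 \<le> \<nu>' D" if "D \<in> sets borel" for D using le[OF that] by (simp add: \<nu>'_def)
  define N where "N = measure_of UNIV (sets borel) (\<lambda>D. ennreal (\<nu>' D))"
  have N: "sets N = sets borel" "\<And>D. D \<in> sets borel \<Longrightarrow> emeasure N D = ennreal (\<nu>' D)"
    using nonneg_signed_measure[OF \<nu>'] nn by (auto simp: N_def)
  have "absolutely_continuous \<tau> N"
    unfolding absolutely_continuous_def
  proof
    fix D assume D: "D \<in> null_sets \<tau>"
    then have Db: "D \<in> sets borel" using sets by auto
    have "measure \<tau> D = 0" using D by (auto simp: null_sets_def measure_def)
    then have "\<nu>' D = 0" using le[OF Db] by (simp add: \<nu>'_def)
    then show "D \<in> null_sets N" using Db N(1) N(2)[OF Db] by (auto simp: null_sets_def)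
  qed
  then obtain f where f[measurable]: "f \<in> borel_measurable \<tau>" and dN: "density \<tau> f = N"
    using Radon_Nikodym[of N] N(1) sets by auto
  have fN: "(\<integral>\<^sup>+x. f x * indicator D x \<partial>\<tau>) = ennreal (\<nu>' D)" if "D \<in> sets borel" for D
    using N(2)[OF that] that sets by (simp flip: dN add: emeasure_density)
  have "(\<integral>\<^sup>+x. f x \<partial>\<tau>) \<noteq> \<infinity>" using fN[of UNIV] by simp
  then have ffin: "AE x in \<tau>. f x \<noteq> \<infinity>" by (intro nn_integral_noteq_infinite) auto
  define g where "g = (\<lambda>x. enn2real (f x))"
  have gm[measurable]: "g \<in> borel_measurable \<tau>" unfolding g_def by measurable
  have gf: "(\<integral>\<^sup>+x. ennreal (indicator D x * g x) \<partial>\<tau>) = ennreal (\<nu>' D)" if "D \<in> sets borel" for D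
  proof -
    have "(\<integral>\<^sup>+x. ennreal (indicator D x * g x) \<partial>\<tau>) = (\<integral>\<^sup>+x. f x * indicator D x \<partial>\<tau>)"
      using ffin by (intro nn_integral_cong_AE, eventually_elim)
        (auto simp: g_def less_top split: split_indicator)
    then show ?thesis using fN[OF that] by simp
  qed
  have gint: "integrable \<tau> g"
    using gf[of UNIV] by (intro integrableI_nonneg) (auto simp: g_def)
  have gD: "integral\<^sup>L \<tau> (\<lambda>x. indicator D x * g x) = \<nu>' D" if D: "D \<in> sets borel" for D
  proof -
    have "integral\<^sup>L \<tau> (\<lambda>x. indicator D x * g x) = enn2real (\<integral>\<^sup>+x. ennreal (indicator D x * g x) \<partial>\<tau>)"
      using D by (intro integral_eq_nn_integral) (auto simp: g_def split: split_indicator)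
    then show ?thesis using gf[OF D] nn[OF D] by simp
  qed
  have iD: "integral\<^sup>L \<tau> (\<lambda>x. indicator D x) = measure \<tau> D" if "D \<in> sets borel" for D
    using that sets sp by simp
  have intD: "integrable \<tau> (\<lambda>x. indicator D x * k x)" if "D \<in> sets borel" "integrable \<tau> k" for D and k :: "real \<Rightarrow> real"
    using that sets integrable_mult_indicator[of D \<tau> k] by simp
  have "AE x in \<tau>. 0 \<le> 2 - g x"
  proof (rule AE_nonneg_if_set_integrals_nonneg[OF sets])
    show "integrable \<tau> (\<lambda>x. 2 - g x)" using gint by simp
    fix D :: "real set" assume D: "D \<in> sets borel"
    have "integral\<^sup>L \<tau> (\<lambda>x. indicator D x * (2 - g x)) = integral\<^sup>L \<tau> (\<lambda>x. indicator D x * 2 - indicator D x * g x)"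
      by (simp add: algebra_simps)
    also have "\<dots> = integral\<^sup>L \<tau> (\<lambda>x. indicator D x * 2) - integral\<^sup>L \<tau> (\<lambda>x. indicator D x * g x)"
      by (intro Bochner_Integration.integral_diff intD D gint) simp
    also have "\<dots> = 2 * measure \<tau> D - \<nu>' D" using gD[OF D] iD[OF D] by simp
    finally show "0 \<le> integral\<^sup>L \<tau> (\<lambda>x. indicator D x * (2 - g x))" using le[OF D] by (simp add: \<nu>'_def)
  qed
  then have g2: "AE x in \<tau>. g x \<le> 2" by simp
  \<comment> \<open>Truncation at 2 changes \<open>g\<close> only on a null set and makes the bound
    on \<open>h\<close> hold at every point.\<close>
  define h where "h = (\<lambda>x. min 2 (g x) - 1)"
  have hm: "h \<in> borel_measurable borel"
  proof -
    have "h \<in> borel_measurable \<tau>" unfolding h_def by measurable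
    then show ?thesis using sets by (simp cong: measurable_cong_sets)
  qed
  show ?thesis
  proof (rule that[OF hm])
    have "0 \<le> g x" for x by (simp add: g_def)
    then show "\<bar>h x\<bar> \<le> 1" for x by (simp add: h_def abs_le_iff min_def)
    fix D :: "real set" assume D[measurable]: "D \<in> sets borel"
    have "integral\<^sup>L \<tau> (\<lambda>x. indicator D x * h x) = integral\<^sup>L \<tau> (\<lambda>x. indicator D x * g x - indicator D x)"
      using g2 hm sets
      by (intro integral_cong_AE) (auto simp: h_def split: split_indicator cong: measurable_cong_sets)
    also have "\<dots> = \<nu>' D - measure \<tau> D"
      using gD[OF D] iD[OF D] intD[OF D gint] intD[OF D, of "\<lambda>_. 1"] by simp
    finally show "\<nu> D = integral\<^sup>L \<tau> (\<lambda>x. indicator D x * h x)" by (simp add: \<nu>'_def)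
  qed
qed

section \<open>Positive semidefinite matrices and their quadratic forms\<close>

lemma quad_form:
  fixes A :: "real mat"
  assumes "A \<in> carrier_mat p p" "v \<in> carrier_vec p"
  shows "scalar_prod v (A *\<^sub>v v) = (\<Sum>i<p. \<Sum>j<p. v $ i * v $ j * A $$ (i, j))"
  using assms
  by (auto simp: scalar_prod_def mult_mat_vec_def sum_distrib_left lessThan_atLeast0 mult_ac intro!: sum.cong)

lemma psd_quad:
  assumes "psd p A"
  shows "0 \<le> (\<Sum>i<p. \<Sum>j<p. c i * c j * A $$ (i, j))"
proof -
  have A: "A \<in> carrier_mat p p" using assms by (simp add: psd_def sym_mats_def)
  have "0 \<le> scalar_prod (vec p c) (A *\<^sub>v vec p c)" using assms by (simp add: psd_def)
  also have "\<dots> = (\<Sum>i<p. \<Sum>j<p. vec p c $ i * vec p c $ j * A $$ (i, j))" by (rule quad_form[OF A]) simp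
  also have "\<dots> = (\<Sum>i<p. \<Sum>j<p. c i * c j * A $$ (i, j))" by (intro sum.cong) auto
  finally show ?thesis .
qed

lemma psd_sym:
  assumes "psd p A" "i < p" "j < p"
  shows "A $$ (i, j) = A $$ (j, i)"
proof -
  have "A \<in> carrier_mat p p" "transpose_mat A = A" using assms by (auto simp: psd_def sym_mats_def)
  then show ?thesis using assms by (metis carrier_matD index_transpose_mat(1))
qed

text \<open>The form at \<open>a e_i + b e_j\<close>. Writing the coefficients as a sum of two cases
  keeps the formula valid for \<open>i = j\<close>.\<close>

lemma quad_two_points:
  fixes A :: "nat \<Rightarrow> nat \<Rightarrow> real"
  assumes ij: "i < p" "j < p"
  shows "(\<Sum>k<p. \<Sum>l<p. ((if k = i then a else 0) + (if k = j then b else 0)) *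
      ((if l = i then a else 0) + (if l = j then b else 0)) * A k l)
    = a * a * A i i + a * b * A i j + b * a * A j i + b * b * A j j"
proof -
  have *: "(\<Sum>l<p. ((if l = i then a else 0) + (if l = j then b else 0)) * f l) = a * f i + b * f j" for f
  proof -
    have "(\<Sum>l<p. ((if l = i then a else 0) + (if l = j then b else 0)) * f l)
        = (\<Sum>l<p. if l = i then a * f i else 0) + (\<Sum>l<p. if l = j then b * f j else 0)"
      unfolding sum.distrib[symmetric] by (intro sum.cong) (auto simp: distrib_right)
    then show ?thesis using ij by simp
  qed
  show ?thesis
    unfolding mult.assoc sum_distrib_left[symmetric] * by (simp add: algebra_simps)
qed

text \<open>The form at \<open>e_i + e_j\<close> and at \<open>e_i - e_j\<close> bounds an entry by
  the mean of two diagonal entries, hence by the trace. This is what makes every entry of a matrix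
  measure dominated by its trace measure.\<close>

lemma psd_entry_bound:
  assumes A: "psd p A" and ij: "i < p" "j < p"
  shows "0 \<le> A $$ (i, i)" "\<bar>A $$ (i, j)\<bar> \<le> (\<Sum>k<p. A $$ (k, k))"
proof -
  have q: "0 \<le> a * a * A $$ (i, i) + a * b * A $$ (i, j) + b * a * A $$ (j, i) + b * b * A $$ (j, j)"
    if "i < p" "j < p" for i j a b
    using psd_quad[OF A, of "\<lambda>k. (if k = i then a else 0) + (if k = j then b else 0)"]
      quad_two_points[OF that, of a b "\<lambda>k l. A $$ (k, l)"] by simp
  have d: "0 \<le> A $$ (k, k)" if "k < p" for k using q[OF that that, of 1 0] by simp
  show "0 \<le> A $$ (i, i)" by (rule d[OF ij(1)])
  have le: "A $$ (k, k) \<le> (\<Sum>k<p. A $$ (k, k))" if "k < p" for k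
    using that d by (intro member_le_sum) auto
  show "\<bar>A $$ (i, j)\<bar> \<le> (\<Sum>k<p. A $$ (k, k))"
    using q[OF ij, of 1 1] q[OF ij, of 1 "-1"] psd_sym[OF A ij] le[OF ij(1)] le[OF ij(2)] by (simp add: abs_le_iff)
qed

lemma integral_double_sum:
  fixes f :: "'i \<Rightarrow> 'j \<Rightarrow> 'a \<Rightarrow> real"
  assumes "\<And>i j. i \<in> I \<Longrightarrow> j \<in> J \<Longrightarrow> integrable M (f i j)"
  shows "integrable M (\<lambda>x. \<Sum>i\<in>I. \<Sum>j\<in>J. c i j * f i j x)"
    "integral\<^sup>L M (\<lambda>x. \<Sum>i\<in>I. \<Sum>j\<in>J. c i j * f i j x) = (\<Sum>i\<in>I. \<Sum>j\<in>J. c i j * integral\<^sup>L M (f i j))"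
proof -
  have 1: "integrable M (\<lambda>x. c i j * f i j x)" if "i \<in> I" "j \<in> J" for i j
    using assms[OF that] by simp
  have 2: "integrable M (\<lambda>x. \<Sum>j\<in>J. c i j * f i j x)" if "i \<in> I" for i
    by (intro Bochner_Integration.integrable_sum 1 that)
  show "integrable M (\<lambda>x. \<Sum>i\<in>I. \<Sum>j\<in>J. c i j * f i j x)"
    by (intro Bochner_Integration.integrable_sum 2)
  have "integral\<^sup>L M (\<lambda>x. \<Sum>i\<in>I. \<Sum>j\<in>J. c i j * f i j x) = (\<Sum>i\<in>I. integral\<^sup>L M (\<lambda>x. \<Sum>j\<in>J. c i j * f i j x))"
    by (rule Bochner_Integration.integral_sum) (rule 2)
  also have "\<dots> = (\<Sum>i\<in>I. \<Sum>j\<in>J. c i j * integral\<^sup>L M (f i j))"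
  proof (rule sum.cong[OF refl])
    fix i assume i: "i \<in> I"
    have "integral\<^sup>L M (\<lambda>x. \<Sum>j\<in>J. c i j * f i j x) = (\<Sum>j\<in>J. integral\<^sup>L M (\<lambda>x. c i j * f i j x))"
      by (rule Bochner_Integration.integral_sum) (rule 1[OF i])
    then show "integral\<^sup>L M (\<lambda>x. \<Sum>j\<in>J. c i j * f i j x) = (\<Sum>j\<in>J. c i j * integral\<^sup>L M (f i j))" by simp
  qed
  finally show "integral\<^sup>L M (\<lambda>x. \<Sum>i\<in>I. \<Sum>j\<in>J. c i j * f i j x) = (\<Sum>i\<in>I. \<Sum>j\<in>J. c i j * integral\<^sup>L M (f i j))" .
qed

section \<open>The matrix density of a positive matrix-valued measure\<close>

lemma trace_measure_props:
  assumes "psd_measure p \<mu>"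
  shows "sets (trace_measure p \<mu>) = sets borel" "finite_measure (trace_measure p \<mu>)"
    "\<And>D. D \<in> sets borel \<Longrightarrow> measure (trace_measure p \<mu>) D = (\<Sum>i<p. \<mu> D $$ (i, i))"
proof -
  let ?\<nu> = "\<lambda>D. \<Sum>i<p. \<mu> D $$ (i, i)"
  have \<nu>: "signed_borel_measure ?\<nu>"
    using assms unfolding psd_measure_def signed_borel_measure_def by (auto intro!: sums_sum)
  have nn: "0 \<le> ?\<nu> D" if "D \<in> sets borel" for D
    using that assms psd_entry_bound(1) by (intro sum_nonneg) (auto simp: psd_measure_def)
  note N = nonneg_signed_measure[OF \<nu> nn, folded trace_measure_def]
  show "sets (trace_measure p \<mu>) = sets borel" "finite_measure (trace_measure p \<mu>)"
    using nonneg_signed_measure[OF \<nu>] nn by (auto simp: trace_measure_def)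
  show "measure (trace_measure p \<mu>) D = ?\<nu> D" if "D \<in> sets borel" for D
    using nonneg_signed_measure(2)[OF \<nu>, of D] nn that by (simp add: trace_measure_def measure_def)
qed

text \<open>For a fixed vector \<open>c\<close> positivity of the density holds off a null set
  depending on \<open>c\<close>. One null set for all \<open>c\<close> is obtained from countably
  many rational vectors and a limit.\<close>

lemma psd_measure_density:
  assumes \<mu>: "psd_measure p \<mu>"
  obtains h where "\<forall>i<p. \<forall>j<p. h i j \<in> borel_measurable borel"
    "\<forall>i<p. \<forall>j<p. \<forall>x. \<bar>h i j x\<bar> \<le> 1"
    "\<forall>i<p. \<forall>j<p. h i j = h j i"
    "\<forall>i<p. \<forall>j<p. \<forall>D\<in>sets borel.
       \<mu> D $$ (i, j) = integral\<^sup>L (trace_measure p \<mu>) (\<lambda>x. indicator D x * h i j x)"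
    "AE x in trace_measure p \<mu>. \<forall>c. 0 \<le> (\<Sum>i<p. \<Sum>j<p. c i * c j * h i j x)"
proof -
  let ?\<tau> = "trace_measure p \<mu>"
  note \<tau> = trace_measure_props[OF \<mu>]
  interpret finite_measure ?\<tau> by (rule \<tau>(2))
  have psd: "psd p (\<mu> D)" if "D \<in> sets borel" for D using \<mu> that by (simp add: psd_measure_def)
  have "\<exists>h. h \<in> borel_measurable borel \<and> (\<forall>x. \<bar>h x\<bar> \<le> 1) \<and>
      (\<forall>D \<in> sets borel. \<mu> D $$ (i, j) = integral\<^sup>L ?\<tau> (\<lambda>x. indicator D x * h x))"
    if "i < p" "j < p" for i j
  proof -
    have "signed_borel_measure (\<lambda>D. \<mu> D $$ (i, j))" using \<mu> that by (simp add: psd_measure_def)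
    moreover have "\<bar>\<mu> D $$ (i, j)\<bar> \<le> measure ?\<tau> D" if "D \<in> sets borel" for D
      using psd_entry_bound(2)[OF psd[OF that] \<open>i < p\<close> \<open>j < p\<close>] \<tau>(3)[OF that] by simp
    ultimately show ?thesis using RN_bounded[OF \<tau>(2,1), of "\<lambda>D. \<mu> D $$ (i, j)"] by metis
  qed
  then obtain h0 where h0: "\<And>i j. i < p \<Longrightarrow> j < p \<Longrightarrow> h0 i j \<in> borel_measurable borel \<and> (\<forall>x. \<bar>h0 i j x\<bar> \<le> 1) \<and>
      (\<forall>D \<in> sets borel. \<mu> D $$ (i, j) = integral\<^sup>L ?\<tau> (\<lambda>x. indicator D x * h0 i j x))" by metis
  \<comment> \<open>Densities are unique only almost everywhere; sorting the index pair makes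
    \<open>h\<close> symmetric at every point.\<close>
  define h where "h = (\<lambda>i j. h0 (min i j) (max i j))"
  have h1: "h i j \<in> borel_measurable borel" "\<bar>h i j x\<bar> \<le> 1" if "i < p" "j < p" for i j x
    using h0[of "min i j" "max i j"] that by (auto simp: h_def)
  have h2: "h i j = h j i" for i j by (simp add: h_def min.commute max.commute)
  have h3: "\<mu> D $$ (i, j) = integral\<^sup>L ?\<tau> (\<lambda>x. indicator D x * h i j x)"
    if "i < p" "j < p" "D \<in> sets borel" for i j D
    using h0[of "min i j" "max i j"] that psd_sym[OF psd[OF that(3)] that(1,2)]
    by (cases "i \<le> j") (auto simp: h_def min_def max_def)
  have hint: "integrable ?\<tau> (h i j)" if "i < p" "j < p" for i j
    using h1[OF that] \<tau>(1) by (intro integrable_const_bound[of _ 1]) (auto cong: measurable_cong_sets)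
  \<comment> \<open>Rational coefficient vectors coded as lists, a countable type, so that
    \<open>AE_all_countable\<close> applies.\<close>
  define r where "r = (\<lambda>(xs :: rat list) i. if i < length xs then real_of_rat (xs ! i) else 0)"
  have "AE x in ?\<tau>. \<forall>xs. 0 \<le> (\<Sum>i<p. \<Sum>j<p. r xs i * r xs j * h i j x)"
    unfolding AE_all_countable
  proof
    fix xs
    show "AE x in ?\<tau>. 0 \<le> (\<Sum>i<p. \<Sum>j<p. r xs i * r xs j * h i j x)"
    proof (rule AE_nonneg_if_set_integrals_nonneg[OF \<tau>(1)])
      show "integrable ?\<tau> (\<lambda>x. \<Sum>i<p. \<Sum>j<p. r xs i * r xs j * h i j x)"
        by (rule integral_double_sum) (use hint in auto)
      fix D :: "real set" assume D: "D \<in> sets borel"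
      have iD: "integrable ?\<tau> (\<lambda>x. indicator D x * h i j x)" if "i < p" "j < p" for i j
        using integrable_mult_indicator[OF _ hint[OF that], of D] D \<tau>(1) by simp
      have "integral\<^sup>L ?\<tau> (\<lambda>x. indicator D x * (\<Sum>i<p. \<Sum>j<p. r xs i * r xs j * h i j x))
        = integral\<^sup>L ?\<tau> (\<lambda>x. \<Sum>i<p. \<Sum>j<p. r xs i * r xs j * (indicator D x * h i j x))"
        by (simp add: sum_distrib_left mult_ac)
      also have "\<dots> = (\<Sum>i<p. \<Sum>j<p. r xs i * r xs j * \<mu> D $$ (i, j))"
        using iD h3[OF _ _ D] by (subst integral_double_sum) auto
      also have "0 \<le> \<dots>" by (rule psd_quad[OF psd[OF D]])
      finally show "0 \<le> integral\<^sup>L ?\<tau> (\<lambda>x. indicator D x * (\<Sum>i<p. \<Sum>j<p. r xs i * r xs j * h i j x))" .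
    qed
  qed
  then have AE: "AE x in ?\<tau>. \<forall>c. 0 \<le> (\<Sum>i<p. \<Sum>j<p. c i * c j * h i j x)"
  proof eventually_elim
    fix x assume x: "\<forall>xs. 0 \<le> (\<Sum>i<p. \<Sum>j<p. r xs i * r xs j * h i j x)"
    show "\<forall>c. 0 \<le> (\<Sum>i<p. \<Sum>j<p. c i * c j * h i j x)"
    proof
      fix c :: "nat \<Rightarrow> real"
      have "\<exists>q. c i < real_of_rat q \<and> real_of_rat q < c i + 1 / real (Suc k)" for k i
        by (rule of_rat_dense) simp
      define q where "q = (\<lambda>k i. SOME q. c i < real_of_rat q \<and> real_of_rat q < c i + 1 / real (Suc k))"
      have q: "c i < real_of_rat (q k i) \<and> real_of_rat (q k i) < c i + 1 / real (Suc k)" for i k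
        unfolding q_def by (rule someI_ex) fact
      define xs where "xs = (\<lambda>k. map (q k) [0..<p])"
      have r: "r (xs k) i = real_of_rat (q k i)" if "i < p" for k i using that by (simp add: r_def xs_def)
      have lim: "(\<lambda>k. r (xs k) i) \<longlonglongrightarrow> c i" if "i < p" for i
      proof (rule tendsto_sandwich)
        show "\<forall>\<^sub>F k in sequentially. c i \<le> r (xs k) i" unfolding r[OF that] using q by (intro always_eventually allI less_imp_le) blast
        show "\<forall>\<^sub>F k in sequentially. r (xs k) i \<le> c i + 1 / real (Suc k)" unfolding r[OF that] using q by (intro always_eventually allI less_imp_le) blast
        show "(\<lambda>k. c i + 1 / real (Suc k)) \<longlonglongrightarrow> c i"
          using tendsto_add[OF tendsto_const LIMSEQ_inverse_real_of_nat, of "c i"] by (simp add: inverse_eq_divide)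
      qed auto
      have "(\<lambda>k. \<Sum>i<p. \<Sum>j<p. r (xs k) i * r (xs k) j * h i j x) \<longlonglongrightarrow> (\<Sum>i<p. \<Sum>j<p. c i * c j * h i j x)"
        using lim by (intro tendsto_sum tendsto_mult tendsto_const) auto
      then show "0 \<le> (\<Sum>i<p. \<Sum>j<p. c i * c j * h i j x)"
        by (rule LIMSEQ_le_const) (use x in auto)
    qed
  qed
  show ?thesis by (rule that[OF _ _ _ _ AE]) (use h1 h2 h3 in auto)
qed

text \<open>From here on the given measure is seen only as a scalar measure \<open>\<tau>\<close>
  with a matrix density, and entries of \<open>L\<close> are ordinary integrals.\<close>

lemma representing_measure_density:
  assumes "representing_measure p d L \<mu>"
  obtains h \<tau> where "\<forall>i<p. \<forall>j<p. h i j = h j i"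
    "AE x in \<tau>. \<forall>c. 0 \<le> (\<Sum>i<p. \<Sum>j<p. c i * c j * h i j x)"
    "\<forall>f i j. degree f \<le> d \<and> i < p \<and> j < p \<longrightarrow> integrable \<tau> (\<lambda>x. poly f x * h i j x)"
    "\<forall>f i j. degree f \<le> d \<and> i < p \<and> j < p \<longrightarrow> L f $$ (i, j) = integral\<^sup>L \<tau> (\<lambda>x. poly f x * h i j x)"
proof -
  have \<mu>: "psd_measure p \<mu>" using assms by (simp add: representing_measure_def)
  let ?\<tau> = "trace_measure p \<mu>"
  note \<tau> = trace_measure_props[OF \<mu>]
  interpret finite_measure ?\<tau> by (rule \<tau>(2))
  obtain h where h': "\<forall>i<p. \<forall>j<p. h i j \<in> borel_measurable borel"
    "\<forall>i<p. \<forall>j<p. \<forall>x. \<bar>h i j x\<bar> \<le> 1"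
    "\<forall>i<p. \<forall>j<p. h i j = h j i"
    "\<forall>i<p. \<forall>j<p. \<forall>D\<in>sets borel.
       \<mu> D $$ (i, j) = integral\<^sup>L (trace_measure p \<mu>) (\<lambda>x. indicator D x * h i j x)"
    "AE x in trace_measure p \<mu>. \<forall>c. 0 \<le> (\<Sum>i<p. \<Sum>j<p. c i * c j * h i j x)"
    using psd_measure_density[OF \<mu>] .
  note h = h'[rule_format]
  have hm: "h i j \<in> borel_measurable ?\<tau>" if "i < p" "j < p" for i j
    using h(1)[OF that] \<tau>(1) by (simp cong: measurable_cong_sets)
  have hint: "integrable ?\<tau> (h i j)" if "i < p" "j < p" for i j
    using h(2)[OF that] hm[OF that] by (intro integrable_const_bound[of _ 1]) auto
  have pm: "poly f \<in> borel_measurable borel" for f :: "real poly"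
    by (intro borel_measurable_continuous_onI continuous_on_poly continuous_on_id)
  have fint: "integrable ?\<tau> (\<lambda>x. poly f x * h i j x)" if "degree f \<le> d" "i < p" "j < p" for f i j
  proof (rule Bochner_Integration.integrable_bound)
    show "integrable ?\<tau> (poly f)" using assms that by (simp add: representing_measure_def)
    show "(\<lambda>x. poly f x * h i j x) \<in> borel_measurable ?\<tau>"
      using hm[OF that(2,3)] pm[of f] \<tau>(1) by (intro borel_measurable_times) (simp_all cong: measurable_cong_sets)
    show "AE x in ?\<tau>. norm (poly f x * h i j x) \<le> norm (poly f x)"
      using h(2)[OF that(2,3)] by (auto simp: abs_mult intro!: mult_left_le)
  qed
  have "L f $$ (i, j) = integral\<^sup>L ?\<tau> (\<lambda>x. poly f x * h i j x)" if "degree f \<le> d" "i < p" "j < p" for f i j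
  proof -
    have "L f $$ (i, j) = signed_integral (\<lambda>D. \<mu> D $$ (i, j)) (poly f)"
      using assms that by (simp add: representing_measure_def mat_integral_def)
    also have "\<dots> = integral\<^sup>L ?\<tau> (\<lambda>x. poly f x * h i j x)"
      using that by (intro signed_integral_density[OF \<tau>(1) hint _ pm fint] h(4))
    finally show ?thesis .
  qed
  then show ?thesis by (intro that[OF h'(3,5)]) (use fint in auto)
qed

text \<open>Cauchy-Schwarz for a semidefinite form: a vector on which the form vanishes lies in its
  kernel. As in \<open>psd_gram_vectors\<close>, the denominator \<open>H j j + 1\<close> avoids a
  case distinction.\<close>

lemma psd_null:
  fixes H :: "nat \<Rightarrow> nat \<Rightarrow> real"
  assumes nn: "\<forall>c. 0 \<le> (\<Sum>i<p. \<Sum>j<p. c i * c j * H i j)"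
    and sym: "\<And>i j. i < p \<Longrightarrow> j < p \<Longrightarrow> H i j = H j i"
    and F: "(\<Sum>i<p. \<Sum>j<p. F i * F j * H i j) = 0" and j: "j < p"
  shows "(\<Sum>i<p. F i * H i j) = 0"
proof -
  let ?X = "\<Sum>i<p. F i * H i j"
  have H: "0 \<le> H j j"
    using nn[rule_format, of "\<lambda>k. (if k = j then 1 else 0) + (if k = j then 0 else 0)"]
      quad_two_points[OF j j, of 1 0 H] by simp
  have quad: "0 \<le> 2 * s * ?X + s\<^sup>2 * H j j" for s
  proof -
    define c where "c = (\<lambda>i. F i + (if i = j then s else 0))"
    have 1: "(\<Sum>k<p. c k * f k) = (\<Sum>k<p. F k * f k) + s * f j" for f
    proof -
      have "(\<Sum>k<p. c k * f k) = (\<Sum>k<p. F k * f k) + (\<Sum>k<p. if k = j then s * f j else 0)"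
        unfolding sum.distrib[symmetric] by (intro sum.cong) (auto simp: c_def distrib_right)
      then show ?thesis using j by simp
    qed
    have "(\<Sum>i<p. \<Sum>k<p. c i * c k * H i k) = (\<Sum>i<p. c i * (\<Sum>k<p. c k * H i k))"
      by (simp add: sum_distrib_left mult.assoc)
    also have "\<dots> = (\<Sum>i<p. F i * (\<Sum>k<p. c k * H i k)) + s * (\<Sum>k<p. c k * H j k)" by (rule 1)
    also have "\<dots> = (\<Sum>i<p. F i * ((\<Sum>k<p. F k * H i k) + s * H i j)) + s * ((\<Sum>k<p. F k * H j k) + s * H j j)"
      unfolding 1 ..
    also have "(\<Sum>i<p. F i * ((\<Sum>k<p. F k * H i k) + s * H i j))
        = (\<Sum>i<p. \<Sum>k<p. F i * F k * H i k) + s * ?X"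
      by (simp add: distrib_left sum.distrib sum_distrib_left mult_ac)
    also have "(\<Sum>k<p. F k * H j k) = ?X" using sym j by (intro sum.cong) auto
    finally show ?thesis using nn[rule_format, of c] F by (simp add: power2_eq_square algebra_simps)
  qed
  define s where "s = - ?X / (H j j + 1)"
  have X: "?X = - s * (H j j + 1)" using H by (simp add: s_def)
  have "2 * s * ?X + s\<^sup>2 * H j j = - s\<^sup>2 * (H j j + 2)" unfolding X by (simp add: power2_eq_square algebra_simps)
  then have "s\<^sup>2 * (H j j + 2) \<le> 0" using quad[of s] by simp
  then have "s = 0" using H by (auto simp: mult_le_0_iff)
  then show ?thesis using X by simp
qed

text \<open>Grouping a long index \<open>l\<close> by its component \<open>g l\<close>, later
  \<open>l mod p\<close>, collapses a coefficient vector to the \<open>p\<close> components of a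
  vector polynomial at a point.\<close>

lemma sum_pullback:
  fixes d :: "'a \<Rightarrow> real" and g :: "'a \<Rightarrow> nat"
  assumes "finite I" "g ` I \<subseteq> {..<p}"
  shows "(\<Sum>l\<in>I. d l * k (g l)) = (\<Sum>i<p. (\<Sum>l | l \<in> I \<and> g l = i. d l) * k i)"
proof -
  have "(\<Sum>l\<in>I. d l * k (g l)) = (\<Sum>i<p. \<Sum>l | l \<in> I \<and> g l = i. d l * k (g l))"
    using assms by (intro sum.group[symmetric]) auto
  also have "\<dots> = (\<Sum>i<p. (\<Sum>l | l \<in> I \<and> g l = i. d l) * k i)"
    by (intro sum.cong) (auto simp: sum_distrib_right)
  finally show ?thesis .
qed

lemma sum_pullback2:
  fixes d :: "'a \<Rightarrow> real" and g :: "'a \<Rightarrow> nat"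
  assumes "finite I" "g ` I \<subseteq> {..<p}"
  shows "(\<Sum>l\<in>I. \<Sum>l'\<in>I. d l * d l' * H (g l) (g l'))
    = (\<Sum>i<p. \<Sum>j<p. (\<Sum>l | l \<in> I \<and> g l = i. d l) * (\<Sum>l | l \<in> I \<and> g l = j. d l) * H i j)"
proof -
  define F where "F = (\<lambda>i. \<Sum>l | l \<in> I \<and> g l = i. d l)"
  have "(\<Sum>l\<in>I. \<Sum>l'\<in>I. d l * d l' * H (g l) (g l')) = (\<Sum>l\<in>I. d l * (\<Sum>l'\<in>I. d l' * H (g l) (g l')))"
    by (simp add: sum_distrib_left mult.assoc)
  also have "\<dots> = (\<Sum>l\<in>I. d l * (\<Sum>j<p. F j * H (g l) j))"
    unfolding F_def by (intro sum.cong refl arg_cong2[where f = "(*)"] sum_pullback assms)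
  also have "\<dots> = (\<Sum>i<p. F i * (\<Sum>j<p. F j * H i j))"
    unfolding F_def by (rule sum_pullback[OF assms])
  also have "\<dots> = (\<Sum>i<p. \<Sum>j<p. F i * F j * H i j)" by (simp add: sum_distrib_left mult.assoc)
  finally show ?thesis by (simp add: F_def)
qed

section \<open>Positivity and recursiveness of the moment matrix in powers of
  \<open>x - t\<close>\<close>

definition shifted_entry :: "nat \<Rightarrow> real \<Rightarrow> (real poly \<Rightarrow> real mat) \<Rightarrow> nat \<Rightarrow> nat \<Rightarrow> real" where
  "shifted_entry p t L l l' = L ([:- t, 1:] ^ (l div p + l' div p)) $$ (l mod p, l' mod p)"

lemma degree_shift_power [simp]: "degree ([:- t, 1:] ^ k :: real poly) = k"
  by (simp add: degree_power_eq)

text \<open>If the form of the moment matrix vanishes at a vector polynomial \<open>P\<close>, then \<open>h P = 0\<close> almost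
  everywhere for the matrix density \<open>h\<close>, hence \<open>(x - t) P\<close> is a null vector as well.\<close>

context
  fixes p n :: nat and t :: real and L :: "real poly \<Rightarrow> real mat" and \<mu>
  assumes p: "p \<ge> 1" and rep: "representing_measure p (2 * n) L \<mu>"
begin

lemma shifted_quad_nonneg: "0 \<le> (\<Sum>l<(n + 1) * p. \<Sum>l'<(n + 1) * p. c l * c l' * shifted_entry p t L l l')"
  and shifted_recursive:
    "(\<Sum>l<n * p. \<Sum>l'<n * p. c l * c l' * shifted_entry p t L l l') = 0 \<Longrightarrow> l'' < (n + 1) * p \<Longrightarrow>
      (\<Sum>l<n * p. c l * shifted_entry p t L (l + p) l'') = 0"
proof -
  obtain h \<tau> where sym': "\<forall>i<p. \<forall>j<p. h i j = h j i"
    and AE: "AE x in \<tau>. \<forall>c. 0 \<le> (\<Sum>i<p. \<Sum>j<p. c i * c j * h i j x)"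
    and int0: "\<forall>f i j. degree f \<le> 2 * n \<and> i < p \<and> j < p \<longrightarrow> integrable \<tau> (\<lambda>x. poly f x * h i j x)"
    and L0: "\<forall>f i j. degree f \<le> 2 * n \<and> i < p \<and> j < p \<longrightarrow> L f $$ (i, j) = integral\<^sup>L \<tau> (\<lambda>x. poly f x * h i j x)"
    using representing_measure_density[OF rep] .
  note sym = sym'[rule_format]
  have int: "integrable \<tau> (\<lambda>x. poly f x * h i j x)"
    and L: "L f $$ (i, j) = integral\<^sup>L \<tau> (\<lambda>x. poly f x * h i j x)"
    if "degree f \<le> 2 * n" "i < p" "j < p" for f i j
    using int0[rule_format, of f i j] L0[rule_format, of f i j] that by simp_all
  have mp: "l mod p < p" for l using p by simp
  have dv: "l div p \<le> n" if "l < (n + 1) * p" for l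
  proof -
    have "l div p < n + 1" using that p by (subst div_less_iff_less_mult) auto
    then show ?thesis by simp
  qed
  have int': "integrable \<tau> (\<lambda>x. (x - t) ^ (l div p + l' div p) * h (l mod p) (l' mod p) x)"
    and L': "shifted_entry p t L l l' = integral\<^sup>L \<tau> (\<lambda>x. (x - t) ^ (l div p + l' div p) * h (l mod p) (l' mod p) x)"
    if "l < (n + 1) * p" "l' < (n + 1) * p" for l l'
    using int[OF _ mp mp, of "[:- t, 1:] ^ (l div p + l' div p)" l l'] L[OF _ mp mp, of "[:- t, 1:] ^ (l div p + l' div p)" l l']
      dv[OF that(1)] dv[OF that(2)] by (simp_all add: shifted_entry_def)
  have quad: "(\<Sum>l<N. \<Sum>l'<N. c l * c l' * shifted_entry p t L l l')
      = integral\<^sup>L \<tau> (\<lambda>x. \<Sum>l<N. \<Sum>l'<N. (c l * (x - t) ^ (l div p)) * (c l' * (x - t) ^ (l' div p)) * h (l mod p) (l' mod p) x)"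
    and quad_int: "integrable \<tau> (\<lambda>x. \<Sum>l<N. \<Sum>l'<N. (c l * (x - t) ^ (l div p)) * (c l' * (x - t) ^ (l' div p)) * h (l mod p) (l' mod p) x)"
    if N: "N \<le> (n + 1) * p" for N and c :: "nat \<Rightarrow> real"
  proof -
    have eq: "(\<Sum>l<N. \<Sum>l'<N. (c l * (x - t) ^ (l div p)) * (c l' * (x - t) ^ (l' div p)) * h (l mod p) (l' mod p) x)
      = (\<Sum>l<N. \<Sum>l'<N. c l * c l' * ((x - t) ^ (l div p + l' div p) * h (l mod p) (l' mod p) x))" for x
      by (simp add: power_add mult_ac)
    have ii: "integrable \<tau> (\<lambda>x. (x - t) ^ (l div p + l' div p) * h (l mod p) (l' mod p) x)"
      if "l \<in> {..<N}" "l' \<in> {..<N}" for l l'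
      using int'[of l l'] that N by simp
    show "integrable \<tau> (\<lambda>x. \<Sum>l<N. \<Sum>l'<N. (c l * (x - t) ^ (l div p)) * (c l' * (x - t) ^ (l' div p)) * h (l mod p) (l' mod p) x)"
      unfolding eq by (rule integral_double_sum(1)[OF ii])
    show "(\<Sum>l<N. \<Sum>l'<N. c l * c l' * shifted_entry p t L l l')
      = integral\<^sup>L \<tau> (\<lambda>x. \<Sum>l<N. \<Sum>l'<N. (c l * (x - t) ^ (l div p)) * (c l' * (x - t) ^ (l' div p)) * h (l mod p) (l' mod p) x)"
    proof -
      have "integral\<^sup>L \<tau> (\<lambda>x. \<Sum>l<N. \<Sum>l'<N. c l * c l' * ((x - t) ^ (l div p + l' div p) * h (l mod p) (l' mod p) x))
        = (\<Sum>l<N. \<Sum>l'<N. c l * c l' * integral\<^sup>L \<tau> (\<lambda>x. (x - t) ^ (l div p + l' div p) * h (l mod p) (l' mod p) x))"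
        by (rule integral_double_sum(2)) (rule ii)
      also have "\<dots> = (\<Sum>l<N. \<Sum>l'<N. c l * c l' * shifted_entry p t L l l')"
        using N L' by (intro sum.cong refl) auto
      finally show ?thesis unfolding eq by simp
    qed
  qed
  have pos: "AE x in \<tau>. 0 \<le> (\<Sum>l<N. \<Sum>l'<N. (c l * (x - t) ^ (l div p)) * (c l' * (x - t) ^ (l' div p)) * h (l mod p) (l' mod p) x)"
    for N and c :: "nat \<Rightarrow> real"
    using AE
  proof eventually_elim
    case (elim x)
    define F where "F = (\<lambda>i. \<Sum>l | l \<in> {..<N} \<and> l mod p = i. c l * (x - t) ^ (l div p))"
    have "(\<Sum>l<N. \<Sum>l'<N. (c l * (x - t) ^ (l div p)) * (c l' * (x - t) ^ (l' div p)) * h (l mod p) (l' mod p) x)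
        = (\<Sum>i<p. \<Sum>j<p. F i * F j * h i j x)"
      unfolding F_def by (rule sum_pullback2[where H = "\<lambda>i j. h i j x"]) (auto simp: mp)
    then show ?case using elim[rule_format, of F] by simp
  qed
  show "0 \<le> (\<Sum>l<(n + 1) * p. \<Sum>l'<(n + 1) * p. c l * c l' * shifted_entry p t L l l')"
    unfolding quad[OF order_refl] by (rule integral_nonneg_AE[OF pos])
  assume c0: "(\<Sum>l<n * p. \<Sum>l'<n * p. c l * c l' * shifted_entry p t L l l') = 0" and l'': "l'' < (n + 1) * p"
  have N: "n * p \<le> (n + 1) * p" by simp
  have "AE x in \<tau>. (\<Sum>l<n * p. \<Sum>l'<n * p. (c l * (x - t) ^ (l div p)) * (c l' * (x - t) ^ (l' div p)) * h (l mod p) (l' mod p) x) = 0"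
    using integral_nonneg_eq_0_iff_AE[OF quad_int[OF N] pos, of c] c0 quad[OF N, of c] by simp
  then have AE0: "AE x in \<tau>. (\<Sum>l<n * p. c l * ((x - t) ^ ((l + p) div p + l'' div p) * h ((l + p) mod p) (l'' mod p) x)) = 0"
    using AE
  proof eventually_elim
    case (elim x)
    define F where "F = (\<lambda>i. \<Sum>l | l \<in> {..<n * p} \<and> l mod p = i. c l * (x - t) ^ (l div p))"
    have "(\<Sum>l<n * p. \<Sum>l'<n * p. (c l * (x - t) ^ (l div p)) * (c l' * (x - t) ^ (l' div p)) * h (l mod p) (l' mod p) x)
        = (\<Sum>i<p. \<Sum>j<p. F i * F j * h i j x)"
      unfolding F_def by (rule sum_pullback2[where H = "\<lambda>i j. h i j x"]) (auto simp: mp)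
    then have "(\<Sum>i<p. \<Sum>j<p. F i * F j * h i j x) = 0" using elim(1) by simp
    then have "(\<Sum>i<p. F i * h i (l'' mod p) x) = 0"
      using sym by (intro psd_null[where H = "\<lambda>i j. h i j x", OF elim(2)]) (auto simp: mp)
    moreover have "(\<Sum>l<n * p. c l * (x - t) ^ (l div p) * h (l mod p) (l'' mod p) x)
        = (\<Sum>i<p. F i * h i (l'' mod p) x)"
      unfolding F_def by (rule sum_pullback[where k = "\<lambda>i. h i (l'' mod p) x"]) (auto simp: mp)
    ultimately have "(\<Sum>l<n * p. c l * (x - t) ^ (l div p) * h (l mod p) (l'' mod p) x) = 0" by simp
    \<comment> \<open>One factor \<open>x - t\<close> turns row \<open>l\<close> into row
      \<open>l + p\<close>, and the other factors supply column \<open>l''\<close>. Because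
      \<open>c\<close> lives on the first \<open>n\<close> blocks, all powers stay within degree
      \<open>2 * n\<close>.\<close>
    then have "(x - t) ^ (1 + l'' div p) * (\<Sum>l<n * p. c l * (x - t) ^ (l div p) * h (l mod p) (l'' mod p) x) = 0"
      by simp
    then show ?case using p by (simp add: sum_distrib_left power_add mult_ac)
  qed
  have lp: "l + p < (n + 1) * p" if "l < n * p" for l using that by simp
  have "(\<Sum>l<n * p. c l * shifted_entry p t L (l + p) l'')
    = (\<Sum>l<n * p. integral\<^sup>L \<tau> (\<lambda>x. c l * ((x - t) ^ ((l + p) div p + l'' div p) * h ((l + p) mod p) (l'' mod p) x)))"
    using L'[OF lp l''] by (intro sum.cong) simp_all
  also have "\<dots> = integral\<^sup>L \<tau> (\<lambda>x. \<Sum>l<n * p. c l * ((x - t) ^ ((l + p) div p + l'' div p) * h ((l + p) mod p) (l'' mod p) x))"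
    using int'[OF lp l''] by (subst Bochner_Integration.integral_sum) auto
  also have "\<dots> = 0" using AE0 by (intro integral_eq_zero_AE)
  finally show "(\<Sum>l<n * p. c l * shifted_entry p t L (l + p) l'') = 0" .
qed

end

section \<open>Gram vectors of the moment matrix\<close>

text \<open>The vector \<open>v (k * p + a)\<close> represents \<open>(x - t)^k e_a\<close>, and \<open>X\<close> is multiplication by \<open>x - t\<close>.\<close>

locale hankel_vectors =
  fixes p n :: nat and t :: real and L :: "real poly \<Rightarrow> real mat" and v :: "nat \<Rightarrow> fseq" and X :: "fseq \<Rightarrow> fseq"
  assumes p: "p \<ge> 1" and n: "n \<ge> 1" and L: "linear_operator p (2 * n) L"
    and gram: "\<And>l l'. l < n * p + p \<Longrightarrow> l' < n * p + p \<Longrightarrow> inner (v l) (v l') = shifted_entry p t L l l'"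
    and X: "linear X" "\<And>l. l < n * p \<Longrightarrow> X (v l) = v (l + p)"

lemma hankel_vectors_exist:
  assumes p: "p \<ge> 1" and n: "n \<ge> 1" and L: "linear_operator p (2 * n) L"
    and rep: "representing_measure p (2 * n) L \<mu>"
  shows "\<exists>v X. hankel_vectors p n t L v X"
proof -
  let ?N = "n * p + p"
  have N: "(n + 1) * p = ?N" by simp
  have mp: "l mod p < p" for l using p by simp
  have dv: "l div p \<le> n" if "l < ?N" for l
  proof -
    have "l div p < n + 1" using that p by (subst div_less_iff_less_mult) auto
    then show ?thesis by simp
  qed
  have sym: "shifted_entry p t L l l' = shifted_entry p t L l' l" if "l < ?N" "l' < ?N" for l l'
  proof -
    have "degree ([:- t, 1:] ^ (l div p + l' div p) :: real poly) \<le> 2 * n" using dv[OF that(1)] dv[OF that(2)] by simp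
    then have "L ([:- t, 1:] ^ (l div p + l' div p)) \<in> sym_mats p" using L by (simp add: linear_operator_def)
    then have "L ([:- t, 1:] ^ (l div p + l' div p)) $$ (l mod p, l' mod p) = L ([:- t, 1:] ^ (l div p + l' div p)) $$ (l' mod p, l mod p)"
      using mp by (metis (mono_tags, lifting) carrier_matD index_transpose_mat(1) mem_Collect_eq sym_mats_def)
    then show ?thesis by (simp add: shifted_entry_def add.commute)
  qed
  have "\<exists>v :: nat \<Rightarrow> fseq. \<forall>i<?N. \<forall>j<?N. inner (v i) (v j) = shifted_entry p t L i j"
    using shifted_quad_nonneg[OF p rep, of _ t] sym unfolding N by (intro psd_gram_vectors) auto
  then obtain v :: "nat \<Rightarrow> fseq" where v: "\<And>i j. i < ?N \<Longrightarrow> j < ?N \<Longrightarrow> inner (v i) (v j) = shifted_entry p t L i j"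
    by blast
  \<comment> \<open>Well-definedness of \<open>X\<close>: a relation among the first
    \<open>n * p\<close> vectors is a null vector of the form, and recursiveness makes the shifted
    combination orthogonal to all Gram vectors.\<close>
  have null: "(\<Sum>l<n * p. c l *\<^sub>R v (l + p)) = 0" if 0: "(\<Sum>l<n * p. c l *\<^sub>R v l) = 0" for c
  proof (rule orth_generators_0[of _ v "{..<?N}"])
    show "(\<Sum>l<n * p. c l *\<^sub>R v (l + p)) \<in> span (v ` {..<?N})"
      by (rule real_vector.span_sum, rule real_vector.span_scale, rule real_vector.span_base) auto
    fix l'' assume l'': "l'' \<in> {..<?N}"
    have "(\<Sum>l<n * p. \<Sum>l'<n * p. c l * c l' * shifted_entry p t L l l')
        = inner (\<Sum>l<n * p. c l *\<^sub>R v l) (\<Sum>l<n * p. c l *\<^sub>R v l)"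
      unfolding inner_sum_left unfolding inner_sum_right using v by (intro sum.cong) (auto simp: mult.assoc)
    then have "(\<Sum>l<n * p. c l * shifted_entry p t L (l + p) l'') = 0"
      using shifted_recursive[OF p rep, of c t l''] 0 l'' N by simp
    moreover have "inner (v l'') (\<Sum>l<n * p. c l *\<^sub>R v (l + p)) = (\<Sum>l<n * p. c l * shifted_entry p t L (l + p) l'')"
      unfolding inner_sum_right using v[of _ l''] l'' by (intro sum.cong) (auto simp: inner_commute[of "v l''"])
    ultimately show "inner (v l'') (\<Sum>l<n * p. c l *\<^sub>R v (l + p)) = 0" by simp
  qed
  obtain X where "linear X" "\<And>l. l \<in> {..<n * p} \<Longrightarrow> X (v l) = v (l + p)"
    by (rule linear_extension_family[where I = "{..<n * p}" and v = v and w = "\<lambda>l. v (l + p)"])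
      (use null in auto)
  then have "hankel_vectors p n t L v X" using p n L v by (intro hankel_vectors.intro) auto
  then show ?thesis by blast
qed

text \<open>The Hankel structure: moving one block from one index to the other keeps the sum of the
  powers.\<close>

lemma shifted_entry_shift:
  assumes "p \<ge> 1"
  shows "shifted_entry p t L (k + p) l = shifted_entry p t L k (l + p)"
  using assms by (simp add: shifted_entry_def)

context hankel_vectors
begin

lemma mod_p: "l mod p < p" using p by simp

sublocale partial_shift v X "n * p" p
proof (rule partial_shift.intro)
  show "inner (v (k + p)) (v l) = inner (v k) (v (l + p))" if "k < n * p" "l < n * p" for k l
    using that gram[of "k + p" l] gram[of k "l + p"] shifted_entry_shift[OF p] by simp
qed (rule X, rule X)

lemma K_orth_0: "u \<in> K \<Longrightarrow> (\<And>l. l < n * p + p \<Longrightarrow> inner (v l) u = 0) \<Longrightarrow> u = 0"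
  unfolding K_def by (rule orth_generators_0[of _ v]) auto

section \<open>Pivot indices and their behaviour under the shift\<close>

abbreviation pivot where "pivot l \<equiv> v l \<notin> span (v ` {..<l})"

text \<open>Applying \<open>X\<close> to a relation shifts it by one block. The shifted relation
  avoids the first block, which is the restriction on the coefficients in the definition of the set
  \<open>A\<close> of the theorem.\<close>

lemma nonpivot_shift:
  assumes "\<not> pivot l" "l < n * p"
  shows "v (l + p) \<in> span (v ` {p..<l + p})"
proof -
  have "X (v l) \<in> X ` span (v ` {..<l})" using assms(1) by auto
  also have "X ` span (v ` {..<l}) = span (X ` v ` {..<l})" using X(1) by (simp add: linear_span_image)
  also have "X ` v ` {..<l} = v ` {p..<l + p}"
  proof -
    have "X ` v ` {..<l} = v ` (\<lambda>k. k + p) ` {..<l}" unfolding image_image using assms(2) X(2) by (intro image_cong) auto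
    also have "(\<lambda>k. k + p) ` {..<l} = {p..<l + p}" by (simp add: lessThan_atLeast0)
    finally show ?thesis .
  qed
  finally show ?thesis using X(2) assms(2) by simp
qed

lemma nonpivot_if: "v l \<in> span (v ` {p..<l}) \<Longrightarrow> \<not> pivot l"
  using real_vector.span_mono[OF image_mono, of "{p..<l}" "{..<l}" v] by fastforce

text \<open>Iterating the shift: once a position inside a block is dependent on what precedes it,
  the same position is dependent in all later blocks.\<close>

lemma nonpivot_propagate:
  assumes "\<not> pivot l"
  shows "l + s * p < n * p + p \<Longrightarrow> \<not> pivot (l + s * p)"
proof (induction s)
  case 0
  then show ?case using assms by simp
next
  case (Suc s)
  then have "\<not> pivot (l + s * p)" "l + s * p < n * p" by auto
  then have "v (l + s * p + p) \<in> span (v ` {p..<l + s * p + p})" by (rule nonpivot_shift)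
  then show ?case using nonpivot_if[of "l + s * p + p"] by (simp add: add_ac)
qed

text \<open>Here indices start at 0; in the theorem they start at 1.\<close>

definition A' where "A' = {l \<in> {..<n * p}. pivot l \<and> v (l + p) \<in> span (v ` {p..<l + p})}"
definition B' where "B' = {l \<in> {n * p..<n * p + p}. pivot l \<and> v l \<in> span (G \<union> v ` {..<l})}"

lemma zero_sub: "real_vector.subspace {0 :: fseq}" by (simp add: real_vector.subspace_def)

lemma span_insert_zero: "span ({0} \<union> S) = span S" for S :: "fseq set"
  by (simp add: real_vector.span_insert_0)

text \<open>Pivots among the first \<open>n * p\<close> vectors number \<open>dim V\<close>. The
  indices whose shift is independent of its predecessors within \<open>v p\<close>,
  \<open>v (p + 1)\<close>, ... number \<open>dim R\<close>; they are pivots by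
  \<open>nonpivot_shift\<close>, and \<open>A'\<close> is the difference.\<close>

lemma card_A': "card A' = dim N0"
proof -
  let ?P = "{l \<in> {..<n * p}. pivot l}" and ?Q = "{l \<in> {..<n * p}. v (l + p) \<notin> span (v ` {p..<l + p})}"
  have z: "{0} \<subseteq> K" "dim {0 :: fseq} = 0"
    using real_vector.subspace_0[OF K_sub] real_vector.dim_span_eq_card_independent[OF real_vector.independent_empty, where ?'a = fseq]
    by auto
  have "card {l \<in> {0..<n * p}. v l \<notin> span ({0} \<union> v ` {0..<l})} + dim {0 :: fseq} = dim (span ({0} \<union> v ` {0..<n * p}))"
    by (rule card_pivots[OF zero_sub K_findim _ z(1)]) (auto intro: v_K)
  then have P: "card ?P = dim V" unfolding span_insert_zero z by (simp add: V_def lessThan_atLeast0)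
  have "card {l \<in> {p..<n * p + p}. v l \<notin> span ({0} \<union> v ` {p..<l})} + dim {0 :: fseq} = dim (span ({0} \<union> v ` {p..<n * p + p}))"
    by (rule card_pivots[OF zero_sub K_findim _ z(1)]) (auto intro: v_K)
  moreover have "card {l \<in> {p..<n * p + p}. v l \<notin> span ({0} \<union> v ` {p..<l})} = card ?Q"
    unfolding span_insert_zero
    by (rule bij_betw_same_card[of "\<lambda>l. l - p"]) (rule bij_betwI[of _ _ _ "\<lambda>l. l + p"], auto)
  ultimately have Q: "card ?Q = dim R" unfolding span_insert_zero z by (simp add: R_def)
  have sub: "?Q \<subseteq> ?P" using nonpivot_shift by auto
  have "A' = ?P - ?Q" by (auto simp: A'_def)
  then have "card A' = card ?P - card ?Q" using sub by (simp add: card_Diff_subset)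
  then show ?thesis using P Q dim_N0 by simp
qed

text \<open>In the last block the pivots relative to \<open>V\<close> number
  \<open>dim K - dim V\<close>, and those relative to \<open>V + G\<close> number
  \<open>dim K - dim (V + G)\<close>. The latter are among the former, and \<open>B'\<close> is the
  difference.\<close>

lemma card_B': "card B' + dim V = dim (span (V \<union> G))"
proof -
  let ?P = "{l \<in> {n * p..<n * p + p}. pivot l}"
    and ?Q = "{l \<in> {n * p..<n * p + p}. v l \<notin> span (G \<union> v ` {..<l})}"
  have sp: "span (span S1 \<union> S2) = span (S1 \<union> S2)" for S1 S2 :: "fseq set"
    unfolding real_vector.span_Un real_vector.span_span ..
  have un: "v ` {..<n * p} \<union> v ` {n * p..<l} = v ` {..<l}" if "n * p \<le> l" for l
    using that by (subst image_Un[symmetric], subst ivl_disj_un) auto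
  have e1: "span (V \<union> v ` {n * p..<l}) = span (v ` {..<l})" if "n * p \<le> l" for l
    unfolding V_def sp un[OF that] ..
  have e2: "span (span (V \<union> G) \<union> v ` {n * p..<l}) = span (G \<union> v ` {..<l})" if "n * p \<le> l" for l
  proof -
    have "span (span (V \<union> G) \<union> v ` {n * p..<l}) = span (span (v ` {..<n * p}) \<union> (G \<union> v ` {n * p..<l}))"
      unfolding sp V_def by (simp add: Un_assoc)
    also have "\<dots> = span (G \<union> v ` {..<l})" unfolding sp un[OF that, symmetric] by (simp add: Un_ac)
    finally show ?thesis .
  qed
  have "card {l \<in> {n * p..<n * p + p}. v l \<notin> span (V \<union> v ` {n * p..<l})} + dim V = dim (span (V \<union> v ` {n * p..<n * p + p}))"
    by (rule card_pivots[OF V_sub K_findim _ V_K]) (auto intro: v_K)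
  moreover have "{l \<in> {n * p..<n * p + p}. v l \<notin> span (V \<union> v ` {n * p..<l})} = ?P" using e1 by auto
  moreover have "span (V \<union> v ` {n * p..<n * p + p}) = K" using e1[of "n * p + p"] by (simp add: K_def)
  ultimately have P: "card ?P + dim V = dim K" by simp
  have "card {l \<in> {n * p..<n * p + p}. v l \<notin> span (span (V \<union> G) \<union> v ` {n * p..<l})} + dim (span (V \<union> G))
      = dim (span (span (V \<union> G) \<union> v ` {n * p..<n * p + p}))"
    by (rule card_pivots[OF real_vector.subspace_span K_findim _ VG_K]) (auto intro: v_K)
  moreover have "{l \<in> {n * p..<n * p + p}. v l \<notin> span (span (V \<union> G) \<union> v ` {n * p..<l})} = ?Q" using e2 by auto
  moreover have "span (span (V \<union> G) \<union> v ` {n * p..<n * p + p}) = K"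
  proof -
    have "span (span (V \<union> G) \<union> v ` {n * p..<n * p + p}) = span (G \<union> v ` {..<n * p + p})" using e2 by simp
    also have "\<dots> = span (K \<union> G)" unfolding K_def sp by (simp add: Un_commute)
    also have "\<dots> = K" using G_K by (simp add: Un_absorb2 span_findim[OF K_findim])
    finally show ?thesis .
  qed
  ultimately have Q: "card ?Q + dim (span (V \<union> G)) = dim K" by simp
  have sub: "?Q \<subseteq> ?P"
  proof
    fix l assume "l \<in> ?Q"
    moreover have "span (v ` {..<l}) \<subseteq> span (G \<union> v ` {..<l})" by (rule real_vector.span_mono) simp
    ultimately show "l \<in> ?P" by auto
  qed
  have "B' = ?P - ?Q" by (auto simp: B'_def)
  then have "card B' = card ?P - card ?Q" using sub by (simp add: card_Diff_subset)
  moreover have "card ?Q \<le> card ?P" using sub by (intro card_mono) auto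
  ultimately show ?thesis using P Q by simp
qed

end

section \<open>Finitely atomic matrix measures\<close>

text \<open>Taylor expansion at \<open>t\<close>, which reduces statements about all polynomials of
  bounded degree to powers of \<open>x - t\<close>.\<close>

lemma shift_expand:
  fixes f :: "real poly"
  assumes "degree f \<le> d"
  shows "f = (\<Sum>k\<le>d. Polynomial.smult (coeff (pcompose f [:t, 1:]) k) ([:- t, 1:] ^ k))"
proof -
  let ?g = "pcompose f [:t, 1:]"
  have dg: "degree ?g \<le> d" using degree_pcompose_le[of f "[:t, 1:]"] assms by simp
  have "poly f x = poly (\<Sum>k\<le>d. Polynomial.smult (coeff ?g k) ([:- t, 1:] ^ k)) x" for x
  proof -
    have "poly f x = poly ?g (x - t)" by (simp add: poly_pcompose)
    also have "\<dots> = (\<Sum>k\<le>degree ?g. coeff ?g k * (x - t) ^ k)" by (rule poly_altdef)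
    also have "\<dots> = (\<Sum>k\<le>d. coeff ?g k * (x - t) ^ k)"
      using dg by (intro sum.mono_neutral_left) (auto simp: coeff_eq_0)
    also have "\<dots> = poly (\<Sum>k\<le>d. Polynomial.smult (coeff ?g k) ([:- t, 1:] ^ k)) x"
      by (simp add: poly_sum)
    finally show ?thesis .
  qed
  then show ?thesis using poly_eq_poly_eq_iff by blast
qed

lemma linear_operator_sum:
  assumes L: "linear_operator p d L" and I: "finite I" "\<And>i. i \<in> I \<Longrightarrow> degree (f i) \<le> d" and ab: "a < p" "b < p"
  shows "L (\<Sum>i\<in>I. Polynomial.smult (c i) (f i)) $$ (a, b) = (\<Sum>i\<in>I. c i * L (f i) $$ (a, b))"
  using I
proof (induction I rule: finite_induct)
  case empty
  have c: "L 0 \<in> carrier_mat p p" using L by (simp add: linear_operator_def sym_mats_def)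
  have "L 0 = L (Polynomial.smult 0 0)" by simp
  also have "\<dots> = 0 \<cdot>\<^sub>m L 0" using L unfolding linear_operator_def by (metis degree_0 zero_le)
  finally have "L 0 $$ (a, b) = (0 \<cdot>\<^sub>m L 0) $$ (a, b)" by simp
  then show ?case using c ab by simp
next
  case (insert i I)
  have d: "degree (Polynomial.smult (c i) (f i)) \<le> d" using insert.prems by (meson degree_smult_le insertI1 order_trans)
  have ds: "degree (\<Sum>i\<in>I. Polynomial.smult (c i) (f i)) \<le> d"
    using insert by (intro degree_sum_le) (auto intro: order_trans[OF degree_smult_le])
  have c: "L g \<in> carrier_mat p p" if "degree g \<le> d" for g using L that by (simp add: linear_operator_def sym_mats_def)
  have "L (\<Sum>i\<in>insert i I. Polynomial.smult (c i) (f i)) = L (Polynomial.smult (c i) (f i)) + L (\<Sum>i\<in>I. Polynomial.smult (c i) (f i))"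
    using insert L d ds by (simp add: linear_operator_def)
  also have "\<dots> $$ (a, b) = (c i \<cdot>\<^sub>m L (f i)) $$ (a, b) + L (\<Sum>i\<in>I. Polynomial.smult (c i) (f i)) $$ (a, b)"
    using c[OF ds] c[OF d] ab L insert.prems by (simp add: linear_operator_def)
  also have "\<dots> = c i * L (f i) $$ (a, b) + (\<Sum>i\<in>I. c i * L (f i) $$ (a, b))"
    using insert c[of "f i"] ab by simp
  finally show ?case using insert by simp
qed

lemma poly_interpolation:
  fixes g :: "real \<Rightarrow> real"
  assumes "finite Y"
  shows "\<exists>f. \<forall>y\<in>Y. poly f y = g y"
  using assms
proof (induction Y rule: finite_induct)
  case (insert z Y)
  then obtain f where f: "\<forall>y\<in>Y. poly f y = g y" by blast
  define q where "q = (\<Prod>y\<in>Y. [:- y, 1:])"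
  have qz: "poly q z \<noteq> 0" using insert by (auto simp: q_def poly_prod)
  have qy: "poly q y = 0" if "y \<in> Y" for y using insert that by (auto simp: q_def poly_prod)
  define h where "h = f + Polynomial.smult ((g z - poly f z) / poly q z) q"
  have "\<forall>y\<in>insert z Y. poly h y = g y" using f qz qy by (auto simp: h_def)
  then show ?case by blast
qed auto

lemma borel_measurable_poly: "poly f \<in> borel_measurable (borel :: real measure)" for f :: "real poly"
  by (intro borel_measurable_continuous_onI continuous_on_poly continuous_on_id)

locale atomic =
  fixes p l :: nat and x :: "nat \<Rightarrow> real" and A :: "nat \<Rightarrow> real mat"
  assumes inj: "inj_on x {1..l}" and psd: "\<And>j. j \<in> {1..l} \<Longrightarrow> psd p (A j)"
begin

abbreviation "\<mu> \<equiv> atomic_measure p l x A"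

lemma measure_index:
  "D \<in> sets borel \<Longrightarrow> a < p \<Longrightarrow> b < p \<Longrightarrow> \<mu> D $$ (a, b) = (\<Sum>j = 1..l. indicator D (x j) * A j $$ (a, b))"
  by (simp add: atomic_measure_def)

lemma psd_measure: "psd_measure p \<mu>"
proof -
  have car: "\<mu> D \<in> carrier_mat p p" if "D \<in> sets borel" for D using that by (simp add: atomic_measure_def)
  have sym: "\<mu> D \<in> sym_mats p" if D: "D \<in> sets borel" for D
  proof -
    have "transpose_mat (\<mu> D) = \<mu> D"
      using car[OF D] measure_index[OF D] psd_sym[OF psd]
      by (intro eq_matI) (auto intro!: sum.cong)
    then show ?thesis using car[OF D] by (simp add: sym_mats_def)
  qed
  have "signed_borel_measure (\<lambda>D. \<mu> D $$ (a, b))" if ab: "a < p" "b < p" for a b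
    unfolding signed_borel_measure_def
  proof (intro conjI allI impI)
    show "\<mu> {} $$ (a, b) = 0" using measure_index[OF _ ab, of "{}"] by simp
    fix E :: "nat \<Rightarrow> real set" assume E: "range E \<subseteq> sets borel" "disjoint_family E"
    have "(\<lambda>i. indicator (E i) (x j) :: real) sums indicator (\<Union>i. E i) (x j)" for j
      using E(2) by (intro indicator_sums) (auto simp: disjoint_family_on_def)
    then have "(\<lambda>i. \<Sum>j = 1..l. indicator (E i) (x j) * A j $$ (a, b)) sums (\<Sum>j = 1..l. indicator (\<Union>i. E i) (x j) * A j $$ (a, b))"
      by (intro sums_sum sums_mult2)
    moreover have "(\<lambda>i. \<mu> (E i) $$ (a, b)) = (\<lambda>i. \<Sum>j = 1..l. indicator (E i) (x j) * A j $$ (a, b))"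
      using E(1) measure_index[OF _ ab] by auto
    moreover have "(\<Union>i. E i) \<in> sets borel" using E(1) by (intro sets.countable_UN) auto
    ultimately show "(\<lambda>i. \<mu> (E i) $$ (a, b)) sums \<mu> (\<Union>i. E i) $$ (a, b)"
      using measure_index[OF _ ab] by simp
  qed
  moreover have "psd p (\<mu> D)" if D: "D \<in> sets borel" for D
    unfolding psd_def
  proof (intro conjI ballI sym[OF D])
    fix w :: "real vec" assume w: "w \<in> carrier_vec p"
    have "scalar_prod w (\<mu> D *\<^sub>v w) = (\<Sum>a<p. \<Sum>b<p. w $ a * w $ b * (\<Sum>j = 1..l. indicator D (x j) * A j $$ (a, b)))"
      unfolding quad_form[OF car[OF D] w] using measure_index[OF D] by (intro sum.cong) auto
    also have "\<dots> = (\<Sum>a<p. \<Sum>b<p. \<Sum>j = 1..l. indicator D (x j) * (w $ a * w $ b * A j $$ (a, b)))"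
      unfolding sum_distrib_left by (intro sum.cong refl) (simp only: mult_ac)
    also have "\<dots> = (\<Sum>a<p. \<Sum>j = 1..l. \<Sum>b<p. indicator D (x j) * (w $ a * w $ b * A j $$ (a, b)))"
      by (intro sum.cong refl sum.swap)
    also have "\<dots> = (\<Sum>j = 1..l. \<Sum>a<p. \<Sum>b<p. indicator D (x j) * (w $ a * w $ b * A j $$ (a, b)))"
      by (rule sum.swap)
    also have "\<dots> = (\<Sum>j = 1..l. indicator D (x j) * (\<Sum>a<p. \<Sum>b<p. w $ a * w $ b * A j $$ (a, b)))"
      by (simp add: sum_distrib_left)
    finally have e: "scalar_prod w (\<mu> D *\<^sub>v w) = (\<Sum>j = 1..l. indicator D (x j) * (\<Sum>a<p. \<Sum>b<p. w $ a * w $ b * A j $$ (a, b)))" .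
    show "0 \<le> scalar_prod w (\<mu> D *\<^sub>v w)"
      unfolding e by (rule sum_nonneg, rule mult_nonneg_nonneg, simp, rule psd_quad[OF psd])
  qed
  moreover have "\<mu> \<in> sets borel \<rightarrow>\<^sub>E sym_mats p"
    using sym by (auto simp: atomic_measure_def PiE_def extensional_def restrict_def)
  ultimately show ?thesis by (simp add: psd_measure_def)
qed

text \<open>With counting measure on the atoms as reference, the density takes the value
  \<open>A j\<close> at \<open>x j\<close>; distinctness of the atoms makes this consistent.\<close>

lemma integral:
  assumes f: "f \<in> borel_measurable borel" and ab: "a < p" "b < p"
  shows "signed_integral (\<lambda>D. \<mu> D $$ (a, b)) f = (\<Sum>j = 1..l. f (x j) * A j $$ (a, b))"
proof -
  define M where "M = distr (count_space {1..l}) borel x"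
  have M: "integral\<^sup>L M g = (\<Sum>j = 1..l. g (x j))" "integrable M g" if "g \<in> borel_measurable borel" for g :: "real \<Rightarrow> real"
    using that unfolding M_def
    by (simp_all add: integral_distr integrable_distr_eq lebesgue_integral_count_space_finite integrable_count_space)
  define h where "h = (\<lambda>y. \<Sum>j = 1..l. indicator {x j} y * A j $$ (a, b))"
  have hm: "h \<in> borel_measurable borel" unfolding h_def by measurable
  have hx: "h (x j) = A j $$ (a, b)" if "j \<in> {1..l}" for j
  proof -
    have "h (x j) = (\<Sum>i = 1..l. if i = j then A j $$ (a, b) else 0)"
      unfolding h_def using inj that by (intro sum.cong) (auto simp: inj_on_eq_iff)
    then show ?thesis using that by simp
  qed
  have "signed_integral (\<lambda>D. \<mu> D $$ (a, b)) f = integral\<^sup>L M (\<lambda>y. f y * h y)"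
  proof (rule signed_integral_density)
    show "sets M = sets borel" by (simp add: M_def)
    show "integrable M h" using hm by (rule M)
    show "integrable M (\<lambda>y. f y * h y)" using f hm by (intro M) measurable
    fix D :: "real set" assume D[measurable]: "D \<in> sets borel"
    have "(\<lambda>y. indicator D y * h y) \<in> borel_measurable borel" using hm by measurable
    then have "integral\<^sup>L M (\<lambda>y. indicator D y * h y) = (\<Sum>j = 1..l. indicator D (x j) * h (x j))" by (rule M)
    also have "\<dots> = \<mu> D $$ (a, b)" unfolding measure_index[OF D ab] using hx by (intro sum.cong) auto
    finally show "\<mu> D $$ (a, b) = integral\<^sup>L M (\<lambda>y. indicator D y * h y)" by simp
  qed (rule f)
  also have "\<dots> = (\<Sum>j = 1..l. f (x j) * h (x j))" using f hm by (intro M) measurable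
  also have "\<dots> = (\<Sum>j = 1..l. f (x j) * A j $$ (a, b))" using hx by (intro sum.cong) auto
  finally show ?thesis .
qed

lemma trace_integrable:
  fixes f :: "real \<Rightarrow> real"
  assumes f: "f \<in> borel_measurable borel"
  shows "integrable (trace_measure p \<mu>) f"
proof -
  note \<tau> = trace_measure_props[OF psd_measure]
  interpret finite_measure "trace_measure p \<mu>" by (rule \<tau>(2))
  define F where "F = x ` {1..l}"
  have "finite F" by (simp add: F_def)
  then have F: "finite F" "- F \<in> sets borel" by (auto intro: borel_comp borel_closed finite_imp_closed)
  have "measure (trace_measure p \<mu>) (- F) = 0"
    unfolding \<tau>(3)[OF F(2)] using measure_index[OF F(2)] by (auto simp: F_def intro!: sum.neutral)
  then have "- F \<in> null_sets (trace_measure p \<mu>)"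
    using F(2) \<tau>(1) by (auto simp: null_sets_def emeasure_eq_measure)
  then have AE: "AE y in trace_measure p \<mu>. y \<in> F" by (auto dest: AE_not_in)
  show ?thesis
  proof (rule integrable_const_bound[of _ "\<Sum>y\<in>F. \<bar>f y\<bar>"])
    show "AE y in trace_measure p \<mu>. norm (f y) \<le> (\<Sum>y\<in>F. \<bar>f y\<bar>)"
      using AE by eventually_elim (use F(1) in \<open>auto intro!: member_le_sum\<close>)
    show "f \<in> borel_measurable (trace_measure p \<mu>)" using f \<tau>(1) by (simp cong: measurable_cong_sets)
  qed
qed

text \<open>The centre \<open>t\<close> is arbitrary: powers of \<open>x - t\<close> up to degree
  \<open>d\<close> span the polynomials on which \<open>L\<close> is tested.\<close>

lemma representing_iff:
  assumes L: "linear_operator p d L"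
  shows "representing_measure p d L \<mu> \<longleftrightarrow>
    (\<forall>k\<le>d. \<forall>a<p. \<forall>b<p. L ([:- t, 1:] ^ k) $$ (a, b) = (\<Sum>j = 1..l. (x j - t) ^ k * A j $$ (a, b)))"
proof
  assume r: "representing_measure p d L \<mu>"
  show "\<forall>k\<le>d. \<forall>a<p. \<forall>b<p. L ([:- t, 1:] ^ k) $$ (a, b) = (\<Sum>j = 1..l. (x j - t) ^ k * A j $$ (a, b))"
  proof (intro allI impI)
    fix k a b assume k: "k \<le> d" and ab: "a < p" "b < p"
    have "L ([:- t, 1:] ^ k) = mat_integral p \<mu> (poly ([:- t, 1:] ^ k))"
      using r k by (simp add: representing_measure_def)
    then have "L ([:- t, 1:] ^ k) $$ (a, b) = signed_integral (\<lambda>D. \<mu> D $$ (a, b)) (poly ([:- t, 1:] ^ k))"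
      using ab by (simp add: mat_integral_def)
    also have "\<dots> = (\<Sum>j = 1..l. poly ([:- t, 1:] ^ k) (x j) * A j $$ (a, b))"
      by (rule integral[OF borel_measurable_poly ab])
    finally show "L ([:- t, 1:] ^ k) $$ (a, b) = (\<Sum>j = 1..l. (x j - t) ^ k * A j $$ (a, b))" by simp
  qed
next
  assume m: "\<forall>k\<le>d. \<forall>a<p. \<forall>b<p. L ([:- t, 1:] ^ k) $$ (a, b) = (\<Sum>j = 1..l. (x j - t) ^ k * A j $$ (a, b))"
  show "representing_measure p d L \<mu>"
    unfolding representing_measure_def
  proof (intro conjI allI impI psd_measure)
    fix f :: "real poly" assume f: "degree f \<le> d"
    show "integrable (trace_measure p \<mu>) (poly f)" by (rule trace_integrable[OF borel_measurable_poly])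
    have car: "L f \<in> carrier_mat p p" using L f by (simp add: linear_operator_def sym_mats_def)
    let ?c = "coeff (pcompose f [:t, 1:])"
    have fe: "f = (\<Sum>k\<le>d. Polynomial.smult (?c k) ([:- t, 1:] ^ k))" by (rule shift_expand[OF f])
    have "L f $$ (a, b) = mat_integral p \<mu> (poly f) $$ (a, b)" if ab: "a < p" "b < p" for a b
    proof -
      have "L f $$ (a, b) = (\<Sum>k\<le>d. ?c k * L ([:- t, 1:] ^ k) $$ (a, b))"
        by (subst (1) fe) (rule linear_operator_sum[OF L _ _ ab]; simp)
      also have "\<dots> = (\<Sum>k\<le>d. \<Sum>j = 1..l. ?c k * (x j - t) ^ k * A j $$ (a, b))"
        using m ab by (simp add: sum_distrib_left mult.assoc)
      also have "\<dots> = (\<Sum>j = 1..l. \<Sum>k\<le>d. ?c k * (x j - t) ^ k * A j $$ (a, b))" by (rule sum.swap)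
      also have "\<dots> = (\<Sum>j = 1..l. poly f (x j) * A j $$ (a, b))"
      proof (rule sum.cong[OF refl])
        fix j
        have "poly f (x j) = (\<Sum>k\<le>d. ?c k * (x j - t) ^ k)" by (subst fe) (simp add: poly_sum)
        then show "(\<Sum>k\<le>d. ?c k * (x j - t) ^ k * A j $$ (a, b)) = poly f (x j) * A j $$ (a, b)"
          by (simp add: sum_distrib_right)
      qed
      also have "\<dots> = mat_integral p \<mu> (poly f) $$ (a, b)"
        using integral[OF borel_measurable_poly ab, of f] ab by (simp add: mat_integral_def)
      finally show ?thesis .
    qed
    then show "L f = mat_integral p \<mu> (poly f)" using car by (intro eq_matI) (auto simp: mat_integral_def)
  qed
qed

end

text \<open>Moments of all orders are compared, so the sums agree for every polynomial, in
  particular for one that interpolates the indicator of a given set at all atoms of both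
  measures.\<close>

lemma atomic_measure_eqI:
  assumes "atomic p l x A" "atomic p l' x' A'"
    and m: "\<And>k a b. a < p \<Longrightarrow> b < p \<Longrightarrow>
      (\<Sum>j = 1..l. (x j - t) ^ k * A j $$ (a, b)) = (\<Sum>j = 1..l'. (x' j - t) ^ k * A' j $$ (a, b))"
  shows "atomic_measure p l x A = atomic_measure p l' x' A'"
proof -
  have poly: "(\<Sum>j = 1..l. poly f (x j) * A j $$ (a, b)) = (\<Sum>j = 1..l'. poly f (x' j) * A' j $$ (a, b))"
    if ab: "a < p" "b < p" for f a b
  proof -
    let ?c = "coeff (pcompose f [:t, 1:])"
    have pf: "poly f y = (\<Sum>k\<le>degree f. ?c k * (y - t) ^ k)" for y
      by (subst (1) shift_expand[OF order_refl, of f t]) (simp add: poly_sum)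
    have e: "(\<Sum>j = 1..l. poly f (x j) * A j $$ (a, b)) = (\<Sum>k\<le>degree f. ?c k * (\<Sum>j = 1..l. (x j - t) ^ k * A j $$ (a, b)))"
      for l x and A :: "nat \<Rightarrow> real mat"
      unfolding pf sum_distrib_left sum_distrib_right by (subst sum.swap) (simp add: mult.assoc)
    show ?thesis unfolding e m[OF ab] ..
  qed
  have "(\<Sum>j = 1..l. indicator D (x j) * A j $$ (a, b)) = (\<Sum>j = 1..l'. indicator D (x' j) * A' j $$ (a, b))"
    if ab: "a < p" "b < p" for D :: "real set" and a b
  proof -
    obtain f where f: "\<forall>y\<in>x ` {1..l} \<union> x' ` {1..l'}. poly f y = indicator D y"
      using poly_interpolation[of "x ` {1..l} \<union> x' ` {1..l'}" "indicator D"] by auto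
    have "(\<Sum>j = 1..l. indicator D (x j) * A j $$ (a, b)) = (\<Sum>j = 1..l. poly f (x j) * A j $$ (a, b))"
      using f by (intro sum.cong) auto
    also have "\<dots> = (\<Sum>j = 1..l'. poly f (x' j) * A' j $$ (a, b))" by (rule poly[OF ab])
    also have "\<dots> = (\<Sum>j = 1..l'. indicator D (x' j) * A' j $$ (a, b))"
      using f by (intro sum.cong) auto
    finally show ?thesis .
  qed
  then show ?thesis unfolding atomic_measure_def by (intro restrict_ext eq_matI) auto
qed

section \<open>Minimal measures and extensions of the shift\<close>

lemma orthonormal_expand:
  fixes E :: "'a::real_inner set"
  assumes E: "finite E" "\<And>e e'. e \<in> E \<Longrightarrow> e' \<in> E \<Longrightarrow> inner e e' = (if e = e' then 1 else 0)" and x: "x \<in> span E"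
  shows "x = (\<Sum>e\<in>E. inner x e *\<^sub>R e)"
proof -
  obtain c where c: "x = (\<Sum>e\<in>E. c e *\<^sub>R e)" using x real_vector.span_finite[OF E(1)] by auto
  have "inner x e = c e" if e: "e \<in> E" for e
  proof -
    have "inner x e = (\<Sum>d\<in>E. if d = e then c e else 0)"
      unfolding c inner_sum_left using E(2) e by (intro sum.cong) auto
    then show ?thesis using E(1) e by simp
  qed
  then show ?thesis using c by simp
qed

lemma orthonormal_dim:
  fixes E :: "'a::real_inner set"
  assumes E: "\<And>e e'. e \<in> E \<Longrightarrow> e' \<in> E \<Longrightarrow> inner e e' = (if e = e' then 1 else 0)"
  shows "dim (span E) = card E"
proof (rule real_vector.dim_span_eq_card_independent, rule pairwise_orthogonal_independent)
  show "pairwise real_inner_class.orthogonal E" using E by (auto simp: pairwise_def real_inner_class.orthogonal_def)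
  show "0 \<notin> E" using E[of 0 0] by auto
qed

lemma mat_rank_zero: "mat_rank (0\<^sub>m p p) = 0"
proof -
  have "mat_rank (0\<^sub>m p p) = dim (span ((\<lambda>_. 0 :: fseq) ` {..<p}))" by (rule mat_rank_gram) auto
  also have "\<dots> \<le> dim (span {} :: fseq set)"
  proof (rule dim_mono_findim[OF _ findim_span])
    show "span ((\<lambda>_. 0 :: fseq) ` {..<p}) \<subseteq> span {}"
      by (rule real_vector.span_minimal[OF _ real_vector.subspace_span]) (use real_vector.span_zero in blast)
  qed simp
  also have "\<dots> = 0" using real_vector.dim_span_eq_card_independent[OF real_vector.independent_empty] by simp
  finally show ?thesis by simp
qed

lemma sum_image_fibres:
  assumes "finite E"
  shows "(\<Sum>r\<in>f ` E. \<Sum>e | e \<in> E \<and> f e = r. g e) = (\<Sum>e\<in>E. g e)"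
  using assms by (intro sum.group) auto

lemma psd_gram:
  fixes w :: "nat \<Rightarrow> 'a::real_inner"
  shows "psd p (mat p p (\<lambda>(a, b). inner (w a) (w b)))"
  unfolding psd_def
proof (intro conjI ballI)
  let ?A = "mat p p (\<lambda>(a, b). inner (w a) (w b))"
  show "?A \<in> sym_mats p" by (auto simp: sym_mats_def inner_commute intro!: eq_matI)
  fix x :: "real vec" assume x: "x \<in> carrier_vec p"
  have "scalar_prod x (?A *\<^sub>v x) = (\<Sum>a<p. \<Sum>b<p. x $ a * x $ b * ?A $$ (a, b))" using x by (intro quad_form) auto
  also have "\<dots> = (\<Sum>a<p. \<Sum>b<p. x $ a * x $ b * inner (w a) (w b))" by (intro sum.cong) auto
  also have "\<dots> = inner (\<Sum>a<p. x $ a *\<^sub>R w a) (\<Sum>a<p. x $ a *\<^sub>R w a)"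
    unfolding inner_sum_left unfolding inner_sum_right
    by (intro sum.cong refl) (simp add: mult.assoc mult.left_commute)
  finally show "0 \<le> scalar_prod x (?A *\<^sub>v x)" by simp
qed

text \<open>Used to identify the total rank of the masses with the dimension of the L^2 space of an
  atomic measure.\<close>

lemma dim_orthogonal_union:
  fixes W :: "nat \<Rightarrow> 'a::real_inner set"
  assumes fin: "\<And>j. finite (W j)"
    and orth: "\<And>i j x y. i < m \<Longrightarrow> j < m \<Longrightarrow> i \<noteq> j \<Longrightarrow> x \<in> W i \<Longrightarrow> y \<in> W j \<Longrightarrow> inner x y = 0"
  shows "dim (span (\<Union>j<m. W j)) = (\<Sum>j<m. dim (span (W j)))"
  using orth
proof (induction m)
  case 0
  then show ?case using real_vector.dim_span_eq_card_independent[OF real_vector.independent_empty] by simp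
next
  case (Suc m)
  let ?U = "span (W m)" and ?V = "span (\<Union>j<m. W j)"
  have eq: "(\<Union>j<Suc m. W j) = (\<Union>j<m. W j) \<union> W m" by (auto simp: less_Suc_eq)
  have sp: "span (?V \<union> ?U) = span (\<Union>j<Suc m. W j)"
    unfolding eq real_vector.span_Un real_vector.span_span ..
  have f: "findim (span (\<Union>j<Suc m. W j))" using fin by (intro findim_span) auto
  have "?U \<inter> ?V \<subseteq> {0}"
  proof
    fix x assume x: "x \<in> ?U \<inter> ?V"
    have xy: "inner x y = 0" if y: "y \<in> (\<Union>j<m. W j)" for y
    proof (rule inner_0_span[of "W m"])
      show "x \<in> span (W m)" using x by simp
      obtain j where "j < m" "y \<in> W j" using y by auto
      then show "inner b y = 0" if "b \<in> W m" for b using that Suc.prems[of m j b y] by simp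
    qed
    have "x \<in> span (\<Union>j<m. W j)" using x by simp
    then have "inner x x = 0" by (rule inner_span_0[of "\<Union>j<m. W j" x x, rotated]) (rule xy)
    then show "x \<in> {0}" by simp
  qed
  then have "?U \<inter> ?V = span {}" using real_vector.span_zero by auto
  then have d0: "dim (?U \<inter> ?V) = 0"
    using real_vector.dim_span_eq_card_independent[OF real_vector.independent_empty, where ?'a = 'a] by simp
  have "dim (span (?V \<union> ?U)) + dim (?U \<inter> ?V) = dim ?U + dim ?V"
  proof (rule dim_span_Un[OF f real_vector.subspace_span _ real_vector.subspace_span])
    show "?V \<subseteq> span (\<Union>j<Suc m. W j)" unfolding eq by (rule real_vector.span_mono) (rule Un_upper1)
    show "?U \<subseteq> span (\<Union>j<Suc m. W j)" unfolding eq by (rule real_vector.span_mono) (rule Un_upper2)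
  qed
  moreover have "dim ?V = (\<Sum>j<m. dim (span (W j)))" 
  proof (rule Suc.IH)
    show "inner x y = 0" if "i < m" "j < m" "i \<noteq> j" "x \<in> W i" "y \<in> W j" for i j x y
      using that by (intro Suc.prems[of i j x y]) simp_all
  qed
  ultimately show ?case unfolding sp d0 by simp
qed

context hankel_vectors
begin

lemma ext_facts:
  assumes "ext S"
  shows "linear S" "S ` K \<subseteq> K" "\<And>x y. x \<in> K \<Longrightarrow> y \<in> K \<Longrightarrow> inner (S x) y = inner x (S y)"
    "\<And>l. l < n * p \<Longrightarrow> S (v l) = v (l + p)"
  using assms by (auto simp: ext_def)

lemma ext_pow_K: "ext S \<Longrightarrow> x \<in> K \<Longrightarrow> (S ^^ k) x \<in> K"
  by (rule funpow_in[OF ext_facts(2)])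

lemma ext_pow_selfadj:
  assumes S: "ext S"
  shows "x \<in> K \<Longrightarrow> y \<in> K \<Longrightarrow> inner ((S ^^ k) x) y = inner x ((S ^^ k) y)"
proof (induction k arbitrary: y)
  case (Suc k)
  have "inner (S ((S ^^ k) x)) y = inner ((S ^^ k) x) (S y)"
    by (rule ext_facts(3)[OF S ext_pow_K[OF S Suc.prems(1)] Suc.prems(2)])
  also have "\<dots> = inner x ((S ^^ k) (S y))"
    using Suc.IH Suc.prems ext_facts(2)[OF S] by blast
  finally show ?case by (simp add: funpow_swap1)
qed simp

lemma ext_pow_v:
  assumes S: "ext S"
  shows "k \<le> n \<Longrightarrow> a < p \<Longrightarrow> (S ^^ k) (v a) = v (k * p + a)"
proof (induction k)
  case (Suc k)
  have "Suc k * p \<le> n * p" using Suc.prems by (intro mult_le_mono1) simp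
  then have "k * p + a < n * p" using Suc.prems by simp
  then have "S (v (k * p + a)) = v (k * p + a + p)" by (rule ext_facts(4)[OF S])
  then show ?case using Suc by (simp add: add_ac)
qed simp

lemma index_bound: "k \<le> n \<Longrightarrow> a < p \<Longrightarrow> k * p + a < n * p + p"
  by (meson add_le_less_mono mult_le_mono1)

lemma v_decomp: "l < n * p + p \<Longrightarrow> l div p \<le> n \<and> l mod p < p \<and> l = l div p * p + l mod p"
proof -
  assume "l < n * p + p"
  then have "l div p < n + 1" using p by (subst div_less_iff_less_mult) auto
  then show ?thesis using mod_p by simp
qed

lemma v_K0: "a < p \<Longrightarrow> v a \<in> K" by (rule v_K) simp

lemma ext_moment:
  assumes S: "ext S" and k: "k \<le> 2 * n" and ab: "a < p" "b < p"
  shows "inner ((S ^^ k) (v a)) (v b) = L ([:- t, 1:] ^ k) $$ (a, b)"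
proof -
  \<comment> \<open>Up to order \<open>2 * n\<close> the power splits into two exponents of at most
    \<open>n\<close> each, and such powers of \<open>S\<close> send \<open>v a\<close> and
    \<open>v b\<close> to known Gram vectors.\<close>
  define i j where "i = min k n" and "j = k - i"
  have ij: "k = j + i" "i \<le> n" "j \<le> n" using k by (auto simp: i_def j_def)
  have "inner ((S ^^ k) (v a)) (v b) = inner ((S ^^ j) ((S ^^ i) (v a))) (v b)" by (simp add: ij(1) funpow_add)
  also have "\<dots> = inner ((S ^^ i) (v a)) ((S ^^ j) (v b))"
    using ab by (intro ext_pow_selfadj[OF S] ext_pow_K[OF S] v_K0)
  also have "\<dots> = inner (v (i * p + a)) (v (j * p + b))" using ij ab by (simp add: ext_pow_v[OF S])
  also have "\<dots> = shifted_entry p t L (i * p + a) (j * p + b)" using ij ab by (intro gram index_bound)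
  also have "\<dots> = L ([:- t, 1:] ^ k) $$ (a, b)" using ab ij by (simp add: shifted_entry_def add.commute)
  finally show ?thesis .
qed

text \<open>The form of an extension is known on all pairs of Gram vectors with an index below
  \<open>n * p\<close>. On the remaining pairs, both from the last block, it is the moment of order
  \<open>2 * n + 1\<close>.\<close>

lemma ext_determined:
  assumes S: "ext S" "ext S'"
    and m: "\<And>k a b. a < p \<Longrightarrow> b < p \<Longrightarrow> inner ((S ^^ k) (v a)) (v b) = inner ((S' ^^ k) (v a)) (v b)"
    and x: "x \<in> K"
  shows "S x = S' x"
proof -
  have top: "inner (T (v (n * p + a))) (v (n * p + b)) = inner ((T ^^ (2 * n + 1)) (v a)) (v b)"
    if T: "ext T" and ab: "a < p" "b < p" for T a b
  proof -
    have "2 * n + 1 = n + (n + 1)" by simp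
    then have "inner ((T ^^ (2 * n + 1)) (v a)) (v b) = inner ((T ^^ n) ((T ^^ (n + 1)) (v a))) (v b)"
      by (simp only: funpow_add o_apply)
    also have "\<dots> = inner ((T ^^ (n + 1)) (v a)) ((T ^^ n) (v b))"
      using ab by (intro ext_pow_selfadj[OF T] ext_pow_K[OF T] v_K0)
    finally show ?thesis using ab by (simp add: ext_pow_v[OF T])
  qed
  have eq: "S (v l) = S' (v l)" if l: "l < n * p + p" for l
  proof (cases "l < n * p")
    case True
    then show ?thesis using S by (simp add: ext_def)
  next
    case False
    then obtain a where a: "a < p" "l = n * p + a" using l by (metis add_less_cancel_left le_add_diff_inverse not_less)
    have "S (v l) - S' (v l) = 0"
    proof (rule K_orth_0)
      show "S (v l) - S' (v l) \<in> K"
        using ext_facts(2)[OF S(1)] ext_facts(2)[OF S(2)] v_K[OF l] by (intro real_vector.subspace_diff[OF K_sub]) auto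
      fix r assume r: "r < n * p + p"
      show "inner (v r) (S (v l) - S' (v l)) = 0"
      proof (cases "r < n * p")
        case True
        have "inner (T (v l)) (v r) = inner (v l) (v (r + p))" if T: "ext T" for T
          using ext_facts(3)[OF T v_K[OF l] v_K[OF r]] ext_facts(4)[OF T True] by simp
        from this[OF S(1)] this[OF S(2)] show ?thesis by (simp add: inner_diff_right inner_commute)
      next
        case False
        then obtain b where b: "b < p" "r = n * p + b" using r by (metis add_less_cancel_left le_add_diff_inverse not_less)
        have "inner (S (v l)) (v r) = inner (S' (v l)) (v r)"
          using top[OF S(1) a(1) b(1)] top[OF S(2) a(1) b(1)] m[OF a(1) b(1), of "2 * n + 1"] a(2) b(2) by simp
        then show ?thesis by (simp add: inner_diff_right inner_commute)
      qed
    qed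
    then show ?thesis by simp
  qed
  show ?thesis
    by (rule real_vector.linear_eq_on[OF ext_facts(1)[OF S(1)] ext_facts(1)[OF S(2)], of x "v ` {..<n * p + p}"])
      (use x eq in \<open>auto simp: K_def\<close>)
qed

text \<open>The moment matrix uses powers of \<open>x\<close>, the Gram vectors powers of
  \<open>x - t\<close>. The binomial expansion of \<open>x^k\<close> around \<open>t\<close> gives
  vectors \<open>w\<close> that depend on the \<open>v\<close> by a unitriangular substitution, so
  both families span \<open>K\<close>.\<close>

lemma mat_rank_moment_matrix: "mat_rank (moment_matrix p n L) = dim K"
proof -
  define c where "c = (\<lambda>k j. real (k choose j) * t ^ (k - j))"
  have mon: "monom 1 k = (\<Sum>j\<le>k. Polynomial.smult (c k j) ([:- t, 1:] ^ j))" for k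
  proof -
    have "poly (monom 1 k) y = poly (\<Sum>j\<le>k. Polynomial.smult (c k j) ([:- t, 1:] ^ j)) y" for y
      using binomial_ring[of "y - t" t k] by (simp add: poly_monom poly_sum c_def mult_ac)
    then show ?thesis using poly_eq_poly_eq_iff by blast
  qed
  define w where "w = (\<lambda>l. \<Sum>j\<le>l div p. c (l div p) j *\<^sub>R v (j * p + l mod p))"
  have gw: "inner (w l) (w l') = L (monom 1 (l div p + l' div p)) $$ (l mod p, l' mod p)"
    if l: "l < n * p + p" "l' < n * p + p" for l l'
  proof -
    let ?k = "l div p" and ?k' = "l' div p" and ?a = "l mod p" and ?b = "l' mod p"
    have k: "?k \<le> n" "?k' \<le> n" using v_decomp l by auto
    have "monom 1 (?k + ?k') = (monom 1 ?k * monom 1 ?k' :: real poly)" by (simp add: mult_monom)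
    also have "\<dots> = (\<Sum>i\<in>{..?k} \<times> {..?k'}. Polynomial.smult (c ?k (fst i) * c ?k' (snd i)) ([:- t, 1:] ^ (fst i + snd i)))"
      unfolding mon[of ?k] mon[of ?k'] sum_product sum.cartesian_product
      by (intro sum.cong refl) (auto simp: power_add mult.commute)
    finally have "L (monom 1 (?k + ?k')) $$ (?a, ?b)
        = (\<Sum>i\<in>{..?k} \<times> {..?k'}. c ?k (fst i) * c ?k' (snd i) * L ([:- t, 1:] ^ (fst i + snd i)) $$ (?a, ?b))"
      using k mod_p by (simp only:) (intro linear_operator_sum[OF L]; auto)
    also have "\<dots> = (\<Sum>i\<in>{..?k} \<times> {..?k'}. c ?k (fst i) * c ?k' (snd i) * inner (v (fst i * p + ?a)) (v (snd i * p + ?b)))"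
    proof (rule sum.cong[OF refl])
      fix i assume i: "i \<in> {..?k} \<times> {..?k'}"
      then have "inner (v (fst i * p + ?a)) (v (snd i * p + ?b)) = shifted_entry p t L (fst i * p + ?a) (snd i * p + ?b)"
        using k mod_p by (intro gram index_bound) auto
      then show "c ?k (fst i) * c ?k' (snd i) * L ([:- t, 1:] ^ (fst i + snd i)) $$ (?a, ?b)
          = c ?k (fst i) * c ?k' (snd i) * inner (v (fst i * p + ?a)) (v (snd i * p + ?b))"
        using p by (simp add: shifted_entry_def)
    qed
    also have "\<dots> = inner (w l) (w l')"
      unfolding w_def inner_sum_left unfolding inner_sum_right
      unfolding sum.cartesian_product by (intro sum.cong) (auto simp: mult_ac)
    finally show ?thesis by simp
  qed
  have "mat_rank (moment_matrix p n L) = dim (span (w ` {..<(n + 1) * p}))"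
    by (rule mat_rank_gram) (auto simp: moment_matrix_def block_mat_def gw add.commute)
  also have "span (w ` {..<(n + 1) * p}) = K"
  proof
    show "span (w ` {..<(n + 1) * p}) \<subseteq> K"
    proof (rule real_vector.span_minimal[OF _ K_sub], rule image_subsetI)
      fix l assume "l \<in> {..<(n + 1) * p}"
      then have l: "l < n * p + p" by simp
      show "w l \<in> K" unfolding w_def
        using v_decomp[OF l] by (intro real_vector.subspace_sum[OF K_sub] real_vector.subspace_scale[OF K_sub] v_K index_bound) auto
    qed
    have "v (k * p + a) \<in> span (w ` {..<(n + 1) * p})" if "k \<le> n" "a < p" for k a
      using that
    proof (induction k rule: less_induct)
      case (less k)
      have ka: "k * p + a < (n + 1) * p" using index_bound[OF less.prems] by simp
      have "w (k * p + a) = (\<Sum>j\<le>k. c k j *\<^sub>R v (j * p + a))" using less.prems by (simp add: w_def)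
      also have "\<dots> = v (k * p + a) + (\<Sum>j<k. c k j *\<^sub>R v (j * p + a))"
        by (subst lessThan_Suc_atMost[symmetric]) (simp add: c_def)
      finally have e: "v (k * p + a) = w (k * p + a) - (\<Sum>j<k. c k j *\<^sub>R v (j * p + a))" by simp
      show ?case unfolding e
      proof (rule real_vector.span_diff)
        show "w (k * p + a) \<in> span (w ` {..<(n + 1) * p})" using ka by (intro real_vector.span_base) auto
        show "(\<Sum>j<k. c k j *\<^sub>R v (j * p + a)) \<in> span (w ` {..<(n + 1) * p})"
          by (rule real_vector.span_sum, rule real_vector.span_scale, rule less.IH) (use less.prems in auto)
      qed
    qed
    then have "v l \<in> span (w ` {..<(n + 1) * p})" if "l < n * p + p" for l
      using v_decomp[OF that] by metis
    then show "K \<subseteq> span (w ` {..<(n + 1) * p})"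
      unfolding K_def by (intro real_vector.span_minimal real_vector.subspace_span) auto
  qed
  finally show ?thesis .
qed

text \<open>This is the spectral measure of \<open>S\<close>: the mass at \<open>r + t\<close> is
  the Gram matrix of the projections of \<open>v 0\<close>, ..., \<open>v (p - 1)\<close> to the
  eigenspace of \<open>r\<close>. Its rank is the full dimension of the eigenspace because the
  powers of \<open>S\<close> carry these \<open>p\<close> vectors to a spanning family of
  \<open>K\<close>.\<close>

lemma measure_of_ext:
  assumes S: "ext S"
  shows "\<exists>l x A. atomic p l x A \<and> (\<forall>j\<in>{1..l}. A j \<noteq> 0\<^sub>m p p) \<and> (\<Sum>j = 1..l. mat_rank (A j)) = dim K \<and>
    mult_at (atomic_measure p l x A) t = nullity S \<and>
    (\<forall>k a b. a < p \<longrightarrow> b < p \<longrightarrow> (\<Sum>j = 1..l. (x j - t) ^ k * A j $$ (a, b)) = inner ((S ^^ k) (v a)) (v b))"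
proof -
  obtain E ev where E0: "finite E \<and> span E = K \<and> card E = dim K \<and> (\<forall>e\<in>E. S e = ev e *\<^sub>R e) \<and>
    (\<forall>e\<in>E. \<forall>e'\<in>E. inner e e' = (if e = e' then 1 else 0))"
    using spectral_decomposition[OF ext_facts(1-3)[OF S] K_findim] by blast
  then have E: "finite E" "span E = K" "card E = dim K" "\<And>e. e \<in> E \<Longrightarrow> S e = ev e *\<^sub>R e"
    "\<And>e e'. e \<in> E \<Longrightarrow> e' \<in> E \<Longrightarrow> inner e e' = (if e = e' then 1 else 0)" by blast+
  have EK: "e \<in> E \<Longrightarrow> e \<in> K" for e using E(2) real_vector.span_base[of e E] by simp
  define Er where "Er = (\<lambda>r. {e \<in> E. ev e = r})"
  have fEr: "finite (Er r)" and EEr: "Er r \<subseteq> E" for r using E(1) by (auto simp: Er_def)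
  have onEr: "inner e e' = (if e = e' then 1 else 0)" if "e \<in> Er r" "e' \<in> Er r" for e e' r
    using that E(5) EEr by blast
  define P where "P = (\<lambda>r a. \<Sum>e\<in>Er r. inner (v a) e *\<^sub>R e)"
  define AA where "AA = (\<lambda>r. mat p p (\<lambda>(a, b). inner (P r a) (P r b)))"
  have PP: "inner (P r a) (P r b) = (\<Sum>e\<in>Er r. inner (v a) e * inner (v b) e)" for r a b
  proof -
    have "inner (P r a) (P r b) = (\<Sum>e\<in>Er r. inner (v a) e * inner e (P r b))"
      by (subst (1) P_def) (simp add: inner_sum_left)
    also have "\<dots> = (\<Sum>e\<in>Er r. inner (v a) e * inner (v b) e)"
    proof (rule sum.cong[OF refl])
      fix e assume e: "e \<in> Er r"
      have "inner e (P r b) = (\<Sum>d\<in>Er r. if d = e then inner (v b) e else 0)"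
        unfolding P_def inner_sum_right using onEr e by (intro sum.cong) auto
      then show "inner (v a) e * inner e (P r b) = inner (v a) e * inner (v b) e" using fEr e by simp
    qed
    finally show ?thesis .
  qed
  have Sr: "S k = r *\<^sub>R k" if "k \<in> span (Er r)" for k r
  proof (rule real_vector.linear_eq_on[OF ext_facts(1)[OF S] _ that])
    show "linear (\<lambda>k. r *\<^sub>R k)" by simp
    show "S b = r *\<^sub>R b" if "b \<in> Er r" for b using that E(4) by (auto simp: Er_def)
  qed
  have Srk: "(S ^^ i) k = r ^ i *\<^sub>R k" if "k \<in> span (Er r)" for k r i
  proof (induction i)
    case (Suc i)
    then show ?case using Sr[OF that] by (simp add: linear_scale[OF ext_facts(1)[OF S]] mult.commute)
  qed simp
  \<comment> \<open>A vector \<open>k\<close> of the eigenspace orthogonal to all projections is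
    orthogonal to \<open>v a\<close> for \<open>a < p\<close>. Since powers of \<open>S\<close> act
    on \<open>k\<close> as scalars, it is orthogonal to every \<open>(S ^^ i) (v a)\<close> with
    \<open>i \<le> n\<close>, hence to \<open>K\<close>.\<close>
  have spP: "span (P r ` {..<p}) = span (Er r)" for r
  proof
    show le: "span (P r ` {..<p}) \<subseteq> span (Er r)"
    proof (rule real_vector.span_minimal[OF _ real_vector.subspace_span], rule image_subsetI)
      fix a show "P r a \<in> span (Er r)" unfolding P_def
        by (rule real_vector.span_sum, rule real_vector.span_scale, rule real_vector.span_base)
    qed
    show "span (Er r) \<subseteq> span (P r ` {..<p})"
    proof
      fix e assume e: "e \<in> span (Er r)"
      show "e \<in> span (P r ` {..<p})"
      proof (rule double_complement[OF findim_span le real_vector.subspace_span e])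
        fix k assume k: "k \<in> span (Er r)" "\<And>u. u \<in> span (P r ` {..<p}) \<Longrightarrow> inner k u = 0"
        have kK: "k \<in> K" using k(1) real_vector.span_mono[OF EEr, of r] E(2) by auto
        have va: "inner (v a) k = 0" if a: "a < p" for a
        proof -
          have "inner (v a) k = (\<Sum>e\<in>Er r. inner k e * inner (v a) e)"
            by (subst orthonormal_expand[OF fEr onEr k(1)]) (simp_all add: inner_sum_right)
          also have "\<dots> = inner k (P r a)" unfolding P_def by (simp add: inner_sum_right mult.commute)
          also have "\<dots> = 0" using a by (intro k(2) real_vector.span_base) auto
          finally show ?thesis .
        qed
        have "k = 0"
        proof (rule K_orth_0[OF kK])
          fix l assume l: "l < n * p + p"
          have "v l = (S ^^ (l div p)) (v (l mod p))" using v_decomp[OF l] ext_pow_v[OF S] by metis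
          then have "inner (v l) k = inner (v (l mod p)) ((S ^^ (l div p)) k)"
            using ext_pow_selfadj[OF S v_K0[OF mod_p] kK] by simp
          then show "inner (v l) k = 0" using Srk[OF k(1)] va[OF mod_p] by simp
        qed
        then show "inner e k = 0" by simp
      qed auto
    qed
  qed
  have rk: "mat_rank (AA r) = card (Er r)" for r
  proof -
    have "mat_rank (AA r) = dim (span (P r ` {..<p}))" by (rule mat_rank_gram) (auto simp: AA_def)
    also have "\<dots> = card (Er r)" unfolding spP using onEr by (rule orthonormal_dim)
    finally show ?thesis .
  qed
  define l where "l = card (ev ` E)"
  have "finite (ev ` E)" using E(1) by simp
  from ex_bij_betw_nat_finite_1[OF this] obtain b where b: "bij_betw b {1..l} (ev ` E)" unfolding l_def ..
  have sum_b: "(\<Sum>j = 1..l. f (b j)) = (\<Sum>r\<in>ev ` E. f r)" for f :: "real \<Rightarrow> 'c::comm_monoid_add"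
    by (rule sum.reindex_bij_betw[OF b])
  have at: "atomic p l (\<lambda>j. b j + t) (\<lambda>j. AA (b j))"
  proof
    show "inj_on (\<lambda>j. b j + t) {1..l}" 
      by (rule inj_onI, rule inj_onD[OF bij_betw_imp_inj_on[OF b]]) simp_all
    show "psd p (AA (b j))" for j unfolding AA_def by (rule psd_gram)
  qed
  have nz: "AA (b j) \<noteq> 0\<^sub>m p p" if "j \<in> {1..l}" for j
  proof
    assume "AA (b j) = 0\<^sub>m p p"
    then have "card (Er (b j)) = 0" using rk[of "b j"] mat_rank_zero by simp
    then have "Er (b j) = {}" using fEr by simp
    moreover have "b j \<in> ev ` E" using bij_betwE[OF b] that by blast
    then obtain e where "e \<in> E" "ev e = b j" by force
    ultimately show False by (auto simp: Er_def)
  qed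
  have "(\<Sum>j = 1..l. mat_rank (AA (b j))) = (\<Sum>r\<in>ev ` E. \<Sum>e | e \<in> E \<and> ev e = r. 1)"
    
    unfolding sum_b[of "\<lambda>r. mat_rank (AA r)"] by (simp add: rk Er_def)
  also have "\<dots> = dim K" unfolding sum_image_fibres[OF E(1)] using E(3) by simp
  finally have rank: "(\<Sum>j = 1..l. mat_rank (AA (b j))) = dim K" .
  have mom: "(\<Sum>j = 1..l. (b j + t - t) ^ k * AA (b j) $$ (a, a')) = inner ((S ^^ k) (v a)) (v a')"
    if a: "a < p" "a' < p" for k a a'
  proof -
    have "(\<Sum>j = 1..l. (b j + t - t) ^ k * AA (b j) $$ (a, a')) = (\<Sum>r\<in>ev ` E. r ^ k * AA r $$ (a, a'))"
      using sum_b[of "\<lambda>r. r ^ k * AA r $$ (a, a')"] by simp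
    also have "\<dots> = (\<Sum>r\<in>ev ` E. \<Sum>e | e \<in> E \<and> ev e = r. ev e ^ k * (inner (v a) e * inner (v a') e))"
      using a by (intro sum.cong refl) (simp add: AA_def PP sum_distrib_left Er_def)
    also have "\<dots> = (\<Sum>e\<in>E. ev e ^ k * (inner (v a) e * inner (v a') e))" by (rule sum_image_fibres[OF E(1)])
    also have "\<dots> = (\<Sum>e\<in>E. inner ((S ^^ k) (v a)) e * inner (v a') e)"
    proof (rule sum.cong[OF refl])
      fix e assume e: "e \<in> E"
      have "inner ((S ^^ k) (v a)) e = inner (v a) ((S ^^ k) e)" by (rule ext_pow_selfadj[OF S v_K0[OF a(1)] EK[OF e]])
      also have "(S ^^ k) e = ev e ^ k *\<^sub>R e" using e by (intro Srk real_vector.span_base) (auto simp: Er_def)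
      finally show "ev e ^ k * (inner (v a) e * inner (v a') e) = inner ((S ^^ k) (v a)) e * inner (v a') e" by simp
    qed
    also have "\<dots> = inner ((S ^^ k) (v a)) (v a')"
    proof -
      have "v a' \<in> span E" using v_K0[OF a(2)] E(2) by simp
      from orthonormal_expand[OF E(1,5) this] have "v a' = (\<Sum>e\<in>E. inner (v a') e *\<^sub>R e)" by simp
      then have "inner ((S ^^ k) (v a)) (v a') = inner ((S ^^ k) (v a)) (\<Sum>e\<in>E. inner (v a') e *\<^sub>R e)" by simp
      then show ?thesis by (simp add: inner_sum_right mult.commute)
    qed
    finally show ?thesis .
  qed
  have ker: "{x \<in> K. S x = 0} = span (Er 0)"
  proof
    show "span (Er 0) \<subseteq> {x \<in> K. S x = 0}"
      using Sr[of _ 0] real_vector.span_mono[OF EEr, of 0] E(2) by auto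
    show "{x \<in> K. S x = 0} \<subseteq> span (Er 0)"
    proof
      fix x assume x: "x \<in> {x \<in> K. S x = 0}"
      have "inner x e = 0" if e: "e \<in> E - Er 0" for e
      proof -
        have "inner x (S e) = inner (S x) e"
          by (rule ext_facts(3)[OF S, symmetric]) (use x e EK in auto)
        then have "ev e * inner x e = 0" using x e E(4)[of e] by simp
        then show ?thesis using e by (auto simp: Er_def)
      qed
      then have "(\<Sum>e\<in>E. inner x e *\<^sub>R e) = (\<Sum>e\<in>Er 0. inner x e *\<^sub>R e)"
        using EEr E(1) by (intro sum.mono_neutral_right) auto
      moreover have "x = (\<Sum>e\<in>E. inner x e *\<^sub>R e)" by (rule orthonormal_expand[OF E(1,5)]) (use x E(2) in auto)
      moreover have "(\<Sum>e\<in>Er 0. inner x e *\<^sub>R e) \<in> span (Er 0)"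
        by (rule real_vector.span_sum, rule real_vector.span_scale, rule real_vector.span_base)
      ultimately show "x \<in> span (Er 0)" by simp
    qed
  qed
  have "atomic_measure p l (\<lambda>j. b j + t) (\<lambda>j. AA (b j)) {t} = AA 0"
  proof (rule eq_matI)
    fix a a' assume "a < dim_row (AA 0)" "a' < dim_col (AA 0)"
    then have a: "a < p" "a' < p" by (auto simp: AA_def)
    have "atomic_measure p l (\<lambda>j. b j + t) (\<lambda>j. AA (b j)) {t} $$ (a, a')
        = (\<Sum>j = 1..l. indicator {t} (b j + t) * AA (b j) $$ (a, a'))"
      by (rule atomic.measure_index[OF at _ a]) simp
    also have "\<dots> = (\<Sum>r\<in>ev ` E. indicator {t} (r + t) * AA r $$ (a, a'))"
      by (rule sum_b[of "\<lambda>r. indicator {t} (r + t) * AA r $$ (a, a')"])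
    also have "\<dots> = (\<Sum>r\<in>ev ` E. if r = 0 then AA 0 $$ (a, a') else 0)"
      by (intro sum.cong) (auto simp: indicator_def)
    also have "\<dots> = (if 0 \<in> ev ` E then AA 0 $$ (a, a') else 0)" using E(1) by simp
    also have "\<dots> = AA 0 $$ (a, a')"
    proof (cases "0 \<in> ev ` E")
      \<comment> \<open>If 0 is no eigenvalue, then \<open>AA 0\<close> is the zero matrix, which is
        also the mass of the measure at \<open>t\<close>.\<close>
      case False
      then have "Er 0 = {}" by (auto simp: Er_def)
      then show ?thesis using a by (simp add: AA_def PP)
    qed simp
    finally show "atomic_measure p l (\<lambda>j. b j + t) (\<lambda>j. AA (b j)) {t} $$ (a, a') = AA 0 $$ (a, a')" .
  qed (simp_all add: atomic_measure_def AA_def)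
  then have "mult_at (atomic_measure p l (\<lambda>j. b j + t) (\<lambda>j. AA (b j))) t = nullity S"
    unfolding mult_at_def nullity_def ker using rk[of 0] orthonormal_dim[of "Er 0"] onEr by simp
  then show ?thesis using at nz rank mom
    by (intro exI[of _ l] exI[of _ "\<lambda>j. b j + t"] exI[of _ "\<lambda>j. AA (b j)"] conjI) auto
qed

end

text \<open>A block diagonal matrix with semidefinite blocks is semidefinite, so
  \<open>psd_gram_vectors\<close> applies to it; \<open>div\<close> recovers the block and
  \<open>mod\<close> the position.\<close>

lemma block_gram_vectors:
  fixes B :: "nat \<Rightarrow> real mat"
  assumes p: "p \<ge> 1" and B: "\<And>j. j < m \<Longrightarrow> psd p (B j)"
  shows "\<exists>w :: nat \<Rightarrow> nat \<Rightarrow> fseq. \<forall>i<m. \<forall>j<m. \<forall>a<p. \<forall>b<p.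
    inner (w i a) (w j b) = (if i = j then B i $$ (a, b) else 0)"
proof -
  define M where "M = (\<lambda>l l'. if l div p = l' div p then B (l div p) $$ (l mod p, l' mod p) else 0)"
  have mod: "l mod p < p" for l using p by simp
  have div: "l div p < m" if "l < m * p" for l using that by (simp add: less_mult_imp_div_less)
  have group: "(\<Sum>l<m * p. f l) = (\<Sum>i<m. \<Sum>a<p. f (i * p + a))" for f :: "nat \<Rightarrow> real"
    by (simp add: sum.nat_group[symmetric] sum.atLeastLessThan_shift_0 atLeast0LessThan)
  have "\<exists>v :: nat \<Rightarrow> fseq. \<forall>i<m * p. \<forall>j<m * p. inner (v i) (v j) = M i j"
  proof (rule psd_gram_vectors)
    show "M l l' = M l' l" if "l < m * p" "l' < m * p" for l l'
      using psd_sym[OF B[OF div[OF that(1)]] mod mod] by (simp add: M_def)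
    show "0 \<le> (\<Sum>l<m * p. \<Sum>l'<m * p. c l * c l' * M l l')" for c
    proof -
      have "(\<Sum>l<m * p. \<Sum>l'<m * p. c l * c l' * M l l')
          = (\<Sum>i<m. \<Sum>a<p. \<Sum>j<m. if i = j then (\<Sum>b<p. c (i * p + a) * c (i * p + b) * B i $$ (a, b)) else 0)"
        unfolding group by (intro sum.cong refl) (auto simp: M_def)
      also have "\<dots> = (\<Sum>i<m. \<Sum>a<p. \<Sum>b<p. c (i * p + a) * c (i * p + b) * B i $$ (a, b))"
        by (rule sum.cong[OF refl], rule sum.cong[OF refl]) simp
      also have "\<dots> \<ge> 0"
      proof (rule sum_nonneg)
        fix i assume "i \<in> {..<m}"
        then show "0 \<le> (\<Sum>a<p. \<Sum>b<p. c (i * p + a) * c (i * p + b) * B i $$ (a, b))"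
          using psd_quad[OF B, of i "\<lambda>a. c (i * p + a)"] by simp
      qed
      finally show ?thesis .
    qed
  qed
  then obtain v :: "nat \<Rightarrow> fseq" where v: "\<And>i j. i < m * p \<Longrightarrow> j < m * p \<Longrightarrow> inner (v i) (v j) = M i j" by auto
  have idx: "i * p + a < m * p" if "i < m" "a < p" for i a
  proof -
    have "Suc i * p \<le> m * p" using that(1) by (intro mult_le_mono1) simp
    then show ?thesis using that(2) by simp
  qed
  show ?thesis
    by (rule exI[of _ "\<lambda>i a. v (i * p + a)"]) (use p in \<open>auto simp: v[OF idx idx] M_def\<close>)
qed

context hankel_vectors
begin

text \<open>The vectors \<open>w j a\<close> realise \<open>L^2\<close> of the measure as an orthogonal sum of one block per atom, and
  \<open>D\<close> is multiplication by \<open>x - t\<close>. The rank condition makes the isometry from \<open>K\<close> surjective.\<close>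

lemma ext_of_measure:
  assumes at: "atomic p l x A"
    and rep: "\<And>k a b. k \<le> 2 * n \<Longrightarrow> a < p \<Longrightarrow> b < p \<Longrightarrow>
      L ([:- t, 1:] ^ k) $$ (a, b) = (\<Sum>j = 1..l. (x j - t) ^ k * A j $$ (a, b))"
    and rank: "(\<Sum>j = 1..l. mat_rank (A j)) = dim K"
  shows "\<exists>S. ext S \<and> mult_at (atomic_measure p l x A) t = nullity S \<and>
    (\<forall>k a b. a < p \<longrightarrow> b < p \<longrightarrow> (\<Sum>j = 1..l. (x j - t) ^ k * A j $$ (a, b)) = inner ((S ^^ k) (v a)) (v b))"
proof -
  \<comment> \<open>Atoms are numbered from 1 and blocks from 0, hence \<open>Suc j\<close>.
    Subtracting \<open>t\<close> makes the multiplicity of \<open>t\<close> a question about the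
    eigenvalue 0.\<close>
  define r where "r = (\<lambda>j. x (Suc j) - t)"
  have r_inj: "i = j" if "r i = r j" "i < l" "j < l" for i j
    using inj_onD[OF atomic.inj[OF at], of "Suc i" "Suc j"] that by (simp add: r_def)
  have psdA: "psd p (A (Suc j))" if "j < l" for j using atomic.psd[OF at, of "Suc j"] that by simp
  obtain w :: "nat \<Rightarrow> nat \<Rightarrow> fseq" where w: "\<forall>i<l. \<forall>j<l. \<forall>a<p. \<forall>b<p.
      inner (w i a) (w j b) = (if i = j then A (Suc i) $$ (a, b) else 0)"
    using block_gram_vectors[OF p, of l "\<lambda>j. A (Suc j)"] psdA by auto
  have wI: "inner (w i a) (w j b) = (if i = j then A (Suc i) $$ (a, b) else 0)"
    if "i < l" "j < l" "a < p" "b < p" for i j a b using w that by simp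
  define W where "W = (\<Union>j<l. w j ` {..<p})"
  have fW: "finite W" unfolding W_def by auto
  have wW: "w j a \<in> W" if "j < l" "a < p" for j a using that unfolding W_def by auto
  have dimW: "dim (span W) = dim K"
  proof -
    have "dim (span W) = (\<Sum>j<l. dim (span (w j ` {..<p})))" unfolding W_def
    proof (rule dim_orthogonal_union)
      show "inner y z = 0" if "i < l" "j < l" "i \<noteq> j" "y \<in> w i ` {..<p}" "z \<in> w j ` {..<p}" for i j y z
        using that wI by auto
    qed simp
    also have "\<dots> = (\<Sum>j<l. mat_rank (A (Suc j)))"
    proof (rule sum.cong[OF refl])
      fix j assume j: "j \<in> {..<l}"
      show "dim (span (w j ` {..<p})) = mat_rank (A (Suc j))"
      proof (rule mat_rank_gram[symmetric])
        show "A (Suc j) \<in> carrier_mat p p" using psdA[of j] j by (simp add: psd_def sym_mats_def)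
      qed (use wI j in simp)
    qed
    also have "\<dots> = dim K" unfolding rank[symmetric] by (simp add: sum.atLeast1_atMost_eq)
    finally show ?thesis .
  qed
  \<comment> \<open>\<open>z k a\<close> represents \<open>(x - t)^k e_a\<close> in the L^2 space of
    the measure.\<close>
  define z where "z = (\<lambda>k a. \<Sum>j<l. r j ^ k *\<^sub>R w j a)"
  have zW: "z k a \<in> span W" if "a < p" for k a unfolding z_def
    using that by (intro real_vector.span_sum real_vector.span_scale real_vector.span_base wW) auto
  have zI: "inner (z k a) (z k' b) = (\<Sum>j = 1..l. (x j - t) ^ (k + k') * A j $$ (a, b))" if "a < p" "b < p" for k k' a b
  proof -
    have "inner (z k a) (z k' b) = (\<Sum>i<l. \<Sum>j<l. if i = j then r i ^ (k + k') * A (Suc i) $$ (a, b) else 0)"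
      unfolding z_def inner_sum_left unfolding inner_sum_right
      using that by (intro sum.cong refl) (auto simp: wI power_add)
    also have "\<dots> = (\<Sum>i<l. r i ^ (k + k') * A (Suc i) $$ (a, b))" by (intro sum.cong refl) simp
    also have "\<dots> = (\<Sum>j = 1..l. (x j - t) ^ (k + k') * A j $$ (a, b))" by (simp add: sum.atLeast1_atMost_eq r_def)
    finally show ?thesis .
  qed
  define vv where "vv = (\<lambda>l. z (l div p) (l mod p))"
  have vvW: "vv i \<in> span W" for i unfolding vv_def by (rule zW[OF mod_p])
  have vvI: "inner (v i) (v j) = inner (vv i) (vv j)" if "i \<in> {..<n * p + p}" "j \<in> {..<n * p + p}" for i j
  proof -
    have "i div p + j div p \<le> 2 * n" using v_decomp[of i] v_decomp[of j] that by auto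
    then show ?thesis using that mod_p by (simp add: gram shifted_entry_def rep vv_def zI)
  qed
  \<comment> \<open>The families \<open>v\<close> and \<open>vv\<close> have the same Gram matrix,
    so their spans have the same dimension. By the rank condition it is also that of
    \<open>span W\<close>, which turns an inclusion into the equality \<open>svv\<close>.\<close>
  define Gm where "Gm = mat (n * p + p) (n * p + p) (\<lambda>(i, j). inner (v i) (v j))"
  have "mat_rank Gm = dim (span (v ` {..<n * p + p}))" by (rule mat_rank_gram) (auto simp: Gm_def)
  moreover have "mat_rank Gm = dim (span (vv ` {..<n * p + p}))" by (rule mat_rank_gram) (auto simp: Gm_def vvI)
  ultimately have dvv: "dim (span (vv ` {..<n * p + p})) = dim K" by (simp add: K_def)
  have svv: "span (vv ` {..<n * p + p}) = span W"
  proof (rule findim_eqI[OF real_vector.subspace_span _ findim_span[OF fW]])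
    show "span (vv ` {..<n * p + p}) \<subseteq> span W"
      by (rule real_vector.span_minimal[OF _ real_vector.subspace_span], rule image_subsetI, rule vvW)
    show "dim (span W) \<le> dim (span (vv ` {..<n * p + p}))" using dvv dimW by linarith
  qed
  let ?I = "{..<n * p + p}"
  have "\<exists>U. linear U \<and> (\<forall>i\<in>?I. U (v i) = vv i) \<and>
      (\<forall>y\<in>span (v ` ?I). \<forall>y'\<in>span (v ` ?I). inner (U y) (U y') = inner y y')"
    by (rule gram_isometry) (simp, rule vvI)
  then obtain U where U0: "linear U \<and> (\<forall>i\<in>?I. U (v i) = vv i) \<and>
      (\<forall>y\<in>span (v ` ?I). \<forall>y'\<in>span (v ` ?I). inner (U y) (U y') = inner y y')" ..
  have U: "linear U" "\<And>i. i \<in> ?I \<Longrightarrow> U (v i) = vv i" using U0 by simp_all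
  have "\<exists>U'. linear U' \<and> (\<forall>i\<in>?I. U' (vv i) = v i) \<and>
      (\<forall>y\<in>span (vv ` ?I). \<forall>y'\<in>span (vv ` ?I). inner (U' y) (U' y') = inner y y')"
    by (rule gram_isometry) (simp, rule vvI[symmetric])
  then obtain U' where U'0: "linear U' \<and> (\<forall>i\<in>?I. U' (vv i) = v i) \<and>
      (\<forall>y\<in>span (vv ` ?I). \<forall>y'\<in>span (vv ` ?I). inner (U' y) (U' y') = inner y y')" ..
  have U': "linear U'" "\<And>i. i \<in> ?I \<Longrightarrow> U' (vv i) = v i" using U'0 by simp_all
  have iso: "inner (U' y) (U' y') = inner y y'" if "y \<in> span W" "y' \<in> span W" for y y'
    using U'0 that unfolding svv by simp
  have UK: "U y \<in> span W" if "y \<in> K" for y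
  proof -
    have "U ` K = span (U ` v ` {..<n * p + p})" unfolding K_def by (rule linear_span_image[OF U(1), symmetric])
    also have "U ` v ` {..<n * p + p} = vv ` {..<n * p + p}" unfolding image_image by (rule image_cong[OF refl U(2)])
    finally have "U ` K = span W" unfolding svv .
    then show ?thesis using imageI[OF that, of U] by simp
  qed
  have U'W: "U' y \<in> K" if "y \<in> span W" for y
  proof -
    have "U' ` span W = span (U' ` vv ` {..<n * p + p})" unfolding svv[symmetric] by (rule linear_span_image[OF U'(1), symmetric])
    also have "U' ` vv ` {..<n * p + p} = v ` {..<n * p + p}" unfolding image_image by (rule image_cong[OF refl U'(2)])
    finally have "U' ` span W = K" unfolding K_def .
    then show ?thesis using imageI[OF that, of U'] by simp
  qed
  have U'U: "U' (U y) = y" if "y \<in> K" for y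
  proof -
    have "(U' \<circ> U) y = id y"
      by (rule real_vector.linear_eq_on[OF linear_compose[OF U(1) U'(1)] linear_id that[unfolded K_def]])
        (use U(2) U'(2) in auto)
    then show ?thesis by simp
  qed
  have UU': "U (U' y) = y" if "y \<in> span W" for y
  proof -
    have "(U \<circ> U') y = id y"
      by (rule real_vector.linear_eq_on[OF linear_compose[OF U'(1) U(1)] linear_id that[folded svv]])
        (use U(2) U'(2) in auto)
    then show ?thesis by simp
  qed
  \<comment> \<open>The vectors of one block may be dependent, so \<open>D\<close> has to respect
    relations. Orthogonality splits a relation into relations inside single blocks, and there
    \<open>D\<close> is a scalar.\<close>
  have null: "(\<Sum>i\<in>{..<l} \<times> {..<p}. c i *\<^sub>R (r (fst i) *\<^sub>R w (fst i) (snd i))) = 0"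
    if 0: "(\<Sum>i\<in>{..<l} \<times> {..<p}. c i *\<^sub>R w (fst i) (snd i)) = 0" for c
  proof -
    define y where "y = (\<lambda>j. \<Sum>a<p. c (j, a) *\<^sub>R w j a)"
    have orth: "inner (y i) (y j) = 0" if "i < l" "j < l" "i \<noteq> j" for i j
      unfolding y_def inner_sum_left inner_sum_right using that by (intro sum.neutral ballI) (simp add: wI)
    have s0: "(\<Sum>j<l. y j) = 0" using 0 unfolding y_def sum.cartesian_product by (simp add: case_prod_unfold)
    have y0: "y i = 0" if i: "i < l" for i
    proof -
      have "(\<Sum>j<l. inner (y i) (y j)) = (\<Sum>j<l. if j = i then inner (y i) (y i) else 0)"
        using orth i by (intro sum.cong refl) auto
      then have "inner (y i) (y i) = inner (y i) (\<Sum>j<l. y j)" using i by (simp add: inner_sum_right)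
      then show ?thesis using s0 by simp
    qed
    have "(\<Sum>i\<in>{..<l} \<times> {..<p}. c i *\<^sub>R (r (fst i) *\<^sub>R w (fst i) (snd i))) = (\<Sum>j<l. \<Sum>a<p. c (j, a) *\<^sub>R (r j *\<^sub>R w j a))"
      unfolding sum.cartesian_product by (simp add: case_prod_unfold)
    also have "\<dots> = (\<Sum>j<l. r j *\<^sub>R y j)"
      unfolding y_def real_vector.scale_sum_right by (simp add: mult.commute)
    also have "\<dots> = 0" using y0 by simp
    finally show ?thesis .
  qed
  obtain D where D: "linear D"
    and D0: "\<And>i. i \<in> {..<l} \<times> {..<p} \<Longrightarrow> D (w (fst i) (snd i)) = r (fst i) *\<^sub>R w (fst i) (snd i)"
    by (rule linear_extension_family[where I = "{..<l} \<times> {..<p}" and v = "\<lambda>i. w (fst i) (snd i)"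
          and w = "\<lambda>i. r (fst i) *\<^sub>R w (fst i) (snd i)", OF _ null]) simp_all
  have Dw: "D (w j a) = r j *\<^sub>R w j a" if "j < l" "a < p" for j a using D0[of "(j, a)"] that by simp
  have DW: "D y \<in> span W" if "y \<in> span W" for y
  proof -
    have "D ` span W = span (D ` W)" by (rule linear_span_image[OF D, symmetric])
    also have "\<dots> \<subseteq> span W"
    proof (rule real_vector.span_minimal[OF _ real_vector.subspace_span], rule image_subsetI)
      fix b assume "b \<in> W"
      then obtain j a where "j < l" "a < p" "b = w j a" unfolding W_def by auto
      then show "D b \<in> span W" using wW[of j a] by (simp add: Dw real_vector.span_scale real_vector.span_base)
    qed
    finally have "D ` span W \<subseteq> span W" .
    then show ?thesis using imageI[OF that, of D] by (rule subsetD)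
  qed
  have Dsym: "inner (D y) y' = inner y (D y')" if "y \<in> span W" "y' \<in> span W" for y y'
  proof (rule selfadjoint_span[OF D _ that])
    fix b b' assume "b \<in> W" "b' \<in> W"
    then obtain i a j c where "i < l" "a < p" "b = w i a" "j < l" "c < p" "b' = w j c" unfolding W_def by auto
    then show "inner (D b) b' = inner b (D b')" by (simp add: Dw wI)
  qed
  have Dz: "D (z k a) = z (Suc k) a" if "a < p" for k a
    unfolding z_def using that by (simp add: linear_sum[OF D] linear_scale[OF D] Dw mult.commute)
  define S where "S = (\<lambda>y. U' (D (U y)))"
  have linS: "linear S"
    using linear_compose[OF U(1) linear_compose[OF D U'(1)]] by (simp add: S_def comp_def)
  have ext: "ext S" unfolding ext_def
  proof (intro conjI ballI allI impI linS)
    show "S ` K \<subseteq> K" unfolding S_def by (rule image_subsetI) (intro U'W DW UK)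
    fix y y' assume y: "y \<in> K" "y' \<in> K"
    have "inner (S y) y' = inner (U' (D (U y))) (U' (U y'))" using U'U[OF y(2)] by (simp add: S_def)
    also have "\<dots> = inner (D (U y)) (U y')" by (rule iso[OF DW[OF UK[OF y(1)]] UK[OF y(2)]])
    also have "\<dots> = inner (U y) (D (U y'))" by (rule Dsym[OF UK[OF y(1)] UK[OF y(2)]])
    also have "\<dots> = inner (U' (U y)) (U' (D (U y')))" by (rule iso[OF UK[OF y(1)] DW[OF UK[OF y(2)]], symmetric])
    also have "\<dots> = inner y (S y')" using U'U[OF y(1)] by (simp add: S_def)
    finally show "inner (S y) y' = inner y (S y')" .
  next
    fix i assume i: "i < n * p"
    have "D (vv i) = vv (i + p)" using p by (simp add: vv_def Dz mod_p)
    then show "S (v i) = v (i + p)" using i U(2)[of i] U'(2)[of "i + p"] by (simp add: S_def)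
  qed
  have pow: "(S ^^ k) (v a) = U' (z k a)" if a: "a < p" for k a
  proof (induction k)
    case 0
    then show ?case using U'(2)[of a] a by (simp add: vv_def)
  next
    case (Suc k)
    then show ?case using UU'[OF zW[OF a]] Dz[OF a] by (simp add: S_def)
  qed
  have mom: "(\<Sum>j = 1..l. (x j - t) ^ k * A j $$ (a, b)) = inner ((S ^^ k) (v a)) (v b)" if ab: "a < p" "b < p" for k a b
  proof -
    have "inner ((S ^^ k) (v a)) (v b) = inner (U' (z k a)) (U' (z 0 b))"
      using pow[OF ab(1), of k] pow[OF ab(2), of 0] by simp
    also have "\<dots> = inner (z k a) (z 0 b)" by (rule iso[OF zW[OF ab(1)] zW[OF ab(2)]])
    finally show ?thesis using ab by (simp add: zI)
  qed
  \<comment> \<open>Selects the block of the atom \<open>t\<close>, and is 0 if \<open>t\<close> is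
    no atom; as the atoms are distinct, at most one summand survives.\<close>
  define g where "g = (\<lambda>a. \<Sum>j<l. if r j = 0 then w j a else 0)"
  have gw: "g a = w j a" if "j < l" "r j = 0" for a j
  proof -
    have "g a = (\<Sum>i<l. if i = j then w j a else 0)"
      unfolding g_def
    proof (rule sum.cong[OF refl])
      fix i assume "i \<in> {..<l}"
      then show "(if r i = 0 then w i a else 0) = (if i = j then w j a else 0)"
        using r_inj[of i j] that by (cases "r i = 0") auto
    qed
    then show ?thesis using that by simp
  qed
  have gW: "g a \<in> span W" if "a < p" for a unfolding g_def
    using that by (intro real_vector.span_sum) (auto intro: real_vector.span_base wW real_vector.span_zero)
  have Dg: "D (g a) = 0" if "a < p" for a unfolding g_def
    using that by (auto simp: linear_sum[OF D] Dw linear_0[OF D] intro!: sum.neutral)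
  \<comment> \<open>On every other block \<open>D\<close> is a nonzero scalar, so self-adjointness
    makes a kernel vector orthogonal to that block.\<close>
  have kerD: "y \<in> span (g ` {..<p})" if y: "y \<in> {y \<in> span W. D y = 0}" for y
  proof (rule double_complement[OF _ _ subspace_kernel_on[OF D real_vector.subspace_span] y])
    show "findim (span (g ` {..<p}))" by (rule findim_span) simp
    show "span (g ` {..<p}) \<subseteq> {y \<in> span W. D y = 0}"
      by (rule real_vector.span_minimal[OF _ subspace_kernel_on[OF D real_vector.subspace_span]]) (auto simp: gW Dg)
    fix k assume k: "k \<in> {y \<in> span W. D y = 0}" "\<And>u. u \<in> span (g ` {..<p}) \<Longrightarrow> inner k u = 0"
    have "k = 0"
    proof (rule eq_0_if_orth_span[of k W])
      fix b assume "b \<in> W"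
      then obtain j a where ja: "j < l" "a < p" "b = w j a" unfolding W_def by auto
      show "inner k b = 0"
      proof (cases "r j = 0")
        case True
        have "g a \<in> span (g ` {..<p})" using ja by (intro real_vector.span_base) auto
        then show ?thesis using k(2) gw[OF ja(1) True, of a] ja(3) by simp
      next
        case False
        have "r j * inner k b = inner k (D b)" using ja by (simp add: Dw)
        also have "\<dots> = inner (D k) b"
          by (rule Dsym[symmetric]) (use k(1) ja wW in \<open>auto intro: real_vector.span_base\<close>)
        finally show ?thesis using k(1) False by simp
      qed
    qed (use k in simp)
    then show "inner y k = 0" by simp
  qed
  have ker: "{y \<in> K. S y = 0} = span ((\<lambda>a. U' (g a)) ` {..<p})"
  proof
    show "{y \<in> K. S y = 0} \<subseteq> span ((\<lambda>a. U' (g a)) ` {..<p})"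
    proof
      fix y assume "y \<in> {y \<in> K. S y = 0}"
      then have y: "y \<in> K" "U' (D (U y)) = 0" by (auto simp: S_def)
      have "inner (D (U y)) (D (U y)) = 0" using iso[OF DW[OF UK[OF y(1)]] DW[OF UK[OF y(1)]]] y(2) by simp
      then have "U y \<in> span (g ` {..<p})" using UK[OF y(1)] by (intro kerD) simp
      then have "U' (U y) \<in> U' ` span (g ` {..<p})" by (rule imageI)
      also have "U' ` span (g ` {..<p}) = span (U' ` g ` {..<p})" by (rule linear_span_image[OF U'(1), symmetric])
      finally show "y \<in> span ((\<lambda>a. U' (g a)) ` {..<p})" using U'U[OF y(1)] by (simp add: image_image)
    qed
    show "span ((\<lambda>a. U' (g a)) ` {..<p}) \<subseteq> {y \<in> K. S y = 0}"
    proof (rule real_vector.span_minimal[OF _ subspace_kernel_on[OF linS K_sub]], rule image_subsetI)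
      fix a assume "a \<in> {..<p}"
      then have a: "a < p" by simp
      have "S (U' (g a)) = 0" unfolding S_def UU'[OF gW[OF a]] Dg[OF a] by (rule linear_0[OF U'(1)])
      then show "U' (g a) \<in> {y \<in> K. S y = 0}" using U'W[OF gW[OF a]] by simp
    qed
  qed
  \<comment> \<open>The mass at \<open>t\<close> is the Gram matrix of a family that spans the
    kernel of \<open>S\<close>, so its rank is the nullity.\<close>
  have "mat_rank (atomic_measure p l x A {t}) = dim (span ((\<lambda>a. U' (g a)) ` {..<p}))"
  proof (rule mat_rank_gram)
    show "atomic_measure p l x A {t} \<in> carrier_mat p p" by (simp add: atomic_measure_def)
    fix a b assume ab: "a < p" "b < p"
    have "inner (U' (g a)) (U' (g b)) = inner (g a) (g b)" by (rule iso[OF gW[OF ab(1)] gW[OF ab(2)]])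
    also have "\<dots> = (\<Sum>i<l. \<Sum>j<l. if i = j then (if r i = 0 then A (Suc i) $$ (a, b) else 0) else 0)"
      unfolding g_def inner_sum_left unfolding inner_sum_right
      using ab by (intro sum.cong refl) (auto simp: wI)
    also have "\<dots> = (\<Sum>i<l. if r i = 0 then A (Suc i) $$ (a, b) else 0)" by (intro sum.cong refl) simp
    also have "\<dots> = (\<Sum>j = 1..l. indicator {t} (x j) * A j $$ (a, b))"
      unfolding One_nat_def sum.atLeast1_atMost_eq by (intro sum.cong refl) (auto simp: r_def indicator_def)
    also have "\<dots> = atomic_measure p l x A {t} $$ (a, b)" by (rule atomic.measure_index[OF at _ ab, symmetric]) simp
    finally show "atomic_measure p l x A {t} $$ (a, b) = inner (U' (g a)) (U' (g b))" ..
  qed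
  then have "mult_at (atomic_measure p l x A) t = nullity S" unfolding mult_at_def nullity_def ker .
  then show ?thesis using ext mom by (intro exI[of _ S]) simp
qed

end

section \<open>The sets of pivot indices\<close>

lemma block_mat_index:
  "a < r * p \<Longrightarrow> b < c * p \<Longrightarrow> block_mat p r c F $$ (a, b) = F (a div p) (b div p) $$ (a mod p, b mod p)"
  by (simp add: block_mat_def)

lemma block_mat_carrier: "block_mat p r c F \<in> carrier_mat (r * p) (c * p)"
  by (simp add: block_mat_def)

lemma image_pred_shift: "(\<lambda>k. v (k - 1)) ` {a + 1..b} = v ` {a..<b}" for v :: "nat \<Rightarrow> 'a"
proof -
  have "(\<lambda>k. k - 1) ` {a + 1..b} = {a..<b}"
  proof (rule Set.set_eqI, rule iffI)
    fix x assume "x \<in> {a..<b}"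
    then show "x \<in> (\<lambda>k. k - 1) ` {a + 1..b}" by (intro image_eqI[of _ _ "x + 1"]) auto
  qed auto
  then show ?thesis by (metis image_image)
qed

context hankel_vectors
begin

text \<open>These copies of the objects in the theorem live in the context of fixed Gram vectors.
  Columns \<open>y\<close> and \<open>u\<close> are numbered from 1 as there, matrix columns from 0,
  hence the later \<open>j - 1\<close>.\<close>

definition "M1 = block_mat p (n + 1) (n + 1) (\<lambda>i j. L ([:- t, 1:] ^ (i + j)))"
definition "M2 = block_mat p n (n + 2) (\<lambda>i j. L ([:- t, 1:] ^ (i + j)))"
definition "H = block_mat p n n (\<lambda>i j. L ([:- t, 1:] ^ (i + j + 1)))"
definition "y = (\<lambda>j. col M1 (j - 1))"
definition "u = (\<lambda>j. col M2 (j - 1))"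

lemma y_carrier: "y l \<in> carrier_vec ((n + 1) * p)" and u_carrier: "u l \<in> carrier_vec (n * p)"
  by (rule carrier_vecI, simp add: y_def u_def M1_def M2_def block_mat_def)+

lemma y_index:
  assumes "1 \<le> l" "l \<le> n * p + p" "a < n * p + p"
  shows "y l $ a = inner (v a) (v (l - 1))"
proof -
  have "y l $ a = M1 $$ (a, l - 1)"
    using assms block_mat_carrier[of p "n + 1" "n + 1"] unfolding y_def M1_def by (subst index_col) (auto simp: block_mat_def)
  also have "\<dots> = shifted_entry p t L a (l - 1)"
    unfolding M1_def using assms by (subst block_mat_index) (auto simp: shifted_entry_def)
  finally show ?thesis using gram[of a "l - 1"] assms by simp
qed

text \<open>By the Hankel property a column of the second matrix lists the inner products of
  \<open>v r\<close> with \<open>v (a + p)\<close> for \<open>a < n * p\<close>. These vectors span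
  \<open>R\<close>, so the column determines \<open>v r\<close> modulo \<open>G\<close>.\<close>

lemma u_index:
  assumes "r < n * p + p" "a < n * p"
  shows "u (p + 1 + r) $ a = inner (v (a + p)) (v r)"
proof -
  have "u (p + 1 + r) $ a = M2 $$ (a, p + r)"
    using assms unfolding u_def M2_def by (subst index_col) (auto simp: block_mat_def)
  also have "\<dots> = shifted_entry p t L a (r + p)"
    unfolding M2_def using assms by (subst block_mat_index) (auto simp: shifted_entry_def add.commute)
  finally show ?thesis using gram[of "a + p" r] assms shifted_entry_shift[OF p, of t L a r] by simp
qed

text \<open>A column of the first matrix lists the inner products of one Gram vector with a spanning
  family of \<open>K\<close>, so the columns satisfy the same linear relations as the
  vectors.\<close>

lemma y_lincomb_iff:
  assumes I: "I \<subseteq> {1..n * p + p}" and l: "1 \<le> l" "l \<le> n * p + p"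
  shows "is_lincomb ((n + 1) * p) y I (y l) \<longleftrightarrow> v (l - 1) \<in> span ((\<lambda>k. v (k - 1)) ` I)"
proof -
  have fI: "finite I" using I finite_subset by blast
  have "(\<forall>r<(n + 1) * p. y l $ r = (\<Sum>k\<in>I. \<gamma> k * y k $ r)) \<longleftrightarrow> v (l - 1) = (\<Sum>k\<in>I. \<gamma> k *\<^sub>R v (k - 1))" for \<gamma>
  proof -
    define w where "w = v (l - 1) - (\<Sum>k\<in>I. \<gamma> k *\<^sub>R v (k - 1))"
    have wK: "w \<in> K" unfolding w_def K_def
    proof (rule real_vector.span_diff, rule real_vector.span_base)
      show "(\<Sum>k\<in>I. \<gamma> k *\<^sub>R v (k - 1)) \<in> span (v ` {..<n * p + p})"
        by (rule real_vector.span_sum, rule real_vector.span_scale, rule real_vector.span_base) (use I in force)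
    qed (use l in auto)
    have e: "inner (v r) w = y l $ r - (\<Sum>k\<in>I. \<gamma> k * y k $ r)" if "r < n * p + p" for r
    proof -
      have "(\<Sum>k\<in>I. \<gamma> k * y k $ r) = (\<Sum>k\<in>I. \<gamma> k * inner (v r) (v (k - 1)))"
        using I that by (intro sum.cong) (auto simp: y_index subset_eq)
      then show ?thesis using y_index[OF l that] by (simp add: w_def inner_diff_right inner_sum_right)
    qed
    have "w = 0 \<longleftrightarrow> (\<forall>r<n * p + p. inner (v r) w = 0)" using K_orth_0[OF wK] by auto
    then show ?thesis using e by (auto simp: w_def)
  qed
  then show ?thesis
    unfolding is_lincomb_iff[OF fI y_carrier y_carrier] span_image_explicit[OF fI] by simp
qed

text \<open>Relations among these columns are relations among the \<open>v r\<close> after pairing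
  with \<open>R\<close>, that is, up to an element of \<open>G\<close>. Starting the columns at
  \<open>p + 1\<close> corresponds to starting the vectors at \<open>v 0\<close>.\<close>

lemma u_lincomb_iff:
  assumes r0: "r0 < n * p + p"
  shows "is_lincomb (n * p) u {p + 1..p + r0} (u (p + 1 + r0)) \<longleftrightarrow> v r0 \<in> span (G \<union> v ` {..<r0})"
proof -
  have im: "{p + 1..p + r0} = (\<lambda>r. p + 1 + r) ` {..<r0}"
  proof (rule Set.set_eqI, rule iffI)
    fix x assume "x \<in> {p + 1..p + r0}"
    then show "x \<in> (\<lambda>r. p + 1 + r) ` {..<r0}" by (intro image_eqI[of _ _ "x - p - 1"]) auto
  qed auto
  have s: "(\<Sum>l\<in>{p + 1..p + r0}. f l) = (\<Sum>r<r0. f (p + 1 + r))" for f :: "nat \<Rightarrow> real"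
    unfolding im by (subst sum.reindex) (auto simp: inj_on_def)
  define w where "w = (\<lambda>\<delta>. v r0 - (\<Sum>r<r0. \<delta> r *\<^sub>R v r))"
  have wK: "w \<delta> \<in> K" for \<delta>
    unfolding w_def K_def
  proof (rule real_vector.span_diff, rule real_vector.span_base)
    show "(\<Sum>r<r0. \<delta> r *\<^sub>R v r) \<in> span (v ` {..<n * p + p})"
      by (rule real_vector.span_sum, rule real_vector.span_scale, rule real_vector.span_base) (use r0 in auto)
  qed (use r0 in auto)
  have e: "inner (v (a + p)) (w \<delta>) = u (p + 1 + r0) $ a - (\<Sum>r<r0. \<delta> r * u (p + 1 + r) $ a)" if "a < n * p" for a \<delta>
  proof -
    have "(\<Sum>r<r0. \<delta> r * u (p + 1 + r) $ a) = (\<Sum>r<r0. \<delta> r * inner (v (a + p)) (v r))"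
    proof (rule sum.cong[OF refl])
      fix r assume "r \<in> {..<r0}"
      then have "u (p + 1 + r) $ a = inner (v (a + p)) (v r)" using r0 that by (intro u_index) auto
      then show "\<delta> r * u (p + 1 + r) $ a = \<delta> r * inner (v (a + p)) (v r)" by (simp only:)
    qed
    then show ?thesis using u_index[OF r0 that] by (simp add: w_def inner_diff_right inner_sum_right)
  qed
  have wG: "w \<delta> \<in> G \<longleftrightarrow> (\<forall>a<n * p. u (p + 1 + r0) $ a = (\<Sum>r<r0. \<delta> r * u (p + 1 + r) $ a))" for \<delta>
  proof -
    have "w \<delta> \<in> G \<longleftrightarrow> (\<forall>l\<in>{p..<n * p + p}. inner (v l) (w \<delta>) = 0)" using wK by (simp add: G_def inner_commute)
    also have "\<dots> \<longleftrightarrow> (\<forall>a<n * p. inner (v (a + p)) (w \<delta>) = 0)"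
    proof safe
      fix l assume "\<forall>a<n * p. inner (v (a + p)) (w \<delta>) = 0" "l \<in> {p..<n * p + p}"
      then show "inner (v l) (w \<delta>) = 0" by (metis add.commute atLeastLessThan_iff le_add_diff_inverse less_diff_conv2)
    qed auto
    finally show ?thesis using e by auto
  qed
  have iff: "is_lincomb (n * p) u {p + 1..p + r0} (u (p + 1 + r0)) \<longleftrightarrow>
      (\<exists>\<gamma>. \<forall>a<n * p. u (p + 1 + r0) $ a = (\<Sum>l\<in>{p + 1..p + r0}. \<gamma> l * u l $ a))"
    by (rule is_lincomb_iff) (auto simp: u_carrier)
  show ?thesis
  proof
    assume "is_lincomb (n * p) u {p + 1..p + r0} (u (p + 1 + r0))"
    then obtain \<gamma> where \<gamma>: "\<forall>a<n * p. u (p + 1 + r0) $ a = (\<Sum>l\<in>{p + 1..p + r0}. \<gamma> l * u l $ a)"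
      unfolding iff by blast
    then have "w (\<lambda>r. \<gamma> (p + 1 + r)) \<in> G" unfolding wG s by simp
    then have g: "w (\<lambda>r. \<gamma> (p + 1 + r)) \<in> span (G \<union> v ` {..<r0})" by (intro real_vector.span_base) simp
    have "(\<Sum>r<r0. \<gamma> (p + 1 + r) *\<^sub>R v r) \<in> span (G \<union> v ` {..<r0})"
      by (rule real_vector.span_sum, rule real_vector.span_scale, rule real_vector.span_base) auto
    from real_vector.span_add[OF g this] show "v r0 \<in> span (G \<union> v ` {..<r0})" by (simp add: w_def)
  next
    assume "v r0 \<in> span (G \<union> v ` {..<r0})"
    then obtain g s' where gs: "v r0 = g + s'" "g \<in> span G" "s' \<in> span (v ` {..<r0})"
      unfolding real_vector.span_Un by blast
    obtain \<delta> where d: "s' = (\<Sum>r<r0. \<delta> r *\<^sub>R v r)" using gs(3) span_image_explicit[of "{..<r0}" s' v] by auto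
    have "g \<in> G" using gs(2) G_sub by (metis real_vector.span_eq_iff)
    then have "w \<delta> \<in> G" using gs(1) d by (simp add: w_def)
    then have "\<forall>a<n * p. u (p + 1 + r0) $ a = (\<Sum>l\<in>{p + 1..p + r0}. \<delta> (l - p - 1) * u l $ a)"
      unfolding wG s by simp
    then show "is_lincomb (n * p) u {p + 1..p + r0} (u (p + 1 + r0))"
      unfolding iff by (rule exI[of _ "\<lambda>l. \<delta> (l - p - 1)"])
  qed
qed

lemma y_lincomb_interval:
  assumes "l < n * p + p" "a \<le> l"
  shows "is_lincomb ((n + 1) * p) y {a + 1..l} (y (l + 1)) \<longleftrightarrow> v l \<in> span (v ` {a..<l})"
  using y_lincomb_iff[of "{a + 1..l}" "l + 1"] assms image_pred_shift[of v a l] by auto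

definition "SA = {i \<in> {1..p}. \<exists>k \<in> {1..n}.
               is_lincomb ((n + 1) * p) y {p + 1..k * p + i - 1} (y (k * p + i)) \<and>
               \<not> is_lincomb ((n + 1) * p) y {1..(k - 1) * p + i - 1} (y ((k - 1) * p + i))}"
definition "SB = {i \<in> {1..p}.
               is_lincomb (n * p) u {p + 1..(n + 1) * p + i - 1} (u ((n + 1) * p + i)) \<and>
               \<not> is_lincomb ((n + 1) * p) y {1..n * p + i - 1} (y (n * p + i))}"
definition "SP = {i \<in> {1..p}. \<not> is_lincomb ((n + 1) * p) y {1..n * p + i - 1} (y (n * p + i))}"

lemma SA_cond:
  assumes i: "i \<in> {1..p}" and k: "k \<in> {1..n}"
  shows "is_lincomb ((n + 1) * p) y {p + 1..k * p + i - 1} (y (k * p + i)) \<and>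
       \<not> is_lincomb ((n + 1) * p) y {1..(k - 1) * p + i - 1} (y ((k - 1) * p + i)) \<longleftrightarrow> (k - 1) * p + (i - 1) \<in> A'"
proof -
  define l where "l = (k - 1) * p + (i - 1)"
  obtain k' where k': "k = Suc k'" using k by (cases k) auto
  have "k' < n" using k k' by simp
  then have "Suc k' * p \<le> n * p" by (intro mult_le_mono1) simp
  then have l: "l < n * p" using i k' by (auto simp: l_def)
  have e: "k * p + i - 1 = l + p" "k * p + i = l + p + 1" "(k - 1) * p + i - 1 = l" "(k - 1) * p + i = l + 1"
    using i by (auto simp: l_def k')
  show ?thesis unfolding e(1,3) unfolding e(2,4) l_def[symmetric]
    using y_lincomb_interval[of "l + p" p] y_lincomb_interval[of l 0] l
    by (auto simp: A'_def lessThan_atLeast0)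
qed

lemma pivot_cond:
  assumes i: "i \<in> {1..p}"
  shows "is_lincomb ((n + 1) * p) y {1..n * p + i - 1} (y (n * p + i)) \<longleftrightarrow> \<not> pivot (n * p + (i - 1))"
proof -
  have "i - 1 < p" "n * p + i - 1 = n * p + (i - 1)" "n * p + i = n * p + (i - 1) + 1" using i by auto
  then show ?thesis using y_lincomb_interval[of "n * p + (i - 1)" 0] by (metis add_0 add_less_cancel_left lessThan_atLeast0 zero_le)
qed

lemma SB_cond:
  assumes i: "i \<in> {1..p}"
  shows "is_lincomb (n * p) u {p + 1..(n + 1) * p + i - 1} (u ((n + 1) * p + i)) \<longleftrightarrow>
    v (n * p + (i - 1)) \<in> span (G \<union> v ` {..<n * p + (i - 1)})"
proof -
  have e: "(n + 1) * p + i - 1 = p + (n * p + (i - 1))" "(n + 1) * p + i = p + 1 + (n * p + (i - 1))" using i by auto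
  show ?thesis unfolding e(1) unfolding e(2) by (rule u_lincomb_iff) (use i in auto)
qed

text \<open>One block after an index of \<open>A'\<close> the vector depends on its predecessors,
  and the dependence propagates, so no later index at the same position is a pivot. Hence each
  element of \<open>SA\<close> comes from a single \<open>k\<close>.\<close>

lemma A'_unique:
  assumes "l \<in> A'" "l' \<in> A'" "l mod p = l' mod p" "l < l'"
  shows False
proof -
  obtain s where s: "l' = l + s * p"
    using assms(3,4) by (metis less_imp_le_nat mod_eq_nat1E mult.commute)
  then obtain s' where s': "s = Suc s'" using assms(4) by (cases s) auto
  have "\<not> pivot (l + p)" using assms(1) nonpivot_if[of "l + p"] by (simp add: A'_def)
  then have "\<not> pivot (l + p + s' * p)" using assms(2) s s' by (intro nonpivot_propagate) (auto simp: A'_def)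
  moreover have "l + p + s' * p = l'" using s s' by simp
  ultimately show False using assms(2) by (simp add: A'_def)
qed

lemma card_SA: "card SA = dim N0"
proof -
  have "SA = (\<lambda>l. l mod p + 1) ` A'"
  proof (rule Set.set_eqI, rule iffI)
    fix i assume "i \<in> SA"
    then obtain k where k: "k \<in> {1..n}" "i \<in> {1..p}" "(k - 1) * p + (i - 1) \<in> A'" unfolding SA_def using SA_cond by blast
    have m: "((k - 1) * p + (i - 1)) mod p = i - 1" using k(2) by (subst mod_mult_self3) auto
    have "i = ((k - 1) * p + (i - 1)) mod p + 1" unfolding m using k(2) by simp
    then show "i \<in> (\<lambda>l. l mod p + 1) ` A'" using k(3) by (rule image_eqI)
  next
    fix i assume "i \<in> (\<lambda>l. l mod p + 1) ` A'"
    then obtain l where l: "l \<in> A'" "i = l mod p + 1" by auto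
    have "l div p < n" using l(1) p by (subst div_less_iff_less_mult) (auto simp: A'_def)
    then have k: "l div p + 1 \<in> {1..n}" by auto
    have i: "i \<in> {1..p}" using l(2) mod_p[of l] by auto
    have "(l div p + 1 - 1) * p + (i - 1) = l" using l(2) by simp
    then have "(l div p + 1 - 1) * p + (i - 1) \<in> A'" using l(1) by simp
    then show "i \<in> SA"
      unfolding SA_def mem_Collect_eq by (intro conjI[OF i] bexI[OF _ k] SA_cond[OF i k, THEN iffD2])
  qed
  moreover have "inj_on (\<lambda>l. l mod p + 1) A'"
    by (rule inj_onI) (metis A'_unique add_right_cancel linorder_neqE_nat)
  ultimately show ?thesis using card_A' by (simp add: card_image)
qed

lemma SB_eq: "SB = (\<lambda>l. l - n * p + 1) ` B'"
proof (rule Set.set_eqI, rule iffI)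
  fix i assume "i \<in> SB"
  then have i: "i \<in> {1..p}" and "n * p + (i - 1) \<in> B'"
    using SB_cond[of i] pivot_cond[of i] by (auto simp: SB_def B'_def)
  then show "i \<in> (\<lambda>l. l - n * p + 1) ` B'" by (intro image_eqI[of _ _ "n * p + (i - 1)"]) auto
next
  fix i assume "i \<in> (\<lambda>l. l - n * p + 1) ` B'"
  then obtain l where l: "l \<in> B'" "i = l - n * p + 1" by auto
  then have i: "i \<in> {1..p}" "n * p + (i - 1) = l" by (auto simp: B'_def)
  then show "i \<in> SB" using SB_cond[OF i(1)] pivot_cond[OF i(1)] l(1) by (auto simp: SB_def B'_def)
qed

lemma card_SB: "card SB + dim V = dim (span (V \<union> G))"
proof -
  have "inj_on (\<lambda>l. l - n * p + 1) B'" by (rule inj_onI) (auto simp: B'_def)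
  then show ?thesis using card_B' by (simp add: SB_eq card_image)
qed

text \<open>For an element of \<open>SA\<close> the dependence propagates to the last block, where
  an element of \<open>SB\<close> must be a pivot.\<close>

lemma SA_SB_disjoint: "SA \<inter> SB = {}"
proof (rule equals0I)
  fix i assume "i \<in> SA \<inter> SB"
  then have "i \<in> SA" and B: "i \<in> SB" by auto
  then obtain k where k: "k \<in> {1..n}" "i \<in> {1..p}" "(k - 1) * p + (i - 1) \<in> A'" unfolding SA_def using SA_cond by blast
  let ?l = "(k - 1) * p + (i - 1)"
  have e: "?l + p + (n - k) * p = n * p + (i - 1)"
  proof -
    have "(k - 1) * p + p + (n - k) * p = (k - 1 + 1 + (n - k)) * p" by (simp add: distrib_right)
    also have "k - 1 + 1 + (n - k) = n" using k by auto
    finally show ?thesis by simp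
  qed
  have "\<not> pivot (?l + p)" using k(3) nonpivot_if[of "?l + p"] by (simp add: A'_def)
  then have "\<not> pivot (?l + p + (n - k) * p)" by (rule nonpivot_propagate) (use e k in auto)
  then have "\<not> pivot (n * p + (i - 1))" unfolding e .
  then show False using B pivot_cond[OF k(2)] by (simp add: SB_def)
qed

lemma card_SA_Un_SB: "card (SA \<union> SB) + dim V = dim N0 + dim (span (V \<union> G))"
proof -
  have "finite SA" "finite SB" by (simp_all add: SA_def SB_def)
  then show ?thesis using card_Un_disjoint[OF _ _ SA_SB_disjoint] card_SA card_SB by simp
qed

text \<open>Supplies condition (a): if \<open>V + G\<close> is all of \<open>K\<close>, every vector
  of the last block lies in the span of \<open>G\<close> and its predecessors.\<close>

lemma SB_full:
  assumes "span (V \<union> G) = K"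
  shows "SB = SP"
proof -
  have "v (n * p + (i - 1)) \<in> span (G \<union> v ` {..<n * p + (i - 1)})" if "i \<in> {1..p}" for i
  proof -
    have "v (n * p + (i - 1)) \<in> span (V \<union> G)" unfolding assms using that by (intro v_K) auto
    moreover have "V \<union> G \<subseteq> span (G \<union> v ` {..<n * p + (i - 1)})"
    proof (rule Un_least)
      show "V \<subseteq> span (G \<union> v ` {..<n * p + (i - 1)})" unfolding V_def by (rule real_vector.span_mono) auto
      show "G \<subseteq> span (G \<union> v ` {..<n * p + (i - 1)})" using real_vector.span_superset[of "G \<union> v ` {..<n * p + (i - 1)}"] by simp
    qed
    ultimately show ?thesis using real_vector.span_minimal[OF _ real_vector.subspace_span] by blast
  qed
  then show ?thesis using SB_cond by (auto simp: SB_def SP_def)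
qed

text \<open>For an empty list both sides are the whole space, in accordance with the convention for
  a matrix without columns.\<close>

lemma mat_of_cols_kernel:
  assumes "\<And>w. w \<in> set ws \<Longrightarrow> w \<in> carrier_vec d"
  shows "mat_kernel (transpose_mat (mat_of_cols d ws)) = {x \<in> carrier_vec d. \<forall>w\<in>set ws. scalar_prod w x = 0}"
proof -
  have row: "row (transpose_mat (mat_of_cols d ws)) k = ws ! k" if "k < length ws" for k
    using that assms[of "ws ! k"] by (simp add: row_transpose col_mat_of_cols)
  have index: "(transpose_mat (mat_of_cols d ws) *\<^sub>v x) $ k = scalar_prod (ws ! k) x" if "k < length ws" for k x
    using row[OF that] that by (subst index_mult_mat_vec) auto
  have "transpose_mat (mat_of_cols d ws) *\<^sub>v x = 0\<^sub>v (length ws) \<longleftrightarrow> (\<forall>w\<in>set ws. scalar_prod w x = 0)" for x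
  proof -
    have "transpose_mat (mat_of_cols d ws) *\<^sub>v x = 0\<^sub>v (length ws) \<longleftrightarrow>
        (\<forall>k<length ws. (transpose_mat (mat_of_cols d ws) *\<^sub>v x) $ k = 0)"
      by (simp add: vec_eq_iff del: index_mult_mat_vec)
    then show ?thesis using index by (simp add: all_set_conv_all_nth del: index_mult_mat_vec)
  qed
  then show ?thesis by (auto simp: mat_kernel_def)
qed

text \<open>A vector in the kernel of \<open>H\<close> is the coordinate vector of some element of
  \<open>V\<close> whose image under \<open>X\<close> is orthogonal to \<open>V\<close>. The two
  inclusions together add orthogonality to the last block, so the image is orthogonal to
  \<open>K\<close> and vanishes; \<open>VG_full_iff\<close> translates this.\<close>

lemma kernel_iff:
  assumes S: "S \<subseteq> {1..p}"
  shows "mat_kernel H \<subseteq> mat_kernel (transpose_mat (mat_of_cols (n * p)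
                (map (\<lambda>i. u ((n + 1) * p + i)) (sorted_list_of_set S)))) \<and>
         mat_kernel H \<subseteq> mat_kernel (transpose_mat (mat_of_cols (n * p)
                (map (\<lambda>i. u ((n + 1) * p + i)) (sorted_list_of_set ({1..p} - S))))) \<longleftrightarrow> span (V \<union> G) = K"
proof -
  have fS: "finite S" using S finite_subset by blast
  have Hc: "H \<in> carrier_mat (n * p) (n * p)" unfolding H_def by (rule block_mat_carrier)
  \<comment> \<open>The element of \<open>V\<close> with coefficient family \<open>x\<close>;
    several \<open>x\<close> may give the same element, since the \<open>v a\<close> may be
    dependent.\<close>
  define h where "h = (\<lambda>x :: real vec. \<Sum>a<n * p. (x $ a) *\<^sub>R v a)"
  have hV: "h x \<in> V" for x
    unfolding h_def by (rule real_vector.subspace_sum[OF V_sub]) (auto intro: real_vector.subspace_scale[OF V_sub] v_V)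
  have Xh: "inner (v r) (X (h x)) = (\<Sum>a<n * p. x $ a * inner (v r) (v (a + p)))" for r x
    unfolding h_def by (simp add: linear_sum[OF X(1)] linear_scale[OF X(1)] inner_sum_right X(2))
  have H_index: "H $$ (b, a) = inner (v b) (v (a + p))" if "a < n * p" "b < n * p" for a b
  proof -
    have "H $$ (b, a) = shifted_entry p t L b (a + p)"
      unfolding H_def using that p by (subst block_mat_index) (auto simp: shifted_entry_def)
    then show ?thesis using gram[of b "a + p"] that by simp
  qed
  have Hx: "H *\<^sub>v x = 0\<^sub>v (n * p) \<longleftrightarrow> (\<forall>b<n * p. inner (v b) (X (h x)) = 0)" if x: "x \<in> carrier_vec (n * p)" for x
  proof -
    have "(H *\<^sub>v x) $ b = inner (v b) (X (h x))" if b: "b < n * p" for b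
    proof -
      have "(H *\<^sub>v x) $ b = (\<Sum>a<n * p. H $$ (b, a) * x $ a)"
        using Hc x b by (auto simp: scalar_prod_def lessThan_atLeast0 intro!: sum.cong)
      also have "\<dots> = inner (v b) (X (h x))" unfolding Xh using b by (intro sum.cong) (auto simp: H_index)
      finally show ?thesis .
    qed
    then show ?thesis using Hc by (auto simp: vec_eq_iff)
  qed
  have kerH: "mat_kernel H = {x \<in> carrier_vec (n * p). \<forall>b<n * p. inner (v b) (X (h x)) = 0}"
    using Hx Hc by (auto simp: mat_kernel_def)
  have ux: "scalar_prod (u ((n + 1) * p + i)) x = inner (v (n * p + (i - 1))) (X (h x))"
    if i: "i \<in> {1..p}" and x: "x \<in> carrier_vec (n * p)" for i x
  proof -
    have e: "(n + 1) * p + i = p + 1 + (n * p + (i - 1))" using i by auto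
    have "scalar_prod (u ((n + 1) * p + i)) x = (\<Sum>a<n * p. u (p + 1 + (n * p + (i - 1))) $ a * x $ a)"
      unfolding e using x by (simp add: scalar_prod_def lessThan_atLeast0)
    also have "\<dots> = inner (v (n * p + (i - 1))) (X (h x))"
      unfolding Xh
    proof (rule sum.cong[OF refl])
      fix a assume "a \<in> {..<n * p}"
      then have "u (p + 1 + (n * p + (i - 1))) $ a = inner (v (a + p)) (v (n * p + (i - 1)))"
        using i by (intro u_index) auto
      then show "u (p + 1 + (n * p + (i - 1))) $ a * x $ a = x $ a * inner (v (n * p + (i - 1))) (v (a + p))"
        by (metis inner_commute mult.commute)
    qed
    finally show ?thesis .
  qed
  have sub: "mat_kernel H \<subseteq> mat_kernel (transpose_mat (mat_of_cols (n * p)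
                (map (\<lambda>i. u ((n + 1) * p + i)) (sorted_list_of_set Q)))) \<longleftrightarrow>
      (\<forall>x \<in> mat_kernel H. \<forall>i\<in>Q. inner (v (n * p + (i - 1))) (X (h x)) = 0)" if Q: "Q \<subseteq> {1..p}" for Q
  proof -
    have fQ: "finite Q" using Q finite_subset by blast
    have k: "mat_kernel (transpose_mat (mat_of_cols (n * p) (map (\<lambda>i. u ((n + 1) * p + i)) (sorted_list_of_set Q))))
        = {x \<in> carrier_vec (n * p). \<forall>i\<in>Q. scalar_prod (u ((n + 1) * p + i)) x = 0}"
      using fQ by (subst mat_of_cols_kernel) (auto simp: u_carrier)
    have c: "x \<in> carrier_vec (n * p)" if "x \<in> mat_kernel H" for x using that by (simp add: kerH)
    have e: "scalar_prod (u ((n + 1) * p + i)) x = inner (v (n * p + (i - 1))) (X (h x))"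
      if "x \<in> mat_kernel H" "i \<in> Q" for x i
      by (rule ux) (use that c Q in auto)
    show ?thesis unfolding k
    proof (intro iffI ballI subsetI)
      fix x i assume "mat_kernel H \<subseteq> {x \<in> carrier_vec (n * p). \<forall>i\<in>Q. scalar_prod (u ((n + 1) * p + i)) x = 0}"
        and x: "x \<in> mat_kernel H" "i \<in> Q"
      then have "scalar_prod (u ((n + 1) * p + i)) x = 0" by blast
      then show "inner (v (n * p + (i - 1))) (X (h x)) = 0" unfolding e[OF x] .
    next
      fix x assume *: "\<forall>x\<in>mat_kernel H. \<forall>i\<in>Q. inner (v (n * p + (i - 1))) (X (h x)) = 0" and x: "x \<in> mat_kernel H"
      have "scalar_prod (u ((n + 1) * p + i)) x = 0" if "i \<in> Q" for i unfolding e[OF x that] using * x that by blast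
      then show "x \<in> {x \<in> carrier_vec (n * p). \<forall>i\<in>Q. scalar_prod (u ((n + 1) * p + i)) x = 0}" using c[OF x] by blast
    qed
  qed
  have "mat_kernel H \<subseteq> mat_kernel (transpose_mat (mat_of_cols (n * p)
                (map (\<lambda>i. u ((n + 1) * p + i)) (sorted_list_of_set S)))) \<and>
         mat_kernel H \<subseteq> mat_kernel (transpose_mat (mat_of_cols (n * p)
                (map (\<lambda>i. u ((n + 1) * p + i)) (sorted_list_of_set ({1..p} - S)))))
      \<longleftrightarrow> (\<forall>x \<in> mat_kernel H. \<forall>i\<in>{1..p}. inner (v (n * p + (i - 1))) (X (h x)) = 0)"
  proof -
    have "(\<forall>x\<in>Q. \<forall>i\<in>S. P x i) \<and> (\<forall>x\<in>Q. \<forall>i\<in>{1..p} - S. P x i) \<longleftrightarrow> (\<forall>x\<in>Q. \<forall>i\<in>{1..p}. P x i)"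
      for Q :: "real vec set" and P
      using S by blast
    then show ?thesis unfolding sub[OF S] sub[OF Diff_subset] .
  qed
  also have "\<dots> \<longleftrightarrow> (\<forall>h\<in>V. (\<forall>y\<in>V. inner (X h) y = 0) \<longrightarrow> X h = 0)"
  proof (intro iffI ballI impI)
    fix g assume *: "\<forall>x \<in> mat_kernel H. \<forall>i\<in>{1..p}. inner (v (n * p + (i - 1))) (X (h x)) = 0"
      and g: "g \<in> V" "\<forall>y\<in>V. inner (X g) y = 0"
    obtain c where c: "g = (\<Sum>a<n * p. c a *\<^sub>R v a)"
      using g(1) unfolding V_def span_image_explicit[OF finite_lessThan] by blast
    define x where "x = vec (n * p) c"
    have hx: "h x = g" unfolding h_def c x_def by (intro sum.cong) auto
    have xc: "x \<in> carrier_vec (n * p)" by (simp add: x_def)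
    have "x \<in> mat_kernel H" unfolding kerH mem_Collect_eq hx using xc g(2) v_V by (auto simp: inner_commute)
    then have k: "\<forall>i\<in>{1..p}. inner (v (n * p + (i - 1))) (X g) = 0" using * hx by auto
    show "X g = 0"
    proof (rule K_orth_0)
      show "X g \<in> K" using X_V R_K g(1) by auto
      fix l assume l: "l < n * p + p"
      show "inner (v l) (X g) = 0"
      proof (cases "l < n * p")
        case True
        then show ?thesis using g(2) v_V by (subst inner_commute) simp
      next
        case False
        then have i: "l - n * p + 1 \<in> {1..p}" and e: "n * p + (l - n * p + 1 - 1) = l" using l by auto
        show ?thesis using k[rule_format, OF i] unfolding e .
      qed
    qed
  next
    fix x i assume *: "\<forall>h\<in>V. (\<forall>y\<in>V. inner (X h) y = 0) \<longrightarrow> X h = 0" and x: "x \<in> mat_kernel H" and i: "i \<in> {1..p}"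
    have xb: "inner (X (h x)) (v b) = 0" if "b < n * p" for b
      using x that unfolding kerH by (subst inner_commute) blast
    have z: "inner (X (h x)) z = 0" if "z \<in> V" for z
      by (rule inner_span_0[OF _ that[unfolded V_def]]) (use xb in auto)
    have "X (h x) = 0" by (rule *[rule_format, OF hV]) (rule z)
    then show "inner (v (n * p + (i - 1))) (X (h x)) = 0" by simp
  qed
  finally show ?thesis using VG_full_iff by simp
qed

section \<open>The correspondence and the theorem\<close>

text \<open>Moments of all orders are matched, beyond those that \<open>L\<close> prescribes: order
  \<open>2 * n + 1\<close> fixes \<open>S\<close> on \<open>K\<close>, and all orders together fix
  the measure.\<close>

definition spectral_measure :: "(fseq \<Rightarrow> fseq) \<Rightarrow> (real set \<Rightarrow> real mat) \<Rightarrow> bool" where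
  "spectral_measure S \<mu> \<longleftrightarrow> mult_at \<mu> t = nullity S \<and>
     (\<exists>l x A. atomic p l x A \<and> \<mu> = atomic_measure p l x A \<and>
       (\<forall>k a b. a < p \<longrightarrow> b < p \<longrightarrow> (\<Sum>j = 1..l. (x j - t) ^ k * A j $$ (a, b)) = inner ((S ^^ k) (v a)) (v b)))"

lemma spectral_measure_exists:
  assumes S: "ext S"
  shows "\<exists>\<mu>. minimal_measure p n L \<mu> \<and> spectral_measure S \<mu>"
proof -
  obtain l x A where at: "atomic p l x A" and nz: "\<forall>j\<in>{1..l}. A j \<noteq> 0\<^sub>m p p"
    and rank: "(\<Sum>j = 1..l. mat_rank (A j)) = dim K"
    and mult: "mult_at (atomic_measure p l x A) t = nullity S"
    and mom: "\<forall>k a b. a < p \<longrightarrow> b < p \<longrightarrow> (\<Sum>j = 1..l. (x j - t) ^ k * A j $$ (a, b)) = inner ((S ^^ k) (v a)) (v b)"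
    using measure_of_ext[OF S] by (elim exE conjE)
  have "representing_measure p (2 * n) L (atomic_measure p l x A)"
    unfolding atomic.representing_iff[OF at L, of t] using ext_moment[OF S] mom by simp
  then have "minimal_measure p n L (atomic_measure p l x A)"
    unfolding minimal_measure_def mat_rank_moment_matrix
    using nz rank atomic.inj[OF at] atomic.psd[OF at]
    by (intro conjI exI[of _ l] exI[of _ x] exI[of _ A]) simp_all
  moreover have "spectral_measure S (atomic_measure p l x A)"
    unfolding spectral_measure_def by (intro conjI mult exI[of _ l] exI[of _ x] exI[of _ A] at refl mom)
  ultimately show ?thesis by (intro exI conjI)
qed

lemma ext_exists:
  assumes "minimal_measure p n L \<mu>"
  shows "\<exists>S. ext S \<and> spectral_measure S \<mu>"
proof -
  have rep: "representing_measure p (2 * n) L \<mu>" using assms by (simp add: minimal_measure_def)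
  obtain l x A where A: "inj_on x {1..l}" "\<forall>j\<in>{1..l}. psd p (A j) \<and> A j \<noteq> 0\<^sub>m p p"
    and \<mu>: "\<mu> = atomic_measure p l x A" and rank: "(\<Sum>j = 1..l. mat_rank (A j)) = dim K"
    using assms unfolding minimal_measure_def mat_rank_moment_matrix by (elim exE conjE)
  have at: "atomic p l x A" by (rule atomic.intro) (use A in auto)
  have "\<exists>S. ext S \<and> mult_at (atomic_measure p l x A) t = nullity S \<and>
    (\<forall>k a b. a < p \<longrightarrow> b < p \<longrightarrow> (\<Sum>j = 1..l. (x j - t) ^ k * A j $$ (a, b)) = inner ((S ^^ k) (v a)) (v b))"
    by (rule ext_of_measure[OF at _ rank])
      (use rep[unfolded \<mu> atomic.representing_iff[OF at L, of t]] in simp)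
  then obtain S where S: "ext S" and mult: "mult_at (atomic_measure p l x A) t = nullity S"
    and mom: "\<forall>k a b. a < p \<longrightarrow> b < p \<longrightarrow> (\<Sum>j = 1..l. (x j - t) ^ k * A j $$ (a, b)) = inner ((S ^^ k) (v a)) (v b)"
    by (elim exE conjE)
  have "spectral_measure S \<mu>"
    unfolding spectral_measure_def \<mu> by (intro conjI mult exI[of _ l] exI[of _ x] exI[of _ A] at refl mom)
  then show ?thesis using S by (intro exI conjI)
qed

text \<open>Expressed as an integral, a moment depends only on \<open>\<mu>\<close> and no longer on
  the chosen list of atoms and masses.\<close>

lemma spectral_measure_moment:
  assumes "spectral_measure S \<mu>" "a < p" "b < p"
  shows "signed_integral (\<lambda>D. \<mu> D $$ (a, b)) (poly ([:- t, 1:] ^ k)) = inner ((S ^^ k) (v a)) (v b)"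
proof -
  obtain l x A where at: "atomic p l x A" and \<mu>: "\<mu> = atomic_measure p l x A"
    and mom: "\<forall>k a b. a < p \<longrightarrow> b < p \<longrightarrow> (\<Sum>j = 1..l. (x j - t) ^ k * A j $$ (a, b)) = inner ((S ^^ k) (v a)) (v b)"
    using assms(1) unfolding spectral_measure_def by (elim exE conjE)
  show ?thesis
    using atomic.integral[OF at borel_measurable_poly assms(2,3), of "[:- t, 1:] ^ k"] mom assms(2,3) by (simp add: \<mu>)
qed

text \<open>The moments of all orders are the link: they determine \<open>S\<close> on
  \<open>K\<close> by \<open>ext_determined\<close> and the measure by
  \<open>atomic_measure_eqI\<close>.\<close>

lemma spectral_measure_unique:
  assumes S: "ext S" "ext S'" and \<mu>: "spectral_measure S \<mu>" "spectral_measure S' \<mu>'"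
  shows "\<mu> = \<mu>' \<longleftrightarrow> (\<forall>x\<in>K. S x = S' x)"
proof
  assume eq: "\<mu> = \<mu>'"
  show "\<forall>x\<in>K. S x = S' x"
    by (intro ballI ext_determined[OF S])
      (simp_all add: spectral_measure_moment[OF \<mu>(1), symmetric] spectral_measure_moment[OF \<mu>(2), symmetric] eq)
next
  assume eq: "\<forall>x\<in>K. S x = S' x"
  have pow: "(S ^^ k) (v a) = (S' ^^ k) (v a)" if a: "a < p" for k a
  proof (induction k)
    case (Suc k)
    then show ?case using eq ext_pow_K[OF S(2) v_K0[OF a], of k] by simp
  qed simp
  obtain l x A where at: "atomic p l x A" and \<mu>1: "\<mu> = atomic_measure p l x A"
    and mom: "\<forall>k a b. a < p \<longrightarrow> b < p \<longrightarrow> (\<Sum>j = 1..l. (x j - t) ^ k * A j $$ (a, b)) = inner ((S ^^ k) (v a)) (v b)"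
    using \<mu>(1) unfolding spectral_measure_def by (elim exE conjE)
  obtain l' x' A' where at': "atomic p l' x' A'" and \<mu>2: "\<mu>' = atomic_measure p l' x' A'"
    and mom': "\<forall>k a b. a < p \<longrightarrow> b < p \<longrightarrow> (\<Sum>j = 1..l'. (x' j - t) ^ k * A' j $$ (a, b)) = inner ((S' ^^ k) (v a)) (v b)"
    using \<mu>(2) unfolding spectral_measure_def by (elim exE conjE)
  show "\<mu> = \<mu>'" unfolding \<mu>1 \<mu>2
    by (rule atomic_measure_eqI[OF at at', of t]) (simp only: mom mom' pow)
qed

section \<open>Transfer of existence and uniqueness from operators to measures\<close>

lemma minimal_exists_iff:
  "(\<exists>\<mu>. minimal_measure p n L \<mu> \<and> mult_at \<mu> t = m) \<longleftrightarrow> (\<exists>S. ext S \<and> nullity S = m)"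
proof
  assume "\<exists>\<mu>. minimal_measure p n L \<mu> \<and> mult_at \<mu> t = m"
  then obtain \<mu> where \<mu>: "minimal_measure p n L \<mu>" "mult_at \<mu> t = m" by (elim exE conjE)
  obtain S where "ext S" "spectral_measure S \<mu>" using ext_exists[OF \<mu>(1)] by (elim exE conjE)
  then show "\<exists>S. ext S \<and> nullity S = m" using \<mu>(2) by (intro exI[of _ S]) (simp add: spectral_measure_def)
next
  assume "\<exists>S. ext S \<and> nullity S = m"
  then obtain S where S: "ext S" "nullity S = m" by (elim exE conjE)
  obtain \<mu> where "minimal_measure p n L \<mu>" "spectral_measure S \<mu>" using spectral_measure_exists[OF S(1)] by (elim exE conjE)
  then show "\<exists>\<mu>. minimal_measure p n L \<mu> \<and> mult_at \<mu> t = m"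
    using S(2) by (intro exI[of _ \<mu>]) (simp add: spectral_measure_def)
qed

lemma minimal_unique_iff:
  "(\<forall>\<mu> \<mu>'. minimal_measure p n L \<mu> \<and> mult_at \<mu> t = m \<and> minimal_measure p n L \<mu>' \<and> mult_at \<mu>' t = m \<longrightarrow> \<mu> = \<mu>') \<longleftrightarrow>
   (\<forall>S S'. ext S \<and> nullity S = m \<and> ext S' \<and> nullity S' = m \<longrightarrow> (\<forall>x\<in>K. S x = S' x))"
proof (intro iffI allI impI; elim conjE)
  fix S S'
  assume un: "\<forall>\<mu> \<mu>'. minimal_measure p n L \<mu> \<and> mult_at \<mu> t = m \<and> minimal_measure p n L \<mu>' \<and> mult_at \<mu>' t = m \<longrightarrow> \<mu> = \<mu>'"
    and S: "ext S" "nullity S = m" "ext S'" "nullity S' = m"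
  obtain \<mu> where \<mu>: "minimal_measure p n L \<mu>" "spectral_measure S \<mu>" using spectral_measure_exists[OF S(1)] by (elim exE conjE)
  obtain \<mu>' where \<mu>': "minimal_measure p n L \<mu>'" "spectral_measure S' \<mu>'" using spectral_measure_exists[OF S(3)] by (elim exE conjE)
  have "mult_at \<mu> t = m" "mult_at \<mu>' t = m" using \<mu>(2) \<mu>'(2) S by (simp_all add: spectral_measure_def)
  then have "\<mu> = \<mu>'" using un[rule_format, of \<mu> \<mu>'] \<mu>(1) \<mu>'(1) by simp
  then show "\<forall>x\<in>K. S x = S' x" using spectral_measure_unique[OF S(1,3) \<mu>(2) \<mu>'(2)] by simp
next
  fix \<mu> \<mu>'
  assume un: "\<forall>S S'. ext S \<and> nullity S = m \<and> ext S' \<and> nullity S' = m \<longrightarrow> (\<forall>x\<in>K. S x = S' x)"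
    and \<mu>: "minimal_measure p n L \<mu>" "mult_at \<mu> t = m" "minimal_measure p n L \<mu>'" "mult_at \<mu>' t = m"
  obtain S where S: "ext S" "spectral_measure S \<mu>" using ext_exists[OF \<mu>(1)] by (elim exE conjE)
  obtain S' where S': "ext S'" "spectral_measure S' \<mu>'" using ext_exists[OF \<mu>(3)] by (elim exE conjE)
  have "nullity S = m" "nullity S' = m" using \<mu> S(2) S'(2) by (simp_all add: spectral_measure_def)
  then have "\<forall>x\<in>K. S x = S' x" using un[rule_format, of S S'] S(1) S'(1) by simp
  then show "\<mu> = \<mu>'" using spectral_measure_unique[OF S(1) S'(1) S(2) S'(2)] by simp
qed

lemma minimal_exists_iff_card:
  "(\<exists>\<mu>. minimal_measure p n L \<mu> \<and> mult_at \<mu> t = m) \<longleftrightarrow> card SA \<le> m \<and> m \<le> card (SA \<union> SB)"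
  unfolding minimal_exists_iff ext_exists_iff using card_SA card_SA_Un_SB by linarith

lemma minimal_unique_iff_card:
  "(\<exists>!\<mu>. minimal_measure p n L \<mu> \<and> mult_at \<mu> t = m) \<longleftrightarrow>
     SB = SP \<and> m = card (SA \<union> SB) \<and>
     mat_kernel H \<subseteq> mat_kernel (transpose_mat (mat_of_cols (n * p)
       (map (\<lambda>i. u ((n + 1) * p + i)) (sorted_list_of_set SB)))) \<and>
     mat_kernel H \<subseteq> mat_kernel (transpose_mat (mat_of_cols (n * p)
       (map (\<lambda>i. u ((n + 1) * p + i)) (sorted_list_of_set ({1..p} - SB)))))"
proof -
  have SB: "SB \<subseteq> {1..p}" by (auto simp: SB_def)
  have "(\<exists>!\<mu>. minimal_measure p n L \<mu> \<and> mult_at \<mu> t = m) \<longleftrightarrow>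
      (\<exists>\<mu>. minimal_measure p n L \<mu> \<and> mult_at \<mu> t = m) \<and>
      (\<forall>S S'. ext S \<and> nullity S = m \<and> ext S' \<and> nullity S' = m \<longrightarrow> (\<forall>x\<in>K. S x = S' x))"
    unfolding minimal_unique_iff[symmetric] by blast
  also have "\<dots> \<longleftrightarrow> span (V \<union> G) = K \<and> m = card (SA \<union> SB)"
  \<comment> \<open>Outside the admissible range no measure exists, and
    \<open>m = card (SA \<union> SB)\<close> is impossible because \<open>card SA\<close> is at most
    this number.\<close>
  proof (cases "card SA \<le> m \<and> m \<le> card (SA \<union> SB)")
    case True
    then have "dim N0 \<le> m" "m + dim V \<le> dim N0 + dim (span (V \<union> G))" using card_SA card_SA_Un_SB by linarith+
    from ext_unique_iff[OF this] show ?thesis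
      unfolding minimal_exists_iff_card using True card_SA_Un_SB by (simp del: real_vector.dim_span) linarith
  next
    case False
    moreover have "finite SA" "finite SB" by (simp_all add: SA_def SB_def)
    then have "card SA \<le> card (SA \<union> SB)" by (intro card_mono) auto
    ultimately show ?thesis unfolding minimal_exists_iff_card by auto
  qed
  also have "\<dots> \<longleftrightarrow> SB = SP \<and> m = card (SA \<union> SB) \<and> span (V \<union> G) = K" using SB_full by auto
  finally show ?thesis unfolding kernel_iff[OF SB, symmetric] .
qed

end

theorem theorem1p1:
  fixes n p m :: nat and t :: real
    and L :: "real poly \<Rightarrow> real mat"
    and T :: "nat \<Rightarrow> real mat"
    and M1 M2 H :: "real mat"
    and y u :: "nat \<Rightarrow> real vec"
    and A B :: "nat set"
  assumes "n \<ge> 1" and "p \<ge> 1"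
    and "linear_operator p (2 * n) L"
    and "\<exists>\<mu>. representing_measure p (2 * n) L \<mu>"
    and "T = (\<lambda>i. L ([:- t, 1:] ^ i))"
    and "M1 = block_mat p (n + 1) (n + 1) (\<lambda>i j. T (i + j))"
    and "M2 = block_mat p n (n + 2) (\<lambda>i j. T (i + j))"
    and "H = block_mat p n n (\<lambda>i j. T (i + j + 1))"
    and "y = (\<lambda>j. col M1 (j - 1))"
    and "u = (\<lambda>j. col M2 (j - 1))"
    and "A = {i \<in> {1..p}. \<exists>k \<in> {1..n}.
               is_lincomb ((n + 1) * p) y {p + 1..k * p + i - 1} (y (k * p + i)) \<and>
               \<not> is_lincomb ((n + 1) * p) y {1..(k - 1) * p + i - 1} (y ((k - 1) * p + i))}"
    and "B = {i \<in> {1..p}.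
               is_lincomb (n * p) u {p + 1..(n + 1) * p + i - 1} (u ((n + 1) * p + i)) \<and>
               \<not> is_lincomb ((n + 1) * p) y {1..n * p + i - 1} (y (n * p + i))}"
  shows "((\<exists>\<mu>. minimal_measure p n L \<mu> \<and> mult_at \<mu> t = m) \<longleftrightarrow>
            card A \<le> m \<and> m \<le> card (A \<union> B)) \<and>
         ((\<exists>!\<mu>. minimal_measure p n L \<mu> \<and> mult_at \<mu> t = m) \<longleftrightarrow>
            B = {i \<in> {1..p}.
                  \<not> is_lincomb ((n + 1) * p) y {1..n * p + i - 1} (y (n * p + i))} \<and>
            m = card (A \<union> B) \<and>
            mat_kernel H \<subseteq>
              mat_kernel (transpose_mat (mat_of_cols (n * p)
                (map (\<lambda>i. u ((n + 1) * p + i)) (sorted_list_of_set B)))) \<and>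
            mat_kernel H \<subseteq>
              mat_kernel (transpose_mat (mat_of_cols (n * p)
                (map (\<lambda>i. u ((n + 1) * p + i)) (sorted_list_of_set ({1..p} - B))))))"
proof -
  obtain \<nu> where "representing_measure p (2 * n) L \<nu>" using assms(4) ..
  from hankel_vectors_exist[OF assms(2,1,3) this, of t]
  obtain v X where hv: "hankel_vectors p n t L v X" by (elim exE)
  interpret hankel_vectors p n t L v X by (rule hv)
  have M1: "M1 = local.M1" and M2: "M2 = local.M2" and H: "H = local.H"
    by (simp_all only: assms M1_def M2_def H_def)
  have y: "y = local.y" and u: "u = local.u"
    by (simp_all only: assms(9,10) M1 M2 y_def u_def)
  have "A = SA" "B = SB" by (simp_all only: assms(11,12) y u SA_def SB_def)
  moreover have "{i \<in> {1..p}. \<not> is_lincomb ((n + 1) * p) y {1..n * p + i - 1} (y (n * p + i))} = SP"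
    by (simp only: y SP_def)
  ultimately show ?thesis unfolding H u y
    using minimal_exists_iff_card minimal_unique_iff_card by simp
qed

end
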